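(* Let $C\subset\mathbb{R}^d$ be a polyhedral cone, let $A$ be a conic Borel set, let $n\in\mathbb{N}$ and $k\in\{1,\dots,d\}$. Let $S_n$ be the isotropic random Schläfli cone with parameter $n$. Then $$\mathbb{E}\,\Phi_k(C\cap S_n,A)=\frac{1}{C(n,d)}\sum_{s=0}^{\min\{n,d-k\}}\binom{n}{s}\Phi_{k+s}(C,A).$$
   Context: Work in $\mathbb{R}^d$, $d\ge 2$. For a linear subspace $L$ of dimension $m$, $\gamma_L$ is the standard Gaussian measure on $L$. A set is conic if it is invariant under multiplication by every $\lambda>0$; a conic Borel set is a conic Borel subset of $\mathbb{R}^d$. A polyhedral cone is $\mathbb{R}^d$ or a finite intersection of closed halfspaces whose boundaries contain the origin; $\mathcal{F}_k(C)$ is its set of $k$-faces, $L(F)$ the linear hull of a face $F$, and $N(C,F)=\{y:\langle y,x\rangle\le0\ \forall x\in C,\ \langle y,x\rangle=0\ \forall x\in F\}$ its normal cone. Curvature measures: $\Phi_k(C,A)=\sum_{F\in\mathcal{F}_k(C)}\gamma_{L(F)}(F\cap A)\gamma_{L(F)^\perp}(N(C,F))$ (zero if there are no $k$-faces, in particular for $k>\dim C$). Linear hyperplanes $H_1,\dots,H_n$ are in general position if any $k\le d$ of them intersect in a subspace of dimension $d-k$; their Schläfli cones are the closures of the connected components of $\mathbb{R}^d\setminus\bigcup_i H_i$, and there are exactly $C(n,d):=2\sum_{r=0}^{d-1}\binom{n-1}{r}$ of them. The isotropic random Schläfli cone $S_n$ is obtained by taking $n$ independent random hyperplanes $u_1^\perp,\dots,u_n^\perp$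 with $u_i$ uniformly distributed on the unit sphere $\mathbb{S}^{d-1}$ (almost surely in general position) and choosing one of the $C(n,d)$ Schläfli cones uniformly at random. *)

theory Defs
  imports "HOL-Analysis.Analysis" "HOL-Probability.Probability"
begin

definition polyhedral_cone :: "'a::euclidean_space set \<Rightarrow> bool" where
  "polyhedral_cone C \<longleftrightarrow> (\<exists>U. finite U \<and> C = {x. \<forall>u\<in>U. inner u x \<le> 0})"

definition conic_set :: "'a::real_vector set \<Rightarrow> bool" where
  "conic_set A \<longleftrightarrow> (\<forall>x\<in>A. \<forall>t::real. t > 0 \<longrightarrow> t *\<^sub>R x \<in> A)"

definition kfaces :: "nat \<Rightarrow> 'a::euclidean_space set \<Rightarrow> 'a set set" where
  "kfaces k C = {F. F face_of C \<and> aff_dim F = int k}"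

definition normal_cone :: "'a::euclidean_space set \<Rightarrow> 'a set \<Rightarrow> 'a set" where
  "normal_cone C F = {y. (\<forall>x\<in>C. inner y x \<le> 0) \<and> (\<forall>x\<in>F. inner y x = 0)}"

definition std_gaussian :: "'a::euclidean_space measure" where
  "std_gaussian = density lborel
     (\<lambda>x. ennreal ((2 * pi) powr (- real DIM('a) / 2) * exp (- (norm x)\<^sup>2 / 2)))"

text \<open>Standard Gaussian measure on a linear subspace L, evaluated at B: the image of the
  standard Gaussian on the whole space under the orthogonal projection onto L, i.e. the
  Gaussian measure of the set of points whose orthogonal projection onto L lies in B.\<close>
definition gauss_on :: "'a::euclidean_space set \<Rightarrow> 'a set \<Rightarrow> real" where
  "gauss_on L B = measure std_gaussian {x. \<exists>y \<in> L \<inter> B. x - y \<in> orthogonal_comp L}"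

definition curv_measure :: "nat \<Rightarrow> 'a::euclidean_space set \<Rightarrow> 'a set \<Rightarrow> real" where
  "curv_measure k C A =
     (\<Sum>F\<in>kfaces k C. gauss_on (span F) (F \<inter> A) *
                      gauss_on (orthogonal_comp (span F)) (normal_cone C F))"

text \<open>Uniform distribution on the unit sphere (normalized spherical Lebesgue measure),
  given via the cone measure: sigma(B) = vol{t x : x in B, 0<t<=1} / vol(unit ball).\<close>
definition uniform_sphere :: "'a::euclidean_space measure" where
  "uniform_sphere = measure_of (sphere 0 1) (sets (restrict_space borel (sphere 0 1)))
     (\<lambda>B. emeasure lborel {t *\<^sub>R x | t x. x \<in> B \<and> 0 < t \<and> t \<le> 1} / emeasure lborel (ball (0::'a) 1))"

definition schlafli_cones :: "nat \<Rightarrow> (nat \<Rightarrow> 'a::euclidean_space) \<Rightarrow> 'a set set" where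
  "schlafli_cones n u = closure ` components (UNIV - (\<Union>i<n. {x. inner (u i) x = 0}))"

definition schlafli_count :: "nat \<Rightarrow> nat \<Rightarrow> nat" where
  "schlafli_count n d = 2 * (\<Sum>r<d. (n - 1) choose r)"

text \<open>Expected value of f(S_n) for the isotropic random Schlaefli cone S_n: average over the
  C(n,d) Schlaefli cones (chosen uniformly) of the random hyperplane arrangement, integrated
  against n i.i.d. uniform unit vectors.\<close>
definition random_schlafli_avg :: "nat \<Rightarrow> ('a::euclidean_space set \<Rightarrow> real) \<Rightarrow> (nat \<Rightarrow> 'a) \<Rightarrow> real" where
  "random_schlafli_avg n f u =
     (\<Sum>S\<in>schlafli_cones n u. f S) / real (schlafli_count n DIM('a))"

end

theory Submission
  imports Defs
begin

text \<open>
  A polyhedral cone given by constraints \<open>w j \<bullet> x \<le> 0\<close>, \<open>j \<in> J\<close>, has its \<open>k\<close>-faces indexed by the sets \<open>I\<close> of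
  active constraints with \<open>dim (w ` I) = d - k\<close>, and the normal cone of such a face is generated by
  \<open>w ` I\<close> (Farkas). Adding the constraint \<open>u \<bullet> x \<le> 0\<close> with a random direction \<open>u\<close> therefore splits
  the curvature measure into faces on which \<open>u\<close> is inactive, which by symmetry contribute \<open>\<Phi>\<^sub>k(C, A) / 2\<close>,
  and faces on which \<open>u\<close> is active, which come from the \<open>(k + 1)\<close>-faces of \<open>C\<close>. For the latter let
  \<open>L = L(F)\<close> and take \<open>u\<close> Gaussian, \<open>u = a + b\<close> with independent \<open>a \<in> L\<close> and \<open>b \<in> L\<^sup>\<bottom>\<close>. The trace of \<open>u\<^sup>\<bottom>\<close> on \<open>L\<close>
  depends on \<open>a\<close> only and is rotation invariant, so the mean angle of \<open>F \<inter> u\<^sup>\<bottom> \<inter> A\<close> is that of \<open>F \<inter> A\<close>;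
  for fixed \<open>a\<close>, averaging over \<open>b\<close> gives half of the angle of the normal cone \<open>N(C, F)\<close>, because a
  linear combination of independent Gaussian vectors is a multiple of a Gaussian vector. Hence one
  random halfspace maps \<open>\<Phi>\<^sub>k\<close> to \<open>(\<Phi>\<^sub>k + \<Phi>\<^sub>k\<^sub>+\<^sub>1) / 2\<close> in the mean, and the binomial sum follows by induction
  for each of the \<open>2 ^ n\<close> sign vectors. Almost surely a sign vector without an open cell has the closed
  cell \<open>{0}\<close>, which does not contribute for \<open>k \<ge> 1\<close>. This dichotomy holds because the frontier of a
  convex set (here the dual of a cell) is a null set.
\<close>

subsection \<open>Gaussian measure under isometries\<close>

text \<open>Uniqueness of Haar measure by Fubini. With \<open>K\<close> the unit ball, the double
  integral of \<open>indicator A (y + x) * indicator K y\<close> is the \<open>\<nu>\<close>-mass of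
  \<open>A\<close> times the volume of \<open>K\<close> in one order; after a shift of
  \<open>y\<close> by \<open>- x\<close> it is the volume of \<open>A\<close> times the
  \<open>\<nu>\<close>-mass of \<open>K\<close> in the other.\<close>

lemma translation_invariant_measure_unique:
  fixes \<nu> :: "'a::euclidean_space measure"
  assumes sets: "sets \<nu> = sets borel" and sf: "sigma_finite_measure \<nu>"
    and inv: "\<And>a. distr \<nu> borel (\<lambda>x. a + x) = \<nu>"
    and ball: "emeasure \<nu> (ball 0 1) = emeasure lborel (ball (0::'a) 1)"
  shows "\<nu> = lborel"
proof (rule measure_eqI)
  show "sets \<nu> = sets lborel" using sets by simp
  fix A assume "A \<in> sets \<nu>"
  then have [measurable]: "A \<in> sets borel" using sets by simp
  note [measurable_cong] = sets
  interpret N: sigma_finite_measure \<nu> by fact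
  interpret P: pair_sigma_finite \<nu> lborel ..
  let ?K = "ball (0::'a) 1" and ?l = "lborel :: 'a measure"
  have [measurable]: "?K \<in> sets borel" by simp
  have shift: "(\<integral>\<^sup>+x. f (y + x) \<partial>\<nu>) = (\<integral>\<^sup>+x. f x \<partial>\<nu>)" if [measurable]: "f \<in> borel_measurable borel" for f y
    by (subst inv[of y, symmetric], subst nn_integral_distr) auto
  have shiftl: "(\<integral>\<^sup>+x. f (y + x) \<partial>?l) = (\<integral>\<^sup>+x. f x \<partial>?l)" if [measurable]: "f \<in> borel_measurable borel" for f y
    by (subst (2) lborel_distr_plus[of y, symmetric]) (simp add: nn_integral_distr)
  have "emeasure \<nu> A * emeasure ?l ?K = (\<integral>\<^sup>+y. (\<integral>\<^sup>+x. indicator A x \<partial>\<nu>) * indicator ?K y \<partial>?l)"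
    using sets by (simp add: nn_integral_cmult_indicator)
  also have "\<dots> = (\<integral>\<^sup>+y. (\<integral>\<^sup>+x. indicator A (y + x) * indicator ?K y \<partial>\<nu>) \<partial>?l)"
  proof (rule nn_integral_cong)
    fix y
    show "(\<integral>\<^sup>+x. indicator A x \<partial>\<nu>) * indicator ?K y = (\<integral>\<^sup>+x. indicator A (y + x) * indicator ?K y \<partial>\<nu>)"
      by (subst shift[of _ y, symmetric]) (auto simp: nn_integral_multc)
  qed
  also have "\<dots> = (\<integral>\<^sup>+x. (\<integral>\<^sup>+y. indicator A (y + x) * indicator ?K y \<partial>?l) \<partial>\<nu>)"
    by (rule P.Fubini') measurable
  also have "\<dots> = (\<integral>\<^sup>+x. (\<integral>\<^sup>+y. indicator A y * indicator ?K (y - x) \<partial>?l) \<partial>\<nu>)"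
  proof (rule nn_integral_cong)
    fix x
    show "(\<integral>\<^sup>+y. indicator A (y + x) * indicator ?K y \<partial>?l) = (\<integral>\<^sup>+y. indicator A y * indicator ?K (y - x) \<partial>?l)"
      by (subst shiftl[of _ x, symmetric]) (auto simp: add.commute)
  qed
  also have "\<dots> = (\<integral>\<^sup>+y. (\<integral>\<^sup>+x. indicator A y * indicator ?K (y - x) \<partial>\<nu>) \<partial>?l)"
    by (rule P.Fubini'[symmetric]) measurable
  also have "\<dots> = (\<integral>\<^sup>+y. indicator A y * (\<integral>\<^sup>+x. indicator ?K x \<partial>\<nu>) \<partial>?l)"
  proof (intro nn_integral_cong, subst nn_integral_cmult)
    fix y
    have "(\<integral>\<^sup>+x. indicator ?K x \<partial>\<nu>) = (\<integral>\<^sup>+x. indicator ?K (-y + x) \<partial>\<nu>)"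
      by (subst shift) auto
    \<comment> \<open>The ball is symmetric, so \<open>x - y\<close> may be replaced by
      \<open>y - x\<close>; this brings in the reflected ball although only translations of
      \<open>\<nu>\<close> are controlled.\<close>
    also have "\<dots> = (\<integral>\<^sup>+x. indicator ?K (y - x) \<partial>\<nu>)"
      by (intro nn_integral_cong) (auto simp: indicator_def norm_minus_commute)
    finally show "indicator A y * (\<integral>\<^sup>+x. indicator ?K (y - x) \<partial>\<nu>) = indicator A y * (\<integral>\<^sup>+x. indicator ?K x \<partial>\<nu>)" by simp
  qed measurable
  also have "\<dots> = emeasure ?l A * emeasure ?l ?K"
    using ball sets by (simp add: nn_integral_multc)
  finally have eq: "emeasure \<nu> A * emeasure ?l ?K = emeasure ?l A * emeasure ?l ?K" .
  have "emeasure ?l ?K \<noteq> 0"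
    using open_not_negligible[of ?K] by (auto simp: negligible_iff_emeasure0 emeasure_completion)
  moreover have "emeasure ?l ?K \<noteq> \<infinity>"
    using emeasure_lborel_ball_finite by (simp add: less_top)
  ultimately show "emeasure \<nu> A = emeasure ?l A"
    using eq by (simp add: mult.commute[of _ "emeasure ?l ?K"] ennreal_mult_cancel_left)
qed

lemma measurable_orthogonal_transformation:
  fixes T :: "'a::euclidean_space \<Rightarrow> 'a"
  assumes "orthogonal_transformation T"
  shows "T \<in> borel_measurable borel"
  using assms by (intro borel_measurable_continuous_onI linear_continuous_on)
    (auto simp: orthogonal_transformation_def linear_linear)

text \<open>A translation by \<open>a = T b\<close> after \<open>T\<close> is \<open>T\<close> after
  the translation by \<open>b\<close>, so the image measure is again translation invariant. It gives
  the unit ball its volume because \<open>T\<close> preserves norms.\<close>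

lemma distr_lborel_orthogonal:
  fixes T :: "'a::euclidean_space \<Rightarrow> 'a"
  assumes T: "orthogonal_transformation T"
  shows "distr lborel borel T = lborel"
proof (rule translation_invariant_measure_unique)
  note [measurable] = measurable_orthogonal_transformation[OF T]
  have lin: "linear T" using T by (simp add: orthogonal_transformation_def)
  have vball: "T -` ball 0 r = ball 0 r" for r
    using T by (auto simp: orthogonal_transformation_norm)
  show "sigma_finite_measure (distr lborel borel T)"
  proof (rule sigma_finite_measure.intro, intro exI conjI ballI)
    show "countable (range (\<lambda>n::nat. ball (0::'a) (real n)))" by auto
    show "range (\<lambda>n::nat. ball (0::'a) (real n)) \<subseteq> sets (distr lborel borel T)" by auto
    have "x \<in> \<Union> (range (\<lambda>n::nat. ball (0::'a) (real n)))" for x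
      using reals_Archimedean2[of "norm x"] by auto
    then show "\<Union> (range (\<lambda>n::nat. ball (0::'a) (real n))) = space (distr lborel borel T)" by auto
    fix a assume "a \<in> range (\<lambda>n::nat. ball (0::'a) (real n))"
    then show "emeasure (distr lborel borel T) a \<noteq> \<infinity>"
      using emeasure_lborel_ball_finite by (auto simp: emeasure_distr vball less_top)
  qed
  show "distr (distr lborel borel T) borel (\<lambda>x. a + x) = distr lborel borel T" for a
  proof -
    obtain b where b: "a = T b" using orthogonal_transformation_surj[OF T] by blast
    have "distr (distr lborel borel T) borel (\<lambda>x. a + x) = distr (distr lborel borel (\<lambda>x. b + x)) borel T"
      by (subst (1 2) distr_distr) (auto simp: comp_def b linear_add[OF lin])
    then show ?thesis by (simp add: lborel_distr_plus)
  qed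
  show "emeasure (distr lborel borel T) (ball 0 1) = emeasure lborel (ball (0::'a) 1)"
    by (simp add: emeasure_distr vball)
qed simp

lemma sets_std_gaussian [simp, measurable_cong]: "sets std_gaussian = sets borel"
  and space_std_gaussian [simp]: "space std_gaussian = UNIV"
  by (simp_all add: std_gaussian_def)

text \<open>The density depends on the norm only, and Lebesgue measure is invariant under
  \<open>T\<close>.\<close>

lemma distr_std_gaussian_orthogonal:
  fixes T :: "'a::euclidean_space \<Rightarrow> 'a"
  assumes T: "orthogonal_transformation T"
  shows "distr std_gaussian borel T = std_gaussian"
proof (rule measure_eqI)
  note [measurable] = measurable_orthogonal_transformation[OF T]
  fix A assume "A \<in> sets (distr std_gaussian borel T)"
  then have [measurable]: "A \<in> sets borel" by simp
  let ?f = "\<lambda>x::'a. ennreal ((2 * pi) powr (- real DIM('a) / 2) * exp (- (norm x)\<^sup>2 / 2))"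
  have [measurable]: "T -` A \<in> sets borel"
    using measurable_sets_borel[OF measurable_orthogonal_transformation[OF T]] by simp
  have "emeasure (distr std_gaussian borel T) A = (\<integral>\<^sup>+x. ?f x * indicator A (T x) \<partial>lborel)"
    by (simp add: std_gaussian_def emeasure_distr emeasure_density)
       (auto intro!: nn_integral_cong simp: indicator_def)
  also have "\<dots> = (\<integral>\<^sup>+x. ?f (T x) * indicator A (T x) \<partial>lborel)"
    using T by (simp add: orthogonal_transformation_norm)
  also have "\<dots> = (\<integral>\<^sup>+x. ?f x * indicator A x \<partial>distr lborel borel T)"
    by (simp add: nn_integral_distr)
  also have "\<dots> = emeasure std_gaussian A"
    by (simp add: distr_lborel_orthogonal[OF T] std_gaussian_def emeasure_density)
  finally show "emeasure (distr std_gaussian borel T) A = emeasure std_gaussian A" .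
qed simp

lemma nn_integral_std_gaussian_orthogonal:
  fixes T :: "'a::euclidean_space \<Rightarrow> 'a"
  assumes "orthogonal_transformation T" "f \<in> borel_measurable borel"
  shows "(\<integral>\<^sup>+x. f (T x) \<partial>std_gaussian) = (\<integral>\<^sup>+x. f x \<partial>std_gaussian)"
  using assms(2) nn_integral_distr[of T std_gaussian borel f] measurable_orthogonal_transformation[OF assms(1)]
  by (simp add: distr_std_gaussian_orthogonal[OF assms(1)])

text \<open>The density is the product of one-dimensional normal densities in the coordinates, each
  of total mass 1.\<close>

lemma prob_space_std_gaussian: "prob_space (std_gaussian :: 'a::euclidean_space measure)"
proof
  let ?g = "\<lambda>x::real. ennreal (std_normal_density x)"
  have "ennreal ((2 * pi) powr (- real DIM('a) / 2) * exp (- (norm x)\<^sup>2 / 2)) = (\<Prod>b\<in>Basis. ?g (x \<bullet> b))" for x :: 'a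
  proof -
    have "(\<Prod>b\<in>(Basis::'a set). std_normal_density (x \<bullet> b)) =
        (1 / sqrt (2 * pi)) ^ DIM('a) * exp (\<Sum>b\<in>(Basis::'a set). - (x \<bullet> b)\<^sup>2 / 2)"
      by (simp add: std_normal_density_def prod_dividef exp_sum power_divide)
    also have "(\<Sum>b\<in>(Basis::'a set). - (x \<bullet> b)\<^sup>2 / 2) = - (norm x)\<^sup>2 / 2"
      by (simp add: sum_divide_distrib[symmetric] sum_negf norm_eq_sqrt_inner euclidean_inner[of x x] power2_eq_square sum_nonneg)
    also have "(1 / sqrt (2 * pi)) ^ DIM('a) = (2 * pi) powr (- real DIM('a) / 2)"
    proof -
      have "1 / sqrt (2 * pi) = (2 * pi) powr (- 1 / 2)"
        by (simp add: powr_minus_divide powr_half_sqrt)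
      then show ?thesis by (simp add: powr_power)
    qed
    finally show ?thesis by (simp add: prod_ennreal)
  qed
  then have "emeasure std_gaussian (UNIV::'a set) = (\<Prod>b\<in>(Basis::'a set). \<integral>\<^sup>+x. ?g x \<partial>lborel)"
    using nn_integral_lborel_prod[of "\<lambda>_::'a. ?g"]
    by (simp add: std_gaussian_def emeasure_density)
  also have "(\<integral>\<^sup>+x. ?g x \<partial>lborel) = 1"
    by (simp add: nn_integral_eq_integral)
  finally show "emeasure std_gaussian (space (std_gaussian :: 'a measure)) = 1" by simp
qed

lemma emeasure_std_gaussian_UNIV [simp]: "emeasure (std_gaussian :: 'a::euclidean_space measure) UNIV = 1"
  using prob_space.emeasure_space_1[OF prob_space_std_gaussian] by simp

text \<open>Squared norms add up in a product space, so densities multiply. Hence orthogonal maps of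
  the product space act on pairs of independent Gaussian vectors and preserve their law.\<close>

lemma std_gaussian_pair:
  "(std_gaussian :: 'a::euclidean_space measure) \<Otimes>\<^sub>M (std_gaussian :: 'b::euclidean_space measure) = std_gaussian"
proof -
  have sf: "sigma_finite_measure (std_gaussian :: 'b measure)"
    using prob_space_std_gaussian prob_space_imp_sigma_finite by blast
  let ?f = "\<lambda>x::'a. ennreal ((2 * pi) powr (- real DIM('a) / 2) * exp (- (norm x)\<^sup>2 / 2))"
  let ?g = "\<lambda>x::'b. ennreal ((2 * pi) powr (- real DIM('b) / 2) * exp (- (norm x)\<^sup>2 / 2))"
  have "(std_gaussian :: 'a measure) \<Otimes>\<^sub>M (std_gaussian :: 'b measure) = density (lborel \<Otimes>\<^sub>M lborel) (\<lambda>(x,y). ?f x * ?g y)"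
    unfolding std_gaussian_def
    by (rule pair_measure_density) (use sf in \<open>auto simp: std_gaussian_def lborel.sigma_finite_measure_axioms\<close>)
  also have "(\<lambda>(x,y). ?f x * ?g y) = (\<lambda>x::'a\<times>'b. ennreal ((2 * pi) powr (- real DIM('a \<times> 'b) / 2) * exp (- (norm x)\<^sup>2 / 2)))"
    by (auto simp: fun_eq_iff ennreal_mult'[symmetric] norm_Pair exp_add[symmetric] powr_add[symmetric] field_simps
        simp del: ennreal_mult')
  finally show ?thesis by (simp add: std_gaussian_def lborel_prod)
qed

lemma null_std_gaussian_negligible:
  assumes "negligible S" "S \<in> sets borel"
  shows "S \<in> null_sets std_gaussian"
proof -
  have "S \<in> null_sets lborel"
    using assms by (simp add: negligible_iff_null_sets null_sets_completion_iff)
  then have "AE x in lborel. x \<notin> S" by (rule AE_not_in)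
  then show ?thesis unfolding std_gaussian_def
    by (subst null_sets_density_iff) (use assms in auto)
qed

text \<open>Proper subspaces are Lebesgue null; most of the later general position arguments reduce
  to this.\<close>

lemma AE_std_gaussian_subspace:
  fixes S :: "'a::euclidean_space set"
  assumes "subspace S" "S \<noteq> UNIV"
  shows "AE x in std_gaussian. x \<notin> S"
proof (rule AE_not_in, rule null_std_gaussian_negligible)
  show "negligible S"
    using assms by (intro negligible_lowdim) (metis dim_eq_full dim_subset_UNIV le_neq_implies_less span_eq_iff)
  show "S \<in> sets borel" using closed_subspace[OF assms(1)] by (rule borel_closed)
qed

subsection \<open>Orthogonal projections\<close>

text \<open>The decomposition is the one used in \<open>gauss_on\<close>. For a subspace
  \<open>L\<close> the description is proper, by the two lemmas that follow.\<close>

definition proj :: "'a::euclidean_space set \<Rightarrow> 'a \<Rightarrow> 'a" where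
  "proj L x = (THE y. y \<in> L \<and> x - y \<in> orthogonal_comp L)"

lemma proj_unique:
  assumes "subspace L" "y \<in> L" "x - y \<in> orthogonal_comp L"
  shows "proj L x = y"
  unfolding proj_def
proof (rule the_equality)
  fix z assume z: "z \<in> L \<and> x - z \<in> orthogonal_comp L"
  have "z - y \<in> L" using z assms subspace_diff by blast
  moreover have "(x - y) - (x - z) \<in> orthogonal_comp L"
    using z assms subspace_diff[OF subspace_orthogonal_comp] by blast
  ultimately have "z - y \<in> L \<inter> orthogonal_comp L" by simp
  then show "z = y" using orthogonal_Int_0[OF assms(1)] by auto
qed (use assms in auto)

lemma
  fixes L :: "'a::euclidean_space set"
  assumes "subspace L"
  shows proj_mem: "proj L x \<in> L"
    and proj_residual: "x - proj L x \<in> orthogonal_comp L"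
proof -
  have "x \<in> L + orthogonal_comp L"
    using subspace_sum_orthogonal_comp[OF assms] by simp
  then obtain y z where "x = y + z" "y \<in> L" "z \<in> orthogonal_comp L"
    by (auto elim: set_plus_elim)
  then have "proj L x = y" by (intro proj_unique assms) auto
  with \<open>x = y + z\<close> \<open>y \<in> L\<close> \<open>z \<in> _\<close>
  show "proj L x \<in> L" "x - proj L x \<in> orthogonal_comp L" by auto
qed

context
  fixes L :: "'a::euclidean_space set"
  assumes L: "subspace L"
begin

lemma proj_id: "x \<in> L \<Longrightarrow> proj L x = x"
  by (intro proj_unique L) (auto simp: subspace_0 subspace_orthogonal_comp)

lemma proj_orthogonal_comp: "proj (orthogonal_comp L) x = x - proj L x"
  by (intro proj_unique subspace_orthogonal_comp)
     (simp_all add: proj_residual proj_mem L orthogonal_comp_self)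

lemma linear_proj: "linear (proj L)"
proof
  fix x y :: 'a and r :: real
  have "(x - proj L x) + (y - proj L y) \<in> orthogonal_comp L"
    by (intro subspace_add subspace_orthogonal_comp proj_residual L)
  then show "proj L (x + y) = proj L x + proj L y"
    by (intro proj_unique L subspace_add proj_mem) (simp_all add: algebra_simps)
  have "r *\<^sub>R (x - proj L x) \<in> orthogonal_comp L"
    by (intro subspace_scale subspace_orthogonal_comp proj_residual L)
  then show "proj L (r *\<^sub>R x) = r *\<^sub>R proj L x"
    by (intro proj_unique L subspace_scale proj_mem) (simp_all add: algebra_simps)
qed

lemma borel_measurable_proj [measurable]: "proj L \<in> borel_measurable borel"
  by (intro borel_measurable_continuous_onI linear_continuous_on linear_conv_bounded_linear[THEN iffD1] linear_proj)

lemma inner_proj_right: "x \<in> L \<Longrightarrow> inner x (proj L y) = inner x y"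
  using proj_residual[OF L, of y] by (auto simp: orthogonal_comp_def orthogonal_def inner_diff_right)

lemma inner_proj_left: "x \<in> L \<Longrightarrow> inner (proj L y) x = inner y x"
  using inner_proj_right[of x y] by (simp add: inner_commute)

lemma inner_proj_proj: "inner (proj L x) (proj L y) = inner (proj L x) y"
  by (intro inner_proj_right proj_mem L)

lemma inner_proj_sym: "inner (proj L x) y = inner x (proj L y)"
  by (metis inner_proj_proj inner_commute)

lemma gauss_on_eq_proj: "gauss_on L B = measure std_gaussian {x. proj L x \<in> B}"
proof -
  have "(\<exists>y\<in>L \<inter> B. x - y \<in> orthogonal_comp L) \<longleftrightarrow> proj L x \<in> B" for x
  proof
    assume "proj L x \<in> B"
    then show "\<exists>y\<in>L \<inter> B. x - y \<in> orthogonal_comp L"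
      using proj_mem[OF L] proj_residual[OF L] by (intro bexI[of _ "proj L x"]) auto
  qed (use proj_unique[OF L] in auto)
  then show ?thesis by (simp add: gauss_on_def)
qed

lemma emeasure_gauss_on:
  "emeasure std_gaussian {x. proj L x \<in> B} = ennreal (gauss_on L B)"
proof -
  interpret prob_space "std_gaussian :: 'a measure" by (rule prob_space_std_gaussian)
  show ?thesis by (simp add: gauss_on_eq_proj emeasure_eq_measure)
qed

text \<open>Exchanging the \<open>L\<close>-components of two independent Gaussian vectors is an isometry of the
  product space; this replaces an appeal to coordinates.\<close>
lemma nn_integral_gaussian_proj_indep:
  assumes [measurable]: "f \<in> borel_measurable (borel \<Otimes>\<^sub>M borel)"
  shows "(\<integral>\<^sup>+x. f (proj L x, x - proj L x) \<partial>std_gaussian) =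
     (\<integral>\<^sup>+x. \<integral>\<^sup>+y. f (proj L x, y - proj L y) \<partial>std_gaussian \<partial>std_gaussian)"
proof -
  interpret G: prob_space "std_gaussian :: 'a measure" by (rule prob_space_std_gaussian)
  let ?T = "\<lambda>(x, y). (proj L x + (y - proj L y), proj L y + (x - proj L x))"
  have nrm: "inner (proj L x + (y - proj L y)) (proj L x + (y - proj L y)) =
       inner (proj L x) (proj L x) + inner (y - proj L y) (y - proj L y)" for x y
  proof -
    have "inner (proj L x) (y - proj L y) = 0"
      by (simp add: inner_diff_right inner_proj_proj)
    then show ?thesis
      by (simp add: inner_add_left inner_add_right inner_commute[of "y - proj L y" "proj L x"])
  qed
  have T: "orthogonal_transformation ?T"
    unfolding orthogonal_transformation
  proof (intro conjI allI)
    show "linear ?T"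
      by (rule linearI) (auto simp: linear_add[OF linear_proj] linear_scale[OF linear_proj] algebra_simps)
    fix v :: "'a \<times> 'a"
    obtain x y where v: "v = (x, y)" by (cases v)
    show "norm (?T v) = norm v"
      \<comment> \<open>With equal arguments \<open>nrm\<close> is Pythagoras for \<open>x\<close>
        and for \<open>y\<close>; with mixed arguments it gives the two components of the
        image.\<close>
      using nrm[of x y] nrm[of y x] nrm[of x x] nrm[of y y]
      by (simp add: v norm_eq_sqrt_inner)
  qed
  \<comment> \<open>The projection kills residuals, so the first component of
    \<open>?T (x, y)\<close> has its \<open>L\<close>-part from \<open>x\<close> and its residual
    from \<open>y\<close>.\<close>
  have PP: "proj L (proj L x + (y - proj L y)) = proj L x" for x y
    using linear_add[OF linear_proj, of "proj L x" "y - proj L y"] linear_diff[OF linear_proj, of y "proj L y"]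
    by (simp add: proj_id proj_mem[OF L])
  have "(\<integral>\<^sup>+x. f (proj L x, x - proj L x) \<partial>std_gaussian) =
     (\<integral>\<^sup>+x. \<integral>\<^sup>+y. f (proj L x, x - proj L x) \<partial>(std_gaussian :: 'a measure) \<partial>std_gaussian)"
    by simp
  also have "\<dots> = (\<integral>\<^sup>+z. f (proj L (fst z), fst z - proj L (fst z)) \<partial>((std_gaussian :: 'a measure) \<Otimes>\<^sub>M (std_gaussian :: 'a measure)))"
    by (subst G.nn_integral_fst[symmetric]) auto
  also have "\<dots> = (\<integral>\<^sup>+z. f (proj L (fst (?T z)), fst (?T z) - proj L (fst (?T z))) \<partial>((std_gaussian :: 'a measure) \<Otimes>\<^sub>M (std_gaussian :: 'a measure)))"
    unfolding std_gaussian_pair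
    by (subst nn_integral_std_gaussian_orthogonal[OF T]) (auto simp: borel_prod[symmetric])
  also have "\<dots> = (\<integral>\<^sup>+z. f (proj L (fst z), snd z - proj L (snd z)) \<partial>((std_gaussian :: 'a measure) \<Otimes>\<^sub>M (std_gaussian :: 'a measure)))"
    by (intro nn_integral_cong) (auto simp: PP)
  also have "\<dots> = (\<integral>\<^sup>+x. \<integral>\<^sup>+y. f (proj L x, y - proj L y) \<partial>std_gaussian \<partial>std_gaussian)"
    by (subst G.nn_integral_fst[symmetric]) auto
  finally show ?thesis .
qed

end

section \<open>Conic sets, linear combinations of Gaussian vectors, halfspaces\<close>

lemma conic_set_scaleR_iff:
  assumes "conic_set D" "c > 0"
  shows "c *\<^sub>R x \<in> D \<longleftrightarrow> x \<in> D"
proof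
  assume "c *\<^sub>R x \<in> D"
  then have "(1 / c) *\<^sub>R (c *\<^sub>R x) \<in> D"
    using assms unfolding conic_set_def by (metis divide_pos_pos zero_less_one)
  then show "x \<in> D" using assms by simp
qed (use assms in \<open>auto simp: conic_set_def\<close>)

text \<open>Up to the positive factor \<open>r = 1 / sqrt (1 + c\<^sup>2)\<close>, the vector
  \<open>y - c *\<^sub>R x\<close> is one component of a rotation of the pair \<open>(x, y)\<close>,
  hence standard Gaussian; a conic set does not see the factor.\<close>

lemma gaussian_difference_conic:
  fixes D :: "'a::euclidean_space set"
  assumes [measurable]: "D \<in> sets borel" and D: "conic_set D"
  shows "(\<integral>\<^sup>+x. \<integral>\<^sup>+y. indicator D (y - c *\<^sub>R x) \<partial>std_gaussian \<partial>std_gaussian) = emeasure std_gaussian D"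
proof -
  interpret G: prob_space "std_gaussian :: 'a measure" by (rule prob_space_std_gaussian)
  define r where "r = 1 / sqrt (1 + c\<^sup>2)"
  have r: "r > 0" "r\<^sup>2 * (1 + c\<^sup>2) = 1"
  proof -
    have "1 + c\<^sup>2 > 0" by (simp add: add_pos_nonneg)
    then show "r > 0" "r\<^sup>2 * (1 + c\<^sup>2) = 1" by (simp_all add: r_def power_divide)
  qed
  let ?T = "\<lambda>(x::'a, y::'a). (r *\<^sub>R (x + c *\<^sub>R y), r *\<^sub>R (y - c *\<^sub>R x))"
  have T: "orthogonal_transformation ?T"
    unfolding orthogonal_transformation
  proof (intro conjI allI)
    show "linear ?T"
      by (rule linearI) (auto simp: algebra_simps)
    fix v :: "'a \<times> 'a"
    obtain x y where v: "v = (x, y)" by (cases v)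
    have "inner (?T v) (?T v) = r\<^sup>2 * (1 + c\<^sup>2) * inner v v"
      by (simp add: v inner_add_left inner_add_right inner_diff_left inner_diff_right inner_commute power2_eq_square algebra_simps)
    then show "norm (?T v) = norm v"
      using r by (simp add: norm_eq_sqrt_inner)
  qed
  have "(\<integral>\<^sup>+x. \<integral>\<^sup>+y. indicator D (y - c *\<^sub>R x) \<partial>std_gaussian \<partial>std_gaussian) =
     (\<integral>\<^sup>+x. \<integral>\<^sup>+y. indicator D (r *\<^sub>R (y - c *\<^sub>R x)) \<partial>std_gaussian \<partial>std_gaussian)"
    using conic_set_scaleR_iff[OF D r(1)] by (simp add: indicator_def)
  also have "\<dots> = (\<integral>\<^sup>+z. indicator D (snd (?T z)) \<partial>((std_gaussian :: 'a measure) \<Otimes>\<^sub>M (std_gaussian :: 'a measure)))"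
    by (subst G.nn_integral_fst[symmetric]) (auto simp: case_prod_beta)
  also have "\<dots> = (\<integral>\<^sup>+z. indicator D (snd z) \<partial>((std_gaussian :: 'a measure) \<Otimes>\<^sub>M std_gaussian))"
    unfolding std_gaussian_pair
    by (subst nn_integral_std_gaussian_orthogonal[OF T]) (auto simp: borel_prod[symmetric])
  also have "\<dots> = (\<integral>\<^sup>+x. \<integral>\<^sup>+y. indicator D y \<partial>std_gaussian \<partial>(std_gaussian :: 'a measure))"
    by (subst G.nn_integral_fst[symmetric]) auto
  also have "\<dots> = emeasure std_gaussian D"
    by simp
  finally show ?thesis .
qed

lemma AE_std_gaussian_inner:
  fixes a :: "'a::euclidean_space"
  assumes "a \<noteq> 0"
  shows "AE x in std_gaussian. inner a x \<noteq> 0"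
  using AE_std_gaussian_subspace[OF subspace_hyperplane[of a]] assms
  by auto (metis (mono_tags, lifting) UNIV_I inner_eq_zero_iff mem_Collect_eq)

text \<open>The map \<open>x \<mapsto> - x\<close> preserves the Gaussian measure and exchanges the
  two halfspaces up to the null hyperplane between them.\<close>

lemma emeasure_std_gaussian_halfspace:
  fixes a :: "'a::euclidean_space"
  assumes "a \<noteq> 0"
  shows "emeasure std_gaussian {x. inner a x < 0} = 1 / 2"
    and "emeasure std_gaussian {x. inner a x \<ge> 0} = 1 / 2"
proof -
  interpret G: prob_space "std_gaussian :: 'a measure" by (rule prob_space_std_gaussian)
  let ?G = "std_gaussian :: 'a measure"
  have "(\<integral>\<^sup>+x. indicator {x. inner a x < 0} (- x) \<partial>?G) = (\<integral>\<^sup>+x. indicator {x. inner a x < 0} x \<partial>?G)"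
    by (rule nn_integral_std_gaussian_orthogonal) (auto simp: orthogonal_transformation_neg)
  also have "(\<integral>\<^sup>+x. indicator {x. inner a x < 0} (- x) \<partial>?G) = (\<integral>\<^sup>+x. indicator {x. inner a x \<ge> 0} x \<partial>?G)"
    by (intro nn_integral_cong_AE) (use AE_std_gaussian_inner[OF assms] in \<open>eventually_elim, auto simp: indicator_def\<close>)
  finally have eq: "emeasure ?G {x. inner a x \<ge> 0} = emeasure ?G {x. inner a x < 0}"
    by simp
  have "emeasure ?G {x. inner a x \<ge> 0} + emeasure ?G {x. inner a x < 0} = emeasure ?G UNIV"
  proof (subst plus_emeasure)
    have "{x. inner a x \<ge> 0} \<union> {x. inner a x < 0} = UNIV" by auto
    then show "emeasure ?G ({x. inner a x \<ge> 0} \<union> {x. inner a x < 0}) = emeasure ?G UNIV" by simp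
  qed auto
  then have "2 * emeasure ?G {x. inner a x < 0} = 1"
    using G.emeasure_space_1 eq by (simp add: mult_2)
  then have "emeasure ?G {x. inner a x < 0} = 1 / 2"
    using ennreal_mult_divide_eq[of 2 "emeasure ?G {x. inner a x < 0}"] by (simp add: mult.commute)
  with eq show "emeasure ?G {x. inner a x < 0} = 1 / 2" "emeasure ?G {x. inner a x \<ge> 0} = 1 / 2" by auto
qed

subsection \<open>Rotation invariance determines the measure of conic sets\<close>

text \<open>The reflection in the hyperplane orthogonal to \<open>e = u - v\<close> exchanges unit
  vectors \<open>u\<close> and \<open>v\<close>, and it preserves \<open>L\<close> since
  \<open>e\<close> lies in \<open>L\<close>. For \<open>u = v\<close> the quotient in
  \<open>?T\<close> is a division by zero, hence 0, and \<open>?T\<close> is the identity.\<close>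

lemma reflection_between_unit_vectors:
  fixes u v :: "'a::euclidean_space"
  assumes L: "subspace L" "u \<in> L" "v \<in> L" and "norm u = 1" "norm v = 1"
  obtains T where "orthogonal_transformation T" "\<And>x. x \<in> L \<Longrightarrow> T x \<in> L" "T u = v"
proof
  define e where "e = u - v"
  let ?T = "\<lambda>x. x - (2 * inner x e / inner e e) *\<^sub>R e"
  show "orthogonal_transformation ?T"
    unfolding orthogonal_transformation
  proof (intro conjI allI)
    show "linear ?T"
      by (rule linearI) (auto simp: algebra_simps inner_add_left add_divide_distrib)
    fix x
    have "inner (?T x) (?T x) = inner x x"
      by (cases "e = 0")
         (simp_all add: inner_diff_left inner_diff_right inner_commute[of e x] field_simps)
    then show "norm (?T x) = norm x" by (simp add: norm_eq_sqrt_inner)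
  qed
  show "?T x \<in> L" if "x \<in> L" for x
    using that L by (auto simp: e_def intro!: subspace_diff subspace_scale)
  have "inner u u = 1" "inner v v = 1" using assms by (simp_all add: norm_eq_sqrt_inner)
  then have "inner e e = 2 * inner u e"
    by (simp add: e_def inner_diff_left inner_diff_right inner_commute)
  then show "?T u = v"
    by (cases "e = 0") (auto simp: e_def)
qed

text \<open>The open cone of directions whose angle with \<open>x\<close> has cosine above
  \<open>c\<close>. The form without division makes the relation symmetric in \<open>x\<close> and
  \<open>y\<close> and leaves out the origin.\<close>

definition spherical_cap :: "real \<Rightarrow> 'a::euclidean_space \<Rightarrow> 'a set" where
  "spherical_cap c x = {y. inner x y > c * norm x * norm y}"

lemma spherical_cap_sym: "y \<in> spherical_cap c x \<longleftrightarrow> x \<in> spherical_cap c y"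
  by (simp add: spherical_cap_def inner_commute ac_simps)

lemma pred_spherical_cap [measurable (raw)]:
  assumes [measurable]: "f \<in> borel_measurable M" "g \<in> borel_measurable M"
  shows "Measurable.pred M (\<lambda>w. f w \<in> spherical_cap c (g w))"
  unfolding spherical_cap_def mem_Collect_eq by measurable

lemma sets_spherical_cap [measurable]: "spherical_cap c x \<in> sets borel"
  unfolding spherical_cap_def by measurable

text \<open>The measure lives on the whole space and is concentrated on \<open>L\<close> without the
  origin. The isometries are those of the whole space that map \<open>L\<close> into itself; the
  reflections above show that they act transitively on the unit sphere of \<open>L\<close>.\<close>

definition rotation_invariant_on :: "'a::euclidean_space set \<Rightarrow> 'a measure \<Rightarrow> bool" where
  "rotation_invariant_on L M \<longleftrightarrow> prob_space M \<and> sets M = sets borel \<and> (AE x in M. x \<in> L \<and> x \<noteq> 0) \<and>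
     (\<forall>T. orthogonal_transformation T \<longrightarrow> (\<forall>x\<in>L. T x \<in> L) \<longrightarrow> distr M borel T = M)"

text \<open>A cap depends only on the direction of its axis, and a reflection preserving
  \<open>L\<close> takes one axis to the other.\<close>

lemma emeasure_spherical_cap_const:
  assumes L: "subspace L" and M: "rotation_invariant_on L M"
    and x: "x \<in> L" "x \<noteq> 0" and y: "y \<in> L" "y \<noteq> 0"
  shows "emeasure M (spherical_cap c x) = emeasure M (spherical_cap c y)"
proof -
  have [measurable_cong]: "sets M = sets borel" using M by (simp add: rotation_invariant_on_def)
  have sgn_cap: "spherical_cap c (sgn z) = spherical_cap c z" if "z \<noteq> 0" for z :: 'a
    using that by (auto simp: spherical_cap_def sgn_div_norm field_simps)
  have "sgn x \<in> L" "sgn y \<in> L" using x y L by (auto simp: sgn_div_norm subspace_scale)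
  then obtain T where T: "orthogonal_transformation T" "\<And>x. x \<in> L \<Longrightarrow> T x \<in> L" "T (sgn x) = sgn y"
    using reflection_between_unit_vectors[OF L, of "sgn x" "sgn y"] x y by (auto simp: norm_sgn)
  note [measurable] = measurable_orthogonal_transformation[OF T(1)]
  have "T -` spherical_cap c (sgn y) = spherical_cap c (sgn x)"
    using T by (auto simp: spherical_cap_def orthogonal_transformation_def orthogonal_transformation_norm[OF T(1)] simp flip: T(3))
  moreover have "distr M borel T = M" using M T by (auto simp: rotation_invariant_on_def)
  then have "emeasure M (spherical_cap c (sgn y)) = emeasure (distr M borel T) (spherical_cap c (sgn y))" by simp
  moreover have "space M = UNIV" using sets_eq_imp_space_eq[of M borel] \<open>sets M = sets borel\<close> by simp
  ultimately have "emeasure M (spherical_cap c (sgn y)) = emeasure M (spherical_cap c (sgn x))"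
    by (simp add: emeasure_distr)
  then show ?thesis using x y by (simp add: sgn_cap)
qed

text \<open>Fubini for the symmetric relation \<open>y \<in> spherical_cap c z\<close> under the
  product of \<open>M\<close> and \<open>N\<close>: since cap masses do not depend on the axis, one
  order of integration yields the cap mass for \<open>M\<close>, the other that for
  \<open>N\<close>.\<close>

lemma emeasure_spherical_cap_eq:
  assumes L: "subspace L" and M: "rotation_invariant_on L M" and N: "rotation_invariant_on L N"
    and x: "x \<in> L" "x \<noteq> 0"
  shows "emeasure M (spherical_cap c x) = emeasure N (spherical_cap c x)"
proof -
  have [measurable_cong]: "sets M = sets borel" "sets N = sets borel"
    using M N by (auto simp: rotation_invariant_on_def)
  interpret M: prob_space M using M by (simp add: rotation_invariant_on_def)
  interpret N: prob_space N using N by (simp add: rotation_invariant_on_def)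
  interpret P: pair_sigma_finite M N ..
  have aeM: "AE y in M. y \<in> L \<and> y \<noteq> 0" and aeN: "AE y in N. y \<in> L \<and> y \<noteq> 0"
    using M N by (auto simp: rotation_invariant_on_def)
  have "emeasure M (spherical_cap c x) = (\<integral>\<^sup>+z. emeasure M (spherical_cap c x) \<partial>N)"
    using N.emeasure_space_1 by simp
  also have "\<dots> = (\<integral>\<^sup>+z. (\<integral>\<^sup>+y. indicator (spherical_cap c z) y \<partial>M) \<partial>N)"
    using aeN by (intro nn_integral_cong_AE, eventually_elim)
       (auto intro!: emeasure_spherical_cap_const[OF L M x])
  also have "\<dots> = (\<integral>\<^sup>+y. (\<integral>\<^sup>+z. indicator (spherical_cap c z) y \<partial>N) \<partial>M)"
    by (rule P.Fubini') measurable
  also have "\<dots> = (\<integral>\<^sup>+y. (\<integral>\<^sup>+z. indicator (spherical_cap c y) z \<partial>N) \<partial>M)"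
    by (intro nn_integral_cong) (auto simp: indicator_def spherical_cap_sym)
  also have "\<dots> = (\<integral>\<^sup>+y. emeasure N (spherical_cap c x) \<partial>M)"
    using aeM by (intro nn_integral_cong_AE, eventually_elim)
       (auto intro!: emeasure_spherical_cap_const[OF L N _ _ x])
  also have "\<dots> = emeasure N (spherical_cap c x)"
    using M.emeasure_space_1 by simp
  finally show ?thesis .
qed

text \<open>The squared distance of two unit vectors is twice one minus their inner product, so in
  the \<open>n\<close>-th cap directions differ from that of \<open>x\<close> by a squared distance
  below \<open>2 / (n + 1)\<close>.\<close>

lemma spherical_cap_shrink:
  fixes x :: "'a::euclidean_space"
  assumes "open S" "sgn x \<in> S" "x \<noteq> 0"
  shows "\<forall>\<^sub>F n in sequentially. \<forall>y\<in>spherical_cap (1 - 1 / Suc n) x. y \<noteq> 0 \<and> sgn y \<in> S"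
proof -
  obtain e where e: "e > 0" "ball (sgn x) e \<subseteq> S" using assms open_contains_ball by blast
  have "(\<lambda>n. 2 * (1 / real (Suc n))) \<longlonglongrightarrow> 2 * 0"
    by (intro tendsto_mult tendsto_const lim_1_over_n[THEN LIMSEQ_Suc])
  then have "\<forall>\<^sub>F n in sequentially. 2 * (1 / real (Suc n)) < e\<^sup>2"
    using e by (auto dest!: order_tendstoD(2)[where a="e\<^sup>2"])
  then show ?thesis
  proof eventually_elim
    case (elim n)
    show ?case
    proof (intro ballI conjI)
      fix y assume y: "y \<in> spherical_cap (1 - 1 / real (Suc n)) x"
      show "y \<noteq> 0" using y by (auto simp: spherical_cap_def)
      then have pos: "norm x * norm y > 0" using assms by simp
      have "inner (sgn x) (sgn y) = inner x y / (norm x * norm y)"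
        by (simp add: sgn_div_norm divide_inverse ac_simps)
      also have "\<dots> > 1 - 1 / real (Suc n)"
        using y pos by (simp add: spherical_cap_def pos_less_divide_eq mult.assoc)
      finally have gt: "inner (sgn x) (sgn y) > 1 - 1 / real (Suc n)" .
      have "inner (sgn x) (sgn x) = 1" "inner (sgn y) (sgn y) = 1"
        using assms \<open>y \<noteq> 0\<close> by (simp_all flip: power2_norm_eq_inner add: norm_sgn)
      then have "(dist (sgn x) (sgn y))\<^sup>2 = 2 - 2 * inner (sgn x) (sgn y)"
        by (simp add: dist_norm power2_norm_eq_inner inner_diff_left inner_diff_right inner_commute)
      also have "\<dots> < e\<^sup>2" using gt elim by simp
      finally have "dist (sgn x) (sgn y) < e" using e by (simp add: power2_less_imp_less)
      then show "sgn y \<in> S" using e by auto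
    qed
  qed
qed

text \<open>Christensen's argument: both measures give all caps of a fixed size the same mass, so the
  relative mass of a shrinking cap in an open set can be integrated in either order.\<close>
lemma rotation_invariant_open_le:
  assumes L: "subspace L" and M: "rotation_invariant_on L M" and N: "rotation_invariant_on L N"
    and pos: "\<And>x c. x \<in> L \<Longrightarrow> x \<noteq> 0 \<Longrightarrow> 0 \<le> c \<Longrightarrow> c < 1 \<Longrightarrow> emeasure N (spherical_cap c x) > 0"
    and S: "open S"
  shows "emeasure M (sgn -` S) \<le> emeasure N (sgn -` S)"
proof -
  have [measurable_cong]: "sets M = sets borel" "sets N = sets borel"
    using M N by (auto simp: rotation_invariant_on_def)
  interpret M: prob_space M using M by (simp add: rotation_invariant_on_def)
  interpret N: prob_space N using N by (simp add: rotation_invariant_on_def)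
  interpret P: pair_sigma_finite M N ..
  have aeM: "AE y in M. y \<in> L \<and> y \<noteq> 0" and aeN: "AE y in N. y \<in> L \<and> y \<noteq> 0"
    using M N by (auto simp: rotation_invariant_on_def)
  obtain z where z: "z \<in> L" "z \<noteq> 0"
    using eventually_happens'[OF M.ae_filter_bot aeM] by blast
  define c where "c n = 1 - 1 / real (Suc n)" for n
  have c: "0 \<le> c n" "c n < 1" for n by (auto simp: c_def)
  define g where "g n = emeasure N (spherical_cap (c n) z)" for n
  have g: "0 < g n" "g n < top" for n
    using pos[OF z c] by (auto simp: g_def less_top[symmetric])
  define U where "U = sgn -` S"
  have [measurable]: "U \<in> sets borel"
    unfolding U_def using S by (intro measurable_sets_borel[of _ borel]) auto
  define h where "h n x = (\<integral>\<^sup>+y. indicator U y * indicator (spherical_cap (c n) x) y \<partial>N)" for n x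
  have [measurable]: "h n \<in> borel_measurable borel" for n
    unfolding h_def by measurable
  \<comment> \<open>By the symmetry of the cap relation the inner integral becomes the
    \<open>M\<close>-mass of a cap around \<open>y\<close>, which is \<open>g n\<close> since
    \<open>M\<close> and \<open>N\<close> agree on caps.\<close>
  have int_h: "(\<integral>\<^sup>+x. h n x \<partial>M) = g n * emeasure N U" for n
  proof -
    have "(\<integral>\<^sup>+x. h n x \<partial>M) = (\<integral>\<^sup>+y. \<integral>\<^sup>+x. indicator U y * indicator (spherical_cap (c n) x) y \<partial>M \<partial>N)"
      unfolding h_def by (rule P.Fubini'[symmetric]) measurable
    also have "\<dots> = (\<integral>\<^sup>+y. indicator U y * (\<integral>\<^sup>+x. indicator (spherical_cap (c n) y) x \<partial>M) \<partial>N)"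
      by (intro nn_integral_cong, subst nn_integral_cmult[symmetric])
         (auto intro!: nn_integral_cong simp: indicator_def spherical_cap_sym)
    also have "\<dots> = (\<integral>\<^sup>+y. g n * indicator U y \<partial>N)"
    proof (intro nn_integral_cong_AE, use aeN in eventually_elim)
      case (elim y)
      then show ?case
        using emeasure_spherical_cap_eq[OF L M N, of y "c n"] emeasure_spherical_cap_const[OF L N _ _ z, of y "c n"]
        by (simp add: g_def mult.commute)
    qed
    also have "\<dots> = g n * emeasure N U"
      by (simp add: nn_integral_cmult_indicator)
    finally show ?thesis .
  qed
  \<comment> \<open>For \<open>x\<close> in \<open>U\<close> the caps around \<open>x\<close>
    eventually lie in \<open>U\<close>, where \<open>h n x\<close> is the full cap mass and the
    quotient is 1. Fatou's lemma then gives the inequality.\<close>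
  have lim: "indicator U x \<le> liminf (\<lambda>n. h n x / g n)" if x: "x \<in> L" "x \<noteq> 0" for x
  proof (cases "x \<in> U")
    case True
    have "\<forall>\<^sub>F n in sequentially. \<forall>y\<in>spherical_cap (1 - 1 / Suc n) x. y \<noteq> 0 \<and> sgn y \<in> S"
      using spherical_cap_shrink[OF S _ x(2)] True by (simp add: U_def)
    then have "\<forall>\<^sub>F n in sequentially. 1 \<le> h n x / g n"
    proof eventually_elim
      case (elim n)
      have "h n x = (\<integral>\<^sup>+y. indicator (spherical_cap (c n) x) y \<partial>N)"
        unfolding h_def using elim by (intro nn_integral_cong) (auto simp: indicator_def U_def c_def)
      also have "\<dots> = g n"
        using emeasure_spherical_cap_const[OF L N x z, of "c n"] by (simp add: g_def)
      finally show ?case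
        using g[of n] by (simp add: ennreal_divide_self)
    qed
    then have "1 \<le> liminf (\<lambda>n. h n x / g n)" by (rule Liminf_bounded)
    then show ?thesis using True by simp
  qed auto
  have "emeasure M U = (\<integral>\<^sup>+x. indicator U x \<partial>M)" by simp
  also have "\<dots> \<le> (\<integral>\<^sup>+x. liminf (\<lambda>n. h n x / g n) \<partial>M)"
    using aeM by (intro nn_integral_mono_AE, eventually_elim) (auto intro: lim)
  also have "\<dots> \<le> liminf (\<lambda>n. \<integral>\<^sup>+x. h n x / g n \<partial>M)"
    by (intro nn_integral_liminf) measurable
  also have "\<dots> = liminf (\<lambda>n. emeasure N U)"
    using g by (simp add: nn_integral_divide int_h ennreal_mult_divide_eq less_top[symmetric]
        zero_less_iff_neq_zero mult.commute[of "g _"])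
  also have "\<dots> = emeasure N U" by (simp add: Liminf_const)
  finally show ?thesis by (simp add: U_def)
qed

text \<open>The inequality for open sets, used in both directions, makes the laws of the directions
  agree on a generating system stable under intersection. Membership in a conic set depends on the
  direction alone, except at the origin, which has mass 0.\<close>

lemma rotation_invariant_conic_eq:
  assumes L: "subspace L" and M: "rotation_invariant_on L M" and N: "rotation_invariant_on L N"
    and pos: "\<And>x c. x \<in> L \<Longrightarrow> x \<noteq> 0 \<Longrightarrow> 0 \<le> c \<Longrightarrow> c < 1 \<Longrightarrow> emeasure N (spherical_cap c x) > 0"
  shows rotation_invariant_sgn_eq: "distr M borel sgn = distr N borel sgn"
    and "B \<in> sets borel \<Longrightarrow> conic_set B \<Longrightarrow> emeasure M B = emeasure N B"
proof -
  have s[measurable_cong]: "sets M = sets borel" "sets N = sets borel"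
    using M N by (auto simp: rotation_invariant_on_def)
  interpret M: prob_space M using M by (simp add: rotation_invariant_on_def)
  interpret N: prob_space N using N by (simp add: rotation_invariant_on_def)
  have sp: "space M = UNIV" "space N = UNIV"
    using sets_eq_imp_space_eq[of M borel] sets_eq_imp_space_eq[of N borel] s by auto
  \<comment> \<open>Positivity of cap masses is assumed for \<open>N\<close>; equality of cap masses
    transfers it to \<open>M\<close>, so that the roles can be exchanged.\<close>
  have eq: "emeasure M (sgn -` S) = emeasure N (sgn -` S)" if "open S" for S
    using rotation_invariant_open_le[OF L M N pos that] rotation_invariant_open_le[OF L N M _ that]
      emeasure_spherical_cap_eq[OF L M N] pos by (simp add: antisym)
  show D: "distr M borel sgn = distr N borel sgn"
  proof (rule measure_eqI_generator_eq[where E="{S. open S}" and \<Omega>=UNIV and A="\<lambda>_. UNIV"])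
    show "Int_stable {S::'a set. open S}" by (auto simp: Int_stable_def)
    show "emeasure (distr M borel sgn) X = emeasure (distr N borel sgn) X" if "X \<in> {S. open S}" for X
      using that eq[of X] by (simp add: emeasure_distr sp)
    show "emeasure (distr M borel sgn) UNIV \<noteq> \<infinity>"
      using M.emeasure_finite by (simp add: emeasure_distr)
  qed (auto simp: borel_def)
  assume B[measurable]: "B \<in> sets borel" and con: "conic_set B"
  have sgnB: "sgn x \<in> B \<longleftrightarrow> x \<in> B" if "x \<noteq> 0" for x
    using conic_set_scaleR_iff[OF con, of "1 / norm x" x] that by (simp add: sgn_div_norm divide_inverse)
  have aux: "emeasure Q B = emeasure (distr Q borel sgn) B" if Q: "rotation_invariant_on L Q" for Q
  proof -
    have [measurable_cong]: "sets Q = sets borel" using Q by (auto simp: rotation_invariant_on_def)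
    have "AE x in Q. x \<in> L \<and> x \<noteq> 0" using Q by (auto simp: rotation_invariant_on_def)
    then have "emeasure Q {x\<in>space Q. x \<in> B} = emeasure Q {x\<in>space Q. sgn x \<in> B}"
      by (intro emeasure_eq_AE) (auto simp: sgnB)
    moreover have "space Q = UNIV" using sets_eq_imp_space_eq[of Q borel] \<open>sets Q = _\<close> by simp
    ultimately show ?thesis by (simp add: emeasure_distr vimage_def)
  qed
  show "emeasure M B = emeasure N B" by (simp add: aux[OF M] aux[OF N] D)
qed

text \<open>By equality of dimensions \<open>T\<close> maps \<open>L\<close> onto \<open>L\<close>,
  so it also preserves orthogonality to \<open>L\<close> and the decomposition is transported by
  \<open>T\<close>.\<close>

lemma proj_orthogonal_transformation:
  assumes L: "subspace L" and T: "orthogonal_transformation T" and TL: "\<And>x. x \<in> L \<Longrightarrow> T x \<in> L"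
  shows "proj L (T x) = T (proj L x)"
proof (rule proj_unique[OF L TL[OF proj_mem[OF L]]])
  have lin: "linear T" using T by (rule orthogonal_transformation_linear)
  have "T ` L = L"
  proof (rule subspace_dim_equal)
    show "subspace (T ` L)" using lin L by (rule linear_subspace_image)
    have "dim (T ` L) = dim L"
      by (rule dim_image_eq[OF lin]) (meson T orthogonal_transformation_inj subset_UNIV inj_on_subset)
    then show "dim (T ` L) \<ge> dim L" by simp
  qed (use L TL in auto)
  moreover have "inner (T l) (T x - T (proj L x)) = 0" if "l \<in> L" for l
  proof -
    have "inner (T l) (T x - T (proj L x)) = inner l (x - proj L x)"
      using T by (simp add: orthogonal_transformation_def linear_diff[symmetric])
    then show ?thesis using that proj_residual[OF L, of x] by (auto simp: orthogonal_comp_def orthogonal_def)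
  qed
  ultimately show "T x - T (proj L x) \<in> orthogonal_comp L"
    by (auto simp: orthogonal_comp_def orthogonal_def) (metis imageE)
qed

lemma emeasure_std_gaussian_open_pos:
  fixes S :: "'a::euclidean_space set"
  assumes "open S" "S \<noteq> {}"
  shows "emeasure std_gaussian S > 0"
proof (rule ccontr)
  assume "\<not> emeasure std_gaussian S > 0"
  then have "S \<in> null_sets std_gaussian" using assms by (auto simp: null_sets_def not_gr_zero)
  then have "AE x in lborel. x \<notin> S"
    unfolding std_gaussian_def by (subst (asm) null_sets_density_iff) auto
  then have "S \<in> null_sets lborel" using assms by (subst (asm) AE_iff_null_sets[symmetric]) auto
  then have "negligible S" by (simp add: negligible_iff_null_sets null_sets_completionI)
  with assms open_not_negligible show False by blast
qed

lemma AE_std_gaussian_proj_nonzero: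
  assumes L: "subspace L" "L \<noteq> {0}"
  shows "AE x in std_gaussian. proj L x \<noteq> 0"
proof -
  obtain l where l: "l \<in> L" "l \<noteq> 0" using L subspace_0 by blast
  then have "l \<notin> orthogonal_comp L" by (auto simp: orthogonal_comp_def orthogonal_def intro!: bexI[of _ l])
  then have "AE x in std_gaussian. x \<notin> orthogonal_comp L"
    by (intro AE_std_gaussian_subspace subspace_orthogonal_comp) auto
  then show ?thesis
    by eventually_elim (metis diff_zero proj_residual[OF L(1)])
qed

text \<open>An isometry preserving \<open>L\<close> commutes with the projection, so invariance is
  inherited from the Gaussian measure on the whole space.\<close>

lemma rotation_invariant_proj_gaussian:
  assumes L: "subspace L" "L \<noteq> {0}"
  shows "rotation_invariant_on L (distr std_gaussian borel (proj L))"
proof -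
  interpret G: prob_space "std_gaussian :: 'a measure" by (rule prob_space_std_gaussian)
  have "prob_space (distr std_gaussian borel (proj L))"
    by (intro G.prob_space_distr) (simp add: borel_measurable_proj L)
  moreover have "AE x in distr std_gaussian borel (proj L). x \<in> L \<and> x \<noteq> 0"
    by (subst AE_distr_iff) (use L AE_std_gaussian_proj_nonzero[OF L] closed_subspace[OF L(1)] in
        \<open>auto simp: borel_measurable_proj proj_mem intro!: borel_closed\<close>)
  moreover have "distr (distr std_gaussian borel (proj L)) borel T = distr std_gaussian borel (proj L)"
    if T: "orthogonal_transformation T" and TL: "\<forall>x\<in>L. T x \<in> L" for T
  proof -
    note [measurable] = measurable_orthogonal_transformation[OF T] borel_measurable_proj[OF L(1)]
    have "T \<circ> proj L = proj L \<circ> T"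
      using proj_orthogonal_transformation[OF L(1) T] TL by (auto simp: fun_eq_iff)
    then have "distr (distr std_gaussian borel (proj L)) borel T = distr (distr std_gaussian borel T) borel (proj L)"
      by (subst (1 2) distr_distr) auto
    then show ?thesis by (simp add: distr_std_gaussian_orthogonal[OF T])
  qed
  ultimately show ?thesis by (simp add: rotation_invariant_on_def)
qed

text \<open>The preimage of the cap under the projection is open and contains \<open>x\<close>, and
  nonempty open sets have positive Gaussian measure.\<close>

lemma emeasure_proj_gaussian_cap_pos:
  assumes L: "subspace L" and x: "x \<in> L" "x \<noteq> 0" and c: "c < 1"
  shows "emeasure (distr std_gaussian borel (proj L)) (spherical_cap c x) > 0"
proof -
  have "continuous_on UNIV (proj L)"
    by (intro linear_continuous_on linear_conv_bounded_linear[THEN iffD1] linear_proj L)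
  then have "open {y. c * norm x * norm (proj L y) < inner x (proj L y)}"
    by (intro open_Collect_less continuous_intros)
  moreover have "c * (norm x * norm x) < inner x x"
    using c x by (simp flip: power2_norm_eq_inner add: power2_eq_square)
  then have "x \<in> {y. c * norm x * norm (proj L y) < inner x (proj L y)}"
    using x by (simp add: proj_id[OF L] mult.assoc)
  ultimately have "emeasure std_gaussian {y. c * norm x * norm (proj L y) < inner x (proj L y)} > 0"
    by (intro emeasure_std_gaussian_open_pos) auto
  moreover have "proj L -` spherical_cap c x = {y. c * norm x * norm (proj L y) < inner x (proj L y)}"
    by (auto simp: spherical_cap_def)
  moreover have "emeasure (distr std_gaussian borel (proj L)) (spherical_cap c x) =
      emeasure std_gaussian (proj L -` spherical_cap c x)"
    using borel_measurable_proj[OF L]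
    by (subst emeasure_distr) (simp_all add: sets_spherical_cap measurable_cong_sets[OF sets_std_gaussian refl])
  ultimately show ?thesis by simp
qed

section \<open>The uniform distribution on the sphere as the law of a normalized Gaussian
  vector\<close>

text \<open>The value at the null event \<open>x = 0\<close> is arbitrary; it only has to lie on the sphere.\<close>
definition unit_dir :: "'a::euclidean_space \<Rightarrow> 'a" where
  "unit_dir x = (if x = 0 then (SOME b. b \<in> Basis) else sgn x)"

lemma norm_unit_dir [simp]: "norm (unit_dir x) = 1"
  using someI_ex[of "\<lambda>b::'a. b \<in> Basis"] nonempty_Basis
  by (auto simp: unit_dir_def norm_sgn)

lemma borel_measurable_unit_dir [measurable]: "unit_dir \<in> borel_measurable borel"
  unfolding unit_dir_def by measurable

text \<open>The cone measure is the radial image of the uniform distribution on the unit ball. That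
  distribution and the Gaussian measure are both rotation invariant on the whole space, so their
  radial images agree.\<close>

lemma uniform_sphere_eq:
  "(uniform_sphere :: 'a::euclidean_space measure) =
     distr std_gaussian (restrict_space borel (sphere 0 1)) unit_dir"
proof -
  let ?S = "sphere (0::'a) 1" and ?K = "cball (0::'a) 1"
  let ?M = "uniform_measure lborel ?K"
  let ?D = "distr std_gaussian (restrict_space borel ?S) unit_dir"
  have K: "emeasure lborel ?K = emeasure lborel (ball (0::'a) 1)"
    by (simp add: emeasure_cball emeasure_ball)
  have K0: "emeasure lborel ?K \<noteq> 0" "emeasure lborel ?K \<noteq> \<infinity>"
    by (auto simp: emeasure_cball less_imp_neq[OF unit_ball_vol_pos, symmetric])
  have M: "rotation_invariant_on UNIV ?M"
    unfolding rotation_invariant_on_def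
  proof (intro conjI allI impI)
    show "prob_space ?M" by (rule prob_space_uniform_measure[OF K0])
    have "AE x in lborel. x \<noteq> (0::'a)" by (rule AE_lborel_singleton)
    then have "AE x in lborel. x \<in> ?K \<longrightarrow> x \<noteq> 0" by eventually_elim auto
    then show "AE x in ?M. x \<in> UNIV \<and> x \<noteq> 0"
      by (intro AE_uniform_measureI) auto
    fix T :: "'a \<Rightarrow> 'a" assume T: "orthogonal_transformation T"
    note [measurable] = measurable_orthogonal_transformation[OF T]
    show "distr ?M borel T = ?M"
    proof (rule measure_eqI)
      fix A assume "A \<in> sets (distr ?M borel T)"
      then have [measurable]: "A \<in> sets borel" by simp
      have [measurable]: "T -` A \<in> sets borel"
        using measurable_sets_borel[OF measurable_orthogonal_transformation[OF T]] by simp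
      have "?K \<inter> T -` A = T -` (?K \<inter> A)" using T by (auto simp: orthogonal_transformation_norm)
      then have "emeasure lborel (?K \<inter> T -` A) = emeasure (distr lborel borel T) (?K \<inter> A)"
        by (simp add: emeasure_distr)
      then show "emeasure (distr ?M borel T) A = emeasure ?M A"
        by (simp add: emeasure_distr distr_lborel_orthogonal[OF T])
    qed simp
  qed simp
  have UNIV0: "(UNIV::'a set) \<noteq> {0}" using nonempty_Basis nonzero_Basis by blast
  have "proj UNIV = (\<lambda>x. x :: 'a)" by (simp add: fun_eq_iff proj_id)
  then have pU: "distr std_gaussian borel (proj UNIV) = (std_gaussian :: 'a measure)"
    by (simp add: distr_id2)
  have eq: "distr ?M borel sgn = distr std_gaussian borel sgn"
    using rotation_invariant_sgn_eq[OF subspace_UNIV M rotation_invariant_proj_gaussian[OF subspace_UNIV UNIV0]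
       emeasure_proj_gaussian_cap_pos[OF subspace_UNIV]] by (simp add: pU)
  have [measurable]: "unit_dir \<in> std_gaussian \<rightarrow>\<^sub>M restrict_space borel ?S"
    by (intro measurable_restrict_space2) auto
  have "uniform_sphere = measure_of (space ?D) (sets ?D) (emeasure ?D)"
    unfolding uniform_sphere_def
  proof (simp add: space_restrict_space, rule measure_of_eq)
    show "sets (restrict_space borel ?S) \<subseteq> Pow ?S"
      using sets.space_closed[of "restrict_space borel ?S"] by (simp add: space_restrict_space)
    fix B assume "B \<in> sigma_sets ?S (sets (restrict_space borel ?S))"
    then have B': "B \<in> sets (restrict_space borel ?S)"
      using sets.sigma_sets_eq[of "restrict_space borel ?S"] by (simp add: space_restrict_space)
    then have B[measurable]: "B \<in> sets borel" and BS: "B \<subseteq> ?S"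
      by (auto simp: sets_restrict_space)
    have [measurable]: "sgn -` B \<in> sets borel"
      using measurable_sets_borel[of "sgn :: 'a \<Rightarrow> 'a" borel B] by simp
    \<comment> \<open>The cone over \<open>B\<close> is the part of the ball with direction in
      \<open>B\<close>; the origin drops out because \<open>B\<close> consists of unit
      vectors.\<close>
    have "{t *\<^sub>R x |t x. x \<in> B \<and> 0 < t \<and> t \<le> 1} = ?K \<inter> sgn -` B"
    proof (intro equalityI subsetI)
      fix z assume "z \<in> {t *\<^sub>R x |t x. x \<in> B \<and> 0 < t \<and> t \<le> 1}"
      then obtain t x where z: "z = t *\<^sub>R x" "x \<in> B" "0 < t" "t \<le> 1" by auto
      with BS have "norm x = 1" by auto
      with z show "z \<in> ?K \<inter> sgn -` B" by (auto simp: sgn_div_norm)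
    next
      fix x assume "x \<in> ?K \<inter> sgn -` B"
      then have x: "x \<in> ?K" "sgn x \<in> B" by auto
      then have "x \<noteq> 0" using BS by auto
      then have "x = norm x *\<^sub>R sgn x" by (simp add: sgn_div_norm)
      with x \<open>x \<noteq> 0\<close> show "x \<in> {t *\<^sub>R x |t x. x \<in> B \<and> 0 < t \<and> t \<le> 1}"
        by (intro CollectI exI[of _ "norm x"] exI[of _ "sgn x"]) auto
    qed
    then have "emeasure lborel {t *\<^sub>R x |t x. x \<in> B \<and> 0 < t \<and> t \<le> 1} / emeasure lborel (ball (0::'a) 1)
       = emeasure (distr ?M borel sgn) B"
      by (simp add: emeasure_distr K)
    also have "\<dots> = emeasure std_gaussian {x. sgn x \<in> B}"
      unfolding eq by (simp add: emeasure_distr vimage_def)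
    also have "\<dots> = emeasure std_gaussian {x. unit_dir x \<in> B}"
    proof (rule emeasure_eq_AE)
      have "AE x in std_gaussian. x \<notin> {0::'a}"
        by (rule AE_std_gaussian_subspace) (use UNIV0 in auto)
      then show "AE x in std_gaussian. x \<in> {x. sgn x \<in> B} \<longleftrightarrow> x \<in> {x. unit_dir x \<in> B}"
        by eventually_elim (auto simp: unit_dir_def)
    qed auto
    also have "\<dots> = emeasure ?D B"
      using B' by (simp add: emeasure_distr vimage_def)
    finally show "emeasure lborel {t *\<^sub>R x |t x. x \<in> B \<and> 0 < t \<and> t \<le> 1} / emeasure lborel (ball (0::'a) 1)
       = emeasure ?D B" .
  qed
  then show ?thesis by (simp only: measure_of_of_measure)
qed

lemma prob_space_uniform_sphere: "prob_space (uniform_sphere :: 'a::euclidean_space measure)"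
  unfolding uniform_sphere_eq
  by (intro prob_space.prob_space_distr prob_space_std_gaussian measurable_restrict_space2) auto

lemma sets_uniform_sphere: "sets (uniform_sphere :: 'a::euclidean_space measure) = sets (restrict_space borel (sphere 0 1))"
  by (simp add: uniform_sphere_eq)

subsection \<open>Faces and normal cones of polyhedral cones\<close>

text \<open>Farkas' lemma: a finitely generated cone is closed, so a point outside it is strictly
  separated from it, and the negative of the separating normal is a polar vector.\<close>

lemma convex_cone_hull_polar:
  fixes S :: "'a::euclidean_space set"
  assumes "finite S"
  shows "y \<in> convex_cone hull S \<longleftrightarrow> (\<forall>x. (\<forall>v\<in>S. inner v x \<le> 0) \<longrightarrow> inner y x \<le> 0)"
proof
  assume y: "y \<in> convex_cone hull S"
  have "convex_cone {y. \<forall>x. (\<forall>v\<in>S. inner v x \<le> 0) \<longrightarrow> inner y x \<le> 0}"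
    by (auto simp: convex_cone_iff inner_add_left add_nonpos_nonpos mult_nonneg_nonpos)
  then have "convex_cone hull S \<subseteq> {y. \<forall>x. (\<forall>v\<in>S. inner v x \<le> 0) \<longrightarrow> inner y x \<le> 0}"
    by (intro hull_minimal) auto
  with y show "\<forall>x. (\<forall>v\<in>S. inner v x \<le> 0) \<longrightarrow> inner y x \<le> 0" by auto
next
  assume y: "\<forall>x. (\<forall>v\<in>S. inner v x \<le> 0) \<longrightarrow> inner y x \<le> 0"
  show "y \<in> convex_cone hull S"
  proof (rule ccontr)
    assume "y \<notin> convex_cone hull S"
    then obtain a b where ab: "inner a y < b" "\<forall>x\<in>convex_cone hull S. inner a x > b"
      using separating_hyperplane_closed_point[OF convex_convex_cone_hull closed_convex_cone_hull[OF assms]]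
      by blast
    then have "b < 0" using convex_cone_hull_contains_0[of S] by force
    have "inner v (- a) \<le> 0" if "v \<in> S" for v
    proof (rule ccontr)
      assume "\<not> inner v (- a) \<le> 0"
      then have neg: "inner a v < 0" by (simp add: inner_commute)
      \<comment> \<open>Both \<open>b\<close> and \<open>inner a v\<close> are negative, so this is
        a positive multiple of a generator; it attains the value \<open>b\<close> exactly, against
        strict separation.\<close>
      have "(b / inner a v) *\<^sub>R v \<in> convex_cone hull S"
        using that neg \<open>b < 0\<close> by (intro convex_cone_hull_mul hull_inc) (auto simp: divide_nonpos_neg)
      then have "inner a ((b / inner a v) *\<^sub>R v) > b" using ab by blast
      with neg show False by simp
    qed
    then have "inner y (- a) \<le> 0" using y by blast
    with ab \<open>b < 0\<close> show False by (simp add: inner_commute)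
  qed
qed

lemma orthogonal_comp_span: "orthogonal_comp (span S) = orthogonal_comp S"
  by (auto simp: orthogonal_comp_def orthogonal_commute intro: span_base orthogonal_to_span)

lemma orthogonal_comp_twice: "orthogonal_comp (orthogonal_comp S) = span (S :: 'a::euclidean_space set)"
  by (metis orthogonal_comp_self orthogonal_comp_span subspace_span)

lemma mem_orthogonal_comp: "x \<in> orthogonal_comp S \<longleftrightarrow> (\<forall>v\<in>S. inner v x = 0)"
  by (simp add: orthogonal_comp_def orthogonal_def)

lemma dim_orthogonal_comp:
  fixes S :: "'a::euclidean_space set"
  shows "dim (orthogonal_comp S) + dim S = DIM('a)"
  using dim_subspace_orthogonal_to_vectors[of "span S" UNIV]
  by (simp add: orthogonal_comp_span[of S, symmetric]) (simp add: orthogonal_comp_def dim_UNIV)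

section \<open>Cones with indexed constraints and their active sets\<close>

text \<open>An indexed family of normals keeps the index set fixed while the normals vary randomly,
  even if some of them coincide.\<close>

definition cone_of :: "'i set \<Rightarrow> ('i \<Rightarrow> 'a::euclidean_space) \<Rightarrow> 'a set" where
  "cone_of J w = {x. \<forall>j\<in>J. inner (w j) x \<le> 0}"

text \<open>The relative interior of the face on which exactly the constraints in \<open>I\<close> are active
  (empty if there is no such face).\<close>
definition active_part :: "'i set \<Rightarrow> ('i \<Rightarrow> 'a::euclidean_space) \<Rightarrow> 'i set \<Rightarrow> 'a set" where
  "active_part J w I = {x. (\<forall>i\<in>I. inner (w i) x = 0) \<and> (\<forall>j\<in>J - I. inner (w j) x < 0)}"

definition active_face :: "'i set \<Rightarrow> ('i \<Rightarrow> 'a::euclidean_space) \<Rightarrow> 'i set \<Rightarrow> 'a set" where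
  "active_face J w I = {x \<in> cone_of J w. \<forall>i\<in>I. inner (w i) x = 0}"

text \<open>The contribution of the face with active set \<open>I\<close> to the curvature measure,
  with the face replaced by its relatively open part. If no face has this active set the first angle
  is that of the empty set, hence 0, so such sets \<open>I\<close> may be included in sums.\<close>

definition curv_term :: "nat \<Rightarrow> 'i set \<Rightarrow> ('i \<Rightarrow> 'a::euclidean_space) \<Rightarrow> 'a set \<Rightarrow> 'i set \<Rightarrow> real" where
  "curv_term k J w A I = (if dim (w ` I) + k = DIM('a)
     then gauss_on (orthogonal_comp (w ` I)) (active_part J w I \<inter> A) * gauss_on (span (w ` I)) (convex_cone hull (w ` I))
     else 0)"

lemma active_part_subset: "active_part J w I \<subseteq> active_face J w I"
  by (auto simp: active_part_def active_face_def cone_of_def) force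

lemma active_face_subset: "active_face J w I \<subseteq> orthogonal_comp (w ` I)"
  by (auto simp: active_face_def mem_orthogonal_comp)

lemma convex_cone_of: "convex (cone_of J w)"
proof -
  have "cone_of J w = (\<Inter>j\<in>J. {x. inner (w j) x \<le> 0})" by (auto simp: cone_of_def)
  then show ?thesis by (auto intro!: convex_INT convex_halfspace_le)
qed

text \<open>The vector \<open>sum w I\<close> is normal to a supporting hyperplane: on the cone a
  sum of nonpositive terms vanishes only if every term does.\<close>

lemma active_face_face_of:
  assumes "finite I" "I \<subseteq> J"
  shows "active_face J w I face_of cone_of J w"
proof -
  have *: "inner (sum w I) x = 0 \<longleftrightarrow> (\<forall>i\<in>I. inner (w i) x = 0)" if "x \<in> cone_of J w" for x
    using that assms sum_nonneg_eq_0_iff[of I "\<lambda>i. - inner (w i) x"]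
    by (auto simp: cone_of_def inner_sum_left sum_negf)
  have "inner (sum w I) x \<le> 0" if "x \<in> cone_of J w" for x
    using that assms by (auto simp: cone_of_def inner_sum_left intro!: sum_nonpos)
  then have "(cone_of J w \<inter> {x. inner (sum w I) x = 0}) face_of cone_of J w"
    by (rule face_of_Int_supporting_hyperplane_le[OF convex_cone_of])
  also have "cone_of J w \<inter> {x. inner (sum w I) x = 0} = active_face J w I"
    using * by (auto simp: active_face_def)
  finally show ?thesis .
qed

text \<open>Inactive constraints are strict at \<open>p\<close> and survive a small step, while
  active ones are controlled by the direction \<open>y\<close>. So the tangent cone at
  \<open>p\<close> is cut out by the constraints in \<open>I\<close> alone.\<close>

lemma active_part_perturb:
  assumes "finite J" and p: "p \<in> active_part J w I" and y: "\<And>i. i \<in> I \<Longrightarrow> inner (w i) y \<le> 0"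
  obtains e where "e > 0" "p + e *\<^sub>R y \<in> cone_of J w"
proof -
  have "\<forall>\<^sub>F e in at_right 0. \<forall>j\<in>J - I. inner (w j) (p + e *\<^sub>R y) < 0"
  proof (intro eventually_ball_finite ballI)
    show "finite (J - I)" using assms by auto
    fix j assume "j \<in> J - I"
    then have "inner (w j) p < 0" using p by (auto simp: active_part_def)
    moreover have "((\<lambda>e. inner (w j) (p + e *\<^sub>R y)) \<longlongrightarrow> inner (w j) (p + 0 *\<^sub>R y)) (at_right 0)"
      by (intro tendsto_intros)
    ultimately show "\<forall>\<^sub>F e in at_right 0. inner (w j) (p + e *\<^sub>R y) < 0"
      by (intro order_tendstoD(2)) auto
  qed
  moreover have "\<forall>\<^sub>F e in at_right (0::real). e > 0" by (rule eventually_at_right_less)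
  ultimately have "\<forall>\<^sub>F e in at_right 0. e > 0 \<and> (\<forall>j\<in>J - I. inner (w j) (p + e *\<^sub>R y) < 0)"
    by eventually_elim auto
  then obtain e where e: "e > 0" "\<forall>j\<in>J - I. inner (w j) (p + e *\<^sub>R y) < 0"
    using eventually_happens'[of "at_right (0::real)"] by auto
  have "inner (w i) (p + e *\<^sub>R y) \<le> 0" if "i \<in> I" for i
    using p y[OF that] that e by (auto simp: active_part_def inner_add_right mult_nonneg_nonpos)
  with e have "p + e *\<^sub>R y \<in> cone_of J w" by (force simp: cone_of_def)
  with e that show thesis by blast
qed

lemma span_active_face:
  assumes "finite J" and p: "p \<in> active_part J w I"
  shows "span (active_face J w I) = orthogonal_comp (w ` I)"
proof
  show "span (active_face J w I) \<subseteq> orthogonal_comp (w ` I)"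
    by (intro span_minimal active_face_subset subspace_orthogonal_comp)
  show "orthogonal_comp (w ` I) \<subseteq> span (active_face J w I)"
  proof
    fix y assume "y \<in> orthogonal_comp (w ` I)"
    then have y: "\<And>i. i \<in> I \<Longrightarrow> inner (w i) y = 0" by (auto simp: mem_orthogonal_comp)
    then obtain e where e: "e > 0" "p + e *\<^sub>R y \<in> cone_of J w"
      using active_part_perturb[OF assms, of y] by force
    have "p + e *\<^sub>R y \<in> active_face J w I" "p \<in> active_face J w I"
      using e y p active_part_subset[of J w I] by (auto simp: active_face_def inner_add_right)
    then have "(1 / e) *\<^sub>R ((p + e *\<^sub>R y) - p) \<in> span (active_face J w I)"
      by (intro span_scale span_diff span_base)
    with e show "y \<in> span (active_face J w I)" by simp
  qed
qed

text \<open>The normal cone is polar to the tangent cone at \<open>p\<close>, where only the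
  constraints in \<open>I\<close> count; Farkas' lemma identifies this polar cone with the hull of
  their normals.\<close>

lemma normal_cone_active_face:
  assumes "finite J" "I \<subseteq> J" and p: "p \<in> active_part J w I"
  shows "normal_cone (cone_of J w) (active_face J w I) = convex_cone hull (w ` I)"
proof -
  have fin: "finite (w ` I)" using assms finite_subset by auto
  have "(\<forall>x\<in>cone_of J w. inner y x \<le> 0) \<and> (\<forall>x\<in>active_face J w I. inner y x = 0)
     \<longleftrightarrow> (\<forall>x. (\<forall>v\<in>w ` I. inner v x \<le> 0) \<longrightarrow> inner y x \<le> 0)" (is "?l \<longleftrightarrow> ?r") for y
  proof
    assume l: ?l
    show ?r
    proof (intro allI impI)
      fix x assume "\<forall>v\<in>w ` I. inner v x \<le> 0"
      then obtain e where e: "e > 0" "p + e *\<^sub>R x \<in> cone_of J w"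
        using active_part_perturb[OF assms(1) p, of x] by auto
      have "inner y p = 0" using l p active_part_subset[of J w I] by blast
      with l e have "e * inner y x \<le> 0" by (force simp: inner_add_right)
      with e show "inner y x \<le> 0" by (simp add: mult_le_0_iff)
    qed
  next
    assume r: ?r
    show ?l
    proof (intro conjI ballI)
      show "inner y x \<le> 0" if "x \<in> cone_of J w" for x
        using r that assms by (auto simp: cone_of_def)
      show "inner y x = 0" if "x \<in> active_face J w I" for x
      proof -
        have "\<forall>v\<in>w ` I. inner v x \<le> 0" "\<forall>v\<in>w ` I. inner v (- x) \<le> 0"
          using that by (auto simp: active_face_def)
        then have "inner y x \<le> 0" "inner y (- x) \<le> 0" using r by blast+
        then show ?thesis by simp
      qed
    qed
  qed
  then show ?thesis unfolding normal_cone_def by (auto simp: convex_cone_hull_polar[OF fin])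
qed

text \<open>Take \<open>I\<close> as the constraints vanishing on all of \<open>F\<close>. A
  relative interior point \<open>p\<close> of \<open>F\<close> satisfies the others strictly, and
  every point of the active face is an endpoint of a segment of the cone through \<open>p\<close>,
  hence lies in \<open>F\<close>.\<close>

lemma face_of_cone_of_active:
  assumes "finite J" and F: "F face_of cone_of J w" "F \<noteq> {}"
  obtains I where "I \<subseteq> J" "active_part J w I \<noteq> {}" "F = active_face J w I"
proof -
  have cF: "convex F" using F face_of_imp_convex by blast
  have FC: "F \<subseteq> cone_of J w" using F face_of_imp_subset by blast
  define I where "I = {j\<in>J. \<forall>x\<in>F. inner (w j) x = 0}"
  obtain p where p: "p \<in> rel_interior F" using rel_interior_eq_empty[OF cF] F by auto
  then have pF: "p \<in> F" using rel_interior_subset by blast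
  have strict: "inner (w j) p < 0" if j: "j \<in> J - I" for j
  proof (rule ccontr)
    assume "\<not> inner (w j) p < 0"
    then have p0: "inner (w j) p = 0" using pF FC j by (force simp: cone_of_def)
    obtain x where x: "x \<in> F" "inner (w j) x \<noteq> 0" using j by (auto simp: I_def)
    then have "inner (w j) x < 0" using FC j by (force simp: cone_of_def)
    moreover obtain e where e: "e > 1" "(1 - e) *\<^sub>R x + e *\<^sub>R p \<in> F"
      using p convex_rel_interior_iff[OF cF F(2)] x by blast
    have "(1 - e) * inner (w j) x \<le> 0" using FC e(2) j p0 by (force simp: cone_of_def inner_add_right)
    ultimately show False using e(1) by (simp add: mult_le_0_iff)
  qed
  have pI: "p \<in> active_part J w I"
    using strict pF by (auto simp: active_part_def I_def)
  have "active_face J w I \<subseteq> F"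
  proof
    fix y assume y: "y \<in> active_face J w I"
    obtain e where e: "e > 0" "p + e *\<^sub>R (p - y) \<in> cone_of J w"
      using active_part_perturb[OF assms(1) pI, of "p - y"] y pI
      by (auto simp: active_face_def active_part_def inner_diff_right)
    show "y \<in> F"
    proof (cases "y = p")
      case False
      \<comment> \<open>The weight \<open>u\<close> is chosen so that \<open>p\<close> is the
        combination of \<open>y\<close> and \<open>p + e *\<^sub>R (p - y)\<close> with weights
        \<open>u\<close> and \<open>1 - u\<close>.\<close>
      define u where "u = e / (1 + e)"
      have u: "0 < u" "u < 1" "(1 - u) * (1 + e) = 1" "(1 - u) * e = u" using e by (auto simp: u_def field_simps)
      have "(1 - (1 - u)) *\<^sub>R y + (1 - u) *\<^sub>R (p + e *\<^sub>R (p - y)) =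
          u *\<^sub>R y + ((1 - u) * (1 + e)) *\<^sub>R p - ((1 - u) * e) *\<^sub>R y"
        by (simp add: algebra_simps)
      also have "\<dots> = p" unfolding u(3,4) by simp
      finally have "p = (1 - (1 - u)) *\<^sub>R y + (1 - u) *\<^sub>R (p + e *\<^sub>R (p - y))" by simp
      moreover have "y \<noteq> p + e *\<^sub>R (p - y)"
      proof
        assume "y = p + e *\<^sub>R (p - y)"
        then have "(1 + e) *\<^sub>R (p - y) = 0" by (simp add: algebra_simps)
        with e(1) False show False by simp
      qed
      ultimately have "p \<in> open_segment y (p + e *\<^sub>R (p - y))"
        using u(1,2) unfolding in_segment by (intro conjI exI[of _ "1 - u"]) auto
      moreover have "y \<in> cone_of J w" using y by (auto simp: active_face_def)
      ultimately show ?thesis using face_ofD[OF F(1)] pF e by blast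
    qed (use pF in simp)
  qed
  moreover have "F \<subseteq> active_face J w I" using FC by (auto simp: active_face_def I_def)
  ultimately have "F = active_face J w I" by blast
  moreover have "I \<subseteq> J" unfolding I_def by blast
  moreover have "active_part J w I \<noteq> {}" using pI by blast
  ultimately show thesis by (intro that)
qed

lemma active_part_determines:
  assumes "I \<subseteq> J" "I' \<subseteq> J" "active_part J w I \<noteq> {}" "active_part J w I' \<noteq> {}"
    and "active_face J w I = active_face J w I'"
  shows "I = I'"
proof -
  have "I' \<subseteq> I" if sub: "I' \<subseteq> J" and ne: "active_part J w I \<noteq> {}" and le: "active_face J w I \<subseteq> active_face J w I'" for I I'
  proof
    fix j assume j: "j \<in> I'"
    obtain p where p: "p \<in> active_part J w I" using ne by auto
    then have "p \<in> active_face J w I'" using active_part_subset[of J w I] le by blast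
    then have "inner (w j) p = 0" using j by (auto simp: active_face_def)
    moreover have "inner (w j) p < 0" if "j \<notin> I"
      using p j sub that unfolding active_part_def by blast
    ultimately show "j \<in> I" by fastforce
  qed
  then show ?thesis using assms by blast
qed

lemma closed_cone_of: "closed (cone_of J w)"
proof -
  have "cone_of J w = (\<Inter>j\<in>J. {x. inner (w j) x \<le> 0})" by (auto simp: cone_of_def)
  then show ?thesis by (auto intro!: closed_INT closed_halfspace_le)
qed

lemma borel_active_face: "active_face J w I \<in> sets borel"
proof -
  have "active_face J w I = cone_of J w \<inter> orthogonal_comp (w ` I)"
    by (auto simp: active_face_def mem_orthogonal_comp)
  then show ?thesis
    using borel_closed[OF closed_Int[OF closed_cone_of closed_subspace[OF subspace_orthogonal_comp]], of J w "w ` I"]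
    by simp
qed

lemma borel_active_part:
  assumes "finite J"
  shows "active_part J w I \<in> sets borel"
proof -
  have "open (\<Inter>j\<in>J - I. {x. inner (w j) x < 0})"
    using assms by (auto intro!: open_INT open_halfspace_lt)
  moreover have "active_part J w I = (\<Inter>j\<in>J - I. {x. inner (w j) x < 0}) \<inter> orthogonal_comp (w ` I)"
    by (auto simp: active_part_def mem_orthogonal_comp)
  ultimately show ?thesis
    using sets.Int[OF borel_open borel_closed[OF closed_subspace[OF subspace_orthogonal_comp]]] by simp
qed

text \<open>The face minus its relatively open part lies in finitely many hyperplanes of its linear
  hull; they are proper because the inactive normals do not vanish at \<open>p\<close>, which
  belongs to the hull.\<close>

lemma gauss_on_active_face:
  assumes "finite J" "I \<subseteq> J" and p: "p \<in> active_part J w I" and A: "A \<in> sets borel"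
  shows "gauss_on (orthogonal_comp (w ` I)) (active_face J w I \<inter> A)
       = gauss_on (orthogonal_comp (w ` I)) (active_part J w I \<inter> A)"
proof -
  let ?L = "orthogonal_comp (w ` I)"
  have L: "subspace ?L" by (rule subspace_orthogonal_comp)
  note [measurable] = borel_measurable_proj[OF L] A
  have "AE x in std_gaussian. \<forall>j\<in>J - I. inner (proj ?L (w j)) x \<noteq> 0"
  proof (intro AE_finite_allI AE_std_gaussian_inner)
    fix j assume "j \<in> J - I"
    moreover have "p \<in> ?L" using p by (auto simp: mem_orthogonal_comp active_part_def)
    ultimately show "proj ?L (w j) \<noteq> 0"
      using p inner_proj_left[OF L, of p "w j"] by (force simp: active_part_def)
  qed (use assms in auto)
  then have "AE x in std_gaussian. proj ?L x \<in> active_face J w I \<inter> A \<longleftrightarrow> proj ?L x \<in> active_part J w I \<inter> A"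
  proof eventually_elim
    case (elim x)
    then have nz: "\<forall>j\<in>J - I. inner (w j) (proj ?L x) \<noteq> 0" by (simp add: inner_proj_sym[OF L])
    have "proj ?L x \<in> active_part J w I" if "proj ?L x \<in> active_face J w I"
      using that nz by (simp add: active_face_def active_part_def cone_of_def order.strict_iff_order)
    then show ?case using active_part_subset[of J w I] by blast
  qed
  moreover have "{x. proj ?L x \<in> active_part J w I \<inter> A} \<in> sets borel"
    using borel_active_part[OF assms(1), of w I] by measurable
  moreover have "{x. proj ?L x \<in> active_face J w I \<inter> A} \<in> sets borel"
    using borel_active_face[of J w I] by measurable
  ultimately show ?thesis
    unfolding gauss_on_eq_proj[OF L] by (intro measure_eq_AE) auto
qed

text \<open>Faces correspond bijectively to active sets of nonempty active part, and all other
  summands are 0. The sum over \<open>Pow J\<close> has a range independent of \<open>w\<close>, so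
  it can be integrated termwise over random constraints.\<close>

theorem curv_measure_cone_of:
  fixes w :: "'i \<Rightarrow> 'a::euclidean_space"
  assumes J: "finite J" and A: "A \<in> sets borel"
  shows "curv_measure k (cone_of J w) A = (\<Sum>I\<in>Pow J. curv_term k J w A I)"
proof -
  define K where "K = {I. I \<subseteq> J \<and> active_part J w I \<noteq> {} \<and> dim (w ` I) + k = DIM('a)}"
  have aff: "aff_dim (active_face J w I) = int k \<longleftrightarrow> dim (w ` I) + k = DIM('a)"
    if ne: "active_part J w I \<noteq> {}" for I
  proof -
    obtain p where p: "p \<in> active_part J w I" using ne by auto
    have "0 \<in> active_face J w I" by (simp add: active_face_def cone_of_def)
    then have "aff_dim (active_face J w I) = int (dim (active_face J w I))"
      by (intro aff_dim_zero hull_inc)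
    also have "dim (active_face J w I) = dim (orthogonal_comp (w ` I))"
      using span_active_face[OF J p] dim_span[of "active_face J w I"] by simp
    finally show ?thesis using dim_orthogonal_comp[of "w ` I"] by linarith
  qed
  have bij: "bij_betw (active_face J w) K (kfaces k (cone_of J w))"
    unfolding bij_betw_def
  proof
    show "inj_on (active_face J w) K"
      by (auto simp: inj_on_def K_def dest: active_part_determines)
    show "active_face J w ` K = kfaces k (cone_of J w)"
    proof (intro equalityI subsetI)
      fix F assume "F \<in> active_face J w ` K"
      then obtain I where "F = active_face J w I" "I \<in> K" by blast
      then show "F \<in> kfaces k (cone_of J w)"
        using active_face_face_of[of I J w] finite_subset[OF _ J] aff[of I] by (simp add: K_def kfaces_def)
    next
      fix F assume F: "F \<in> kfaces k (cone_of J w)"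
      then have "F \<noteq> {}" by (auto simp: kfaces_def)
      then obtain I where I: "I \<subseteq> J" "active_part J w I \<noteq> {}" "F = active_face J w I"
        using face_of_cone_of_active[OF J, of F] F by (auto simp: kfaces_def)
      then show "F \<in> active_face J w ` K" using aff[OF I(2)] F by (auto simp: K_def kfaces_def)
    qed
  qed
  have "curv_measure k (cone_of J w) A =
     (\<Sum>I\<in>K. gauss_on (span (active_face J w I)) (active_face J w I \<inter> A) *
        gauss_on (orthogonal_comp (span (active_face J w I))) (normal_cone (cone_of J w) (active_face J w I)))"
    unfolding curv_measure_def by (rule sum.reindex_bij_betw[OF bij, symmetric])
  also have "\<dots> = (\<Sum>I\<in>K. curv_term k J w A I)"
  proof (intro sum.cong refl)
    fix I assume "I \<in> K"
    then have I: "I \<subseteq> J" "dim (w ` I) + k = DIM('a)" and "active_part J w I \<noteq> {}"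
      by (auto simp: K_def)
    then obtain p where p: "p \<in> active_part J w I" by blast
    show "gauss_on (span (active_face J w I)) (active_face J w I \<inter> A) *
        gauss_on (orthogonal_comp (span (active_face J w I))) (normal_cone (cone_of J w) (active_face J w I))
       = curv_term k J w A I"
      using I by (simp add: curv_term_def span_active_face[OF J p] orthogonal_comp_twice
          normal_cone_active_face[OF J I(1) p] gauss_on_active_face[OF J I(1) p A])
  qed
  also have "\<dots> = (\<Sum>I\<in>Pow J. curv_term k J w A I)"
  proof (intro sum.mono_neutral_left ballI)
    fix I assume "I \<in> Pow J - K"
    then have "active_part J w I = {} \<or> dim (w ` I) + k \<noteq> DIM('a)" by (auto simp: K_def)
    then show "curv_term k J w A I = 0"
      by (auto simp: curv_term_def gauss_on_def)
  qed (use J in \<open>auto simp: K_def\<close>)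
  finally show ?thesis .
qed

subsection \<open>Measurable dependence on the constraints\<close>

abbreviation perp :: "'a::euclidean_space set \<Rightarrow> 'a \<Rightarrow> 'a" where
  "perp V \<equiv> proj (orthogonal_comp V)"

text \<open>One Gram-Schmidt step. If \<open>v\<close> already lies in the span of \<open>V\<close>,
  then \<open>perp V v\<close> is 0 and nothing is subtracted. The recursion yields measurability of
  projections onto random subspaces.\<close>

lemma perp_insert:
  "perp (insert v V) x = perp V x - (inner (perp V x) (perp V v) / inner (perp V v) (perp V v)) *\<^sub>R perp V v"
proof (rule proj_unique[OF subspace_orthogonal_comp])
  let ?q = "perp V x" and ?a = "perp V v"
  let ?z = "?q - (inner ?q ?a / inner ?a ?a) *\<^sub>R ?a"
  note L = subspace_orthogonal_comp[of V]
  have "?z \<in> orthogonal_comp V"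
    by (intro subspace_diff subspace_scale L proj_mem)
  moreover have "inner v ?q = inner ?a ?q" "inner v ?a = inner ?a ?a"
    using inner_proj_proj[OF L] by (metis inner_commute)+
  then have "inner v ?z = 0"
    by (cases "?a = 0") (simp_all add: inner_diff_right inner_commute)
  ultimately show "?z \<in> orthogonal_comp (insert v V)" by (simp add: mem_orthogonal_comp)
  show "x - ?z \<in> orthogonal_comp (orthogonal_comp (insert v V))"
    unfolding mem_orthogonal_comp[of _ "orthogonal_comp (insert v V)"]
  proof
    fix z assume "z \<in> orthogonal_comp (insert v V)"
    then have z: "z \<in> orthogonal_comp V" "inner z v = 0"
      by (auto simp: mem_orthogonal_comp inner_commute)
    then show "inner z (x - ?z) = 0"
      using inner_proj_right[OF L z(1)] by (simp add: inner_diff_right)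
  qed
qed

lemma perp_eq_0_iff: "perp V v = 0 \<longleftrightarrow> v \<in> span V"
proof
  assume "perp V v = 0"
  then have "v \<in> orthogonal_comp (orthogonal_comp V)"
    using proj_residual[OF subspace_orthogonal_comp, of v V] by simp
  then show "v \<in> span V" by (simp add: orthogonal_comp_twice)
next
  assume "v \<in> span V"
  then show "perp V v = 0"
    by (intro proj_unique) (auto simp: orthogonal_comp_twice subspace_orthogonal_comp subspace_0)
qed

lemma proj_span: "proj (span V) x = x - perp V x"
  using proj_orthogonal_comp[OF subspace_orthogonal_comp, of V x] by (simp add: orthogonal_comp_twice)

lemma borel_measurable_perp:
  fixes w :: "'m \<Rightarrow> 'i \<Rightarrow> 'a::euclidean_space"
  assumes "finite I" "\<And>i. i \<in> I \<Longrightarrow> (\<lambda>\<omega>. w \<omega> i) \<in> borel_measurable M" "f \<in> borel_measurable M"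
  shows "(\<lambda>\<omega>. perp (w \<omega> ` I) (f \<omega>)) \<in> borel_measurable M"
  using assms
proof (induction I arbitrary: f rule: finite_induct)
  case empty
  have "perp {} x = x" for x :: 'a
    by (intro proj_id[OF subspace_orthogonal_comp]) (simp add: mem_orthogonal_comp)
  with empty show ?case by simp
next
  case (insert i I)
  have [measurable]: "(\<lambda>\<omega>. perp (w \<omega> ` I) (f \<omega>)) \<in> borel_measurable M"
    "(\<lambda>\<omega>. perp (w \<omega> ` I) (w \<omega> i)) \<in> borel_measurable M"
    using insert by auto
  show ?case unfolding image_insert perp_insert by measurable
qed

text \<open>The dimension grows exactly in those Gram-Schmidt steps whose new vector has a nonzero
  residual.\<close>

lemma measurable_dim_image:
  fixes w :: "'m \<Rightarrow> 'i \<Rightarrow> 'a::euclidean_space"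
  assumes "finite I" "\<And>i. i \<in> I \<Longrightarrow> (\<lambda>\<omega>. w \<omega> i) \<in> borel_measurable M"
  shows "(\<lambda>\<omega>. dim (w \<omega> ` I)) \<in> M \<rightarrow>\<^sub>M count_space UNIV"
  using assms
proof (induction I rule: finite_induct)
  case (insert i I)
  have [measurable]: "(\<lambda>\<omega>. perp (w \<omega> ` I) (w \<omega> i)) \<in> borel_measurable M"
    "(\<lambda>\<omega>. dim (w \<omega> ` I)) \<in> M \<rightarrow>\<^sub>M count_space UNIV"
    using insert by (auto intro: borel_measurable_perp)
  have "dim (w \<omega> ` insert i I) = (if perp (w \<omega> ` I) (w \<omega> i) = 0 then dim (w \<omega> ` I) else Suc (dim (w \<omega> ` I)))" for \<omega>
    by (simp add: dim_insert perp_eq_0_iff)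
  then show ?case by simp
qed simp

lemma convex_cone_hull_finite_image:
  fixes w :: "'i \<Rightarrow> 'a::euclidean_space"
  assumes "finite I"
  shows "convex_cone hull (w ` I) = {\<Sum>i\<in>I. c i *\<^sub>R w i | c. \<forall>i\<in>I. 0 \<le> c i}" (is "_ = ?R")
proof
  show "convex_cone hull (w ` I) \<subseteq> ?R"
  proof (rule hull_minimal)
    show "w ` I \<subseteq> ?R"
    proof
      fix x assume "x \<in> w ` I"
      then obtain j where j: "j \<in> I" "x = w j" by auto
      then have "x = (\<Sum>i\<in>I. (if i = j then 1 else 0) *\<^sub>R w i)"
        using assms by (simp add: if_distrib[of "\<lambda>c. c *\<^sub>R _"] cong: if_cong)
      then show "x \<in> ?R" by fastforce
    qed
    show "convex_cone ?R"
      unfolding convex_cone_iff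
    proof (intro conjI ballI allI impI)
      show "0 \<in> ?R" by (auto intro!: exI[of _ "\<lambda>_. 0"])
      fix x assume "x \<in> ?R"
      then obtain c where c: "x = (\<Sum>i\<in>I. c i *\<^sub>R w i)" "\<forall>i\<in>I. 0 \<le> c i" by auto
      show "t *\<^sub>R x \<in> ?R" if "t \<ge> 0" for t :: real
        using c that by (auto simp: scaleR_sum_right intro!: exI[of _ "\<lambda>i. t * c i"])
      fix y assume "y \<in> ?R"
      then obtain d where d: "y = (\<Sum>i\<in>I. d i *\<^sub>R w i)" "\<forall>i\<in>I. 0 \<le> d i" by auto
      show "x + y \<in> ?R"
        using c d by (auto simp: sum.distrib scaleR_add_left intro!: exI[of _ "\<lambda>i. c i + d i"])
    qed
  qed
  show "?R \<subseteq> convex_cone hull (w ` I)"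
  proof safe
    fix c :: "'i \<Rightarrow> real" assume c: "\<forall>i\<in>I. 0 \<le> c i"
    have "F \<subseteq> I \<Longrightarrow> (\<Sum>i\<in>F. c i *\<^sub>R w i) \<in> convex_cone hull (w ` I)" if "finite F" for F
      using that c
      by (induction F rule: finite_induct)
         (auto intro!: convex_cone_hull_add convex_cone_hull_mul intro: hull_inc simp: convex_cone_hull_contains_0)
    then show "(\<Sum>i\<in>I. c i *\<^sub>R w i) \<in> convex_cone hull (w ` I)" using assms by simp
  qed
qed

text \<open>The cone is closed and nonnegative rational combinations of the generators are dense in
  it. This writes membership with countable quantifiers only, which makes it measurable in
  \<open>w\<close> and \<open>y\<close>.\<close>

lemma mem_convex_cone_hull_approx:
  fixes w :: "'i \<Rightarrow> 'a::euclidean_space"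
  assumes I: "finite I"
  shows "y \<in> convex_cone hull (w ` I) \<longleftrightarrow>
    (\<forall>m::nat. \<exists>N::nat. \<exists>k\<in>Pi\<^sub>E I (\<lambda>_. UNIV::nat set). norm (y - (\<Sum>i\<in>I. (real (k i) / real (Suc N)) *\<^sub>R w i)) < 1 / real (Suc m))"
    (is "_ \<longleftrightarrow> ?R")
proof
  assume "y \<in> convex_cone hull (w ` I)"
  then obtain c where c: "y = (\<Sum>i\<in>I. c i *\<^sub>R w i)" "\<And>i. i \<in> I \<Longrightarrow> 0 \<le> c i"
    by (auto simp: convex_cone_hull_finite_image[OF I])
  \<comment> \<open>Rounding up keeps the numerators nonnegative and moves each coefficient by at
    most \<open>1 / (N + 1)\<close>.\<close>
  define k where "k N = restrict (\<lambda>i. nat \<lceil>real (Suc N) * c i\<rceil>) I" for N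
  have lim: "(\<lambda>N. \<Sum>i\<in>I. (real (k N i) / real (Suc N)) *\<^sub>R w i) \<longlonglongrightarrow> y"
    unfolding c(1)
  proof (intro tendsto_sum tendsto_scaleR tendsto_const)
    fix i assume i: "i \<in> I"
    have k: "real (k N i) = of_int \<lceil>real (Suc N) * c i\<rceil>" for N
      using c(2)[OF i] i by (simp add: k_def del: of_nat_Suc)
    show "(\<lambda>N. real (k N i) / real (Suc N)) \<longlonglongrightarrow> c i"
    proof (rule real_tendsto_sandwich)
      show "\<forall>\<^sub>F N in sequentially. c i \<le> real (k N i) / real (Suc N)"
        unfolding k by (intro always_eventually allI) (simp add: pos_le_divide_eq mult.commute del: of_nat_Suc)
      show "\<forall>\<^sub>F N in sequentially. real (k N i) / real (Suc N) \<le> c i + 1 / real (Suc N)"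
      proof (intro always_eventually allI)
        fix N
        have "real (k N i) \<le> real (Suc N) * c i + 1" unfolding k by linarith
        also have "\<dots> = (c i + 1 / real (Suc N)) * real (Suc N)" by (simp add: field_simps)
        finally show "real (k N i) / real (Suc N) \<le> c i + 1 / real (Suc N)"
          by (subst pos_divide_le_eq) auto
      qed
      have "(\<lambda>N. c i + 1 / real (Suc N)) \<longlonglongrightarrow> c i + 0"
        by (intro tendsto_add tendsto_const lim_1_over_n[THEN LIMSEQ_Suc])
      then show "(\<lambda>N. c i + 1 / real (Suc N)) \<longlonglongrightarrow> c i" by simp
    qed auto
  qed
  show ?R
  proof
    fix m
    have "\<forall>\<^sub>F N in sequentially. dist (\<Sum>i\<in>I. (real (k N i) / real (Suc N)) *\<^sub>R w i) y < 1 / real (Suc m)"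
      using lim by (rule tendstoD) simp
    then obtain N where N: "dist (\<Sum>i\<in>I. (real (k N i) / real (Suc N)) *\<^sub>R w i) y < 1 / real (Suc m)"
      by (auto simp: eventually_sequentially)
    show "\<exists>N. \<exists>k\<in>Pi\<^sub>E I (\<lambda>_. UNIV::nat set). norm (y - (\<Sum>i\<in>I. (real (k i) / real (Suc N)) *\<^sub>R w i)) < 1 / real (Suc m)"
      by (intro exI[of _ N] bexI[of _ "k N"]) (use N in \<open>auto simp: k_def dist_norm norm_minus_commute\<close>)
  qed
next
  assume R: ?R
  have "y \<in> closure (convex_cone hull (w ` I))"
    unfolding closure_approachable
  proof (intro allI impI)
    fix e :: real assume "e > 0"
    then obtain m where m: "1 / real (Suc m) < e" using nat_approx_posE by blast
    obtain N k where "norm (y - (\<Sum>i\<in>I. (real (k i) / real (Suc N)) *\<^sub>R w i)) < 1 / real (Suc m)"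
      using R by blast
    then show "\<exists>x\<in>convex_cone hull (w ` I). dist x y < e"
      using m by (intro bexI[of _ "\<Sum>i\<in>I. (real (k i) / real (Suc N)) *\<^sub>R w i"])
        (auto simp: convex_cone_hull_finite_image[OF I] dist_norm norm_minus_commute)
  qed
  then show "y \<in> convex_cone hull (w ` I)"
    using closed_convex_cone_hull[of "w ` I"] I by (simp add: closure_closed)
qed

lemma pred_convex_cone_hull:
  fixes w :: "'m \<Rightarrow> 'i \<Rightarrow> 'a::euclidean_space"
  assumes I: "finite I" and [measurable]: "\<And>i. i \<in> I \<Longrightarrow> (\<lambda>\<omega>. w \<omega> i) \<in> borel_measurable M" "f \<in> borel_measurable M"
  shows "Measurable.pred M (\<lambda>\<omega>. f \<omega> \<in> convex_cone hull (w \<omega> ` I))"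
proof -
  have "countable (Pi\<^sub>E I (\<lambda>_. UNIV::nat set))" using I by (intro countable_PiE) auto
  moreover have "Measurable.pred M (\<lambda>\<omega>. norm (f \<omega> - (\<Sum>i\<in>I. (real (k i) / real (Suc N)) *\<^sub>R w \<omega> i)) < 1 / real (Suc m))" for k N m
    by measurable
  ultimately show ?thesis
    unfolding mem_convex_cone_hull_approx[OF I]
    by (intro pred_intros_countable) (simp add: pred_def sets.sets_Collect_countable_Ex')
qed

lemma borel_measurable_measure_std_gaussian:
  fixes P :: "'m \<Rightarrow> 'a::euclidean_space \<Rightarrow> bool"
  assumes P: "Measurable.pred (M \<Otimes>\<^sub>M borel) (\<lambda>z. P (fst z) (snd z))"
  shows "(\<lambda>\<omega>. measure std_gaussian {x. P \<omega> x}) \<in> borel_measurable M"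
proof -
  interpret G: prob_space "std_gaussian :: 'a measure" by (rule prob_space_std_gaussian)
  let ?Q = "{z\<in>space (M \<Otimes>\<^sub>M std_gaussian). P (fst z) (snd z)}"
  have "sets (M \<Otimes>\<^sub>M (std_gaussian :: 'a measure)) = sets (M \<Otimes>\<^sub>M borel)"
    by (intro sets_pair_measure_cong) auto
  moreover have "{z\<in>space (M \<Otimes>\<^sub>M borel). P (fst z) (snd z)} \<in> sets (M \<Otimes>\<^sub>M borel)"
    using P by (simp add: pred_def)
  ultimately have "?Q \<in> sets (M \<Otimes>\<^sub>M std_gaussian)" by (simp add: space_pair_measure)
  then have "(\<lambda>\<omega>. emeasure std_gaussian (Pair \<omega> -` ?Q)) \<in> borel_measurable M"
    by (rule G.measurable_emeasure_Pair)
  then have "(\<lambda>\<omega>. measure std_gaussian (Pair \<omega> -` ?Q)) \<in> borel_measurable M"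
    unfolding measure_def by measurable
  also have "?this \<longleftrightarrow> ?thesis"
    by (intro measurable_cong arg_cong[where f="measure std_gaussian"]) (auto simp: space_pair_measure)
  finally show ?thesis .
qed

lemma pred_active_part:
  fixes w :: "'m \<Rightarrow> 'i \<Rightarrow> 'a::euclidean_space"
  assumes J: "finite J" "I \<subseteq> J" and [measurable]: "\<And>i. i \<in> J \<Longrightarrow> (\<lambda>\<omega>. w \<omega> i) \<in> borel_measurable M" "f \<in> borel_measurable M"
  shows "Measurable.pred M (\<lambda>\<omega>. f \<omega> \<in> active_part J (w \<omega>) I)"
proof -
  have fin: "finite I" "finite (J - I)" using J finite_subset by auto
  have "Measurable.pred M (\<lambda>\<omega>. inner (w \<omega> i) (f \<omega>) = 0)" "Measurable.pred M (\<lambda>\<omega>. inner (w \<omega> i) (f \<omega>) < 0)"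
    if [simp]: "i \<in> J" for i
    by measurable
  then show ?thesis
    unfolding active_part_def mem_Collect_eq
    using J by (intro pred_intros_logic pred_intros_finite fin) auto
qed

text \<open>Both projections are expressed by \<open>perp\<close>, which is jointly measurable in
  the parameter and the point; the two angles are then Gaussian measures of sections of measurable
  sets.\<close>

lemma borel_measurable_curv_term:
  fixes w :: "'m \<Rightarrow> 'i \<Rightarrow> 'a::euclidean_space"
  assumes J: "finite J" "I \<subseteq> J" and A[measurable]: "A \<in> sets borel"
    and w: "\<And>i. i \<in> J \<Longrightarrow> (\<lambda>\<omega>. w \<omega> i) \<in> borel_measurable M"
  shows "(\<lambda>\<omega>. curv_term k J (w \<omega>) A I) \<in> borel_measurable M"
proof -
  have fin: "finite I" using J finite_subset by auto
  have w': "(\<lambda>z. w (fst z) i) \<in> borel_measurable (M \<Otimes>\<^sub>M borel)" if "i \<in> J" for i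
    using measurable_compose[OF measurable_fst w[OF that]] .
  have [measurable]: "(\<lambda>\<omega>. dim (w \<omega> ` I)) \<in> M \<rightarrow>\<^sub>M count_space UNIV"
    using J w by (intro measurable_dim_image fin) auto
  have p[measurable]: "(\<lambda>z. perp (w (fst z) ` I) (snd z)) \<in> borel_measurable (M \<Otimes>\<^sub>M borel)"
    using J w' by (intro borel_measurable_perp fin) auto
  have [measurable]: "Measurable.pred (M \<Otimes>\<^sub>M borel) (\<lambda>z. perp (w (fst z) ` I) (snd z) \<in> active_part J (w (fst z)) I)"
    by (intro pred_active_part J w' p)
  have [measurable]: "(\<lambda>\<omega>. gauss_on (orthogonal_comp (w \<omega> ` I)) (active_part J (w \<omega>) I \<inter> A)) \<in> borel_measurable M"
    unfolding gauss_on_eq_proj[OF subspace_orthogonal_comp]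
    by (intro borel_measurable_measure_std_gaussian) (simp only: Int_iff, measurable)
  have [measurable]: "(\<lambda>\<omega>. gauss_on (span (w \<omega> ` I)) (convex_cone hull (w \<omega> ` I))) \<in> borel_measurable M"
    unfolding gauss_on_eq_proj[OF subspace_span] proj_span
    by (intro borel_measurable_measure_std_gaussian pred_convex_cone_hull fin) (use J w' in auto)
  show ?thesis unfolding curv_term_def by measurable
qed

lemma borel_measurable_curv_measure_cone_of:
  fixes w :: "'m \<Rightarrow> 'i \<Rightarrow> 'a::euclidean_space"
  assumes "finite J" "A \<in> sets borel" "\<And>i. i \<in> J \<Longrightarrow> (\<lambda>\<omega>. w \<omega> i) \<in> borel_measurable M"
  shows "(\<lambda>\<omega>. curv_measure k (cone_of J (w \<omega>)) A) \<in> borel_measurable M"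
  using assms by (auto simp: curv_measure_cone_of intro!: borel_measurable_sum borel_measurable_curv_term)

subsection \<open>Intersection with one random halfspace\<close>

lemma gauss_on_nonneg: "gauss_on L B \<ge> 0"
  by (simp add: gauss_on_def)

lemma curv_term_nonneg: "curv_term k J w A I \<ge> 0"
  by (simp add: curv_term_def gauss_on_nonneg)

lemma curv_measure_nonneg: "curv_measure k C A \<ge> 0"
  by (simp add: curv_measure_def gauss_on_nonneg sum_nonneg)

interpretation gauss: prob_space "std_gaussian :: 'a::euclidean_space measure"
  by (rule prob_space_std_gaussian)

interpretation gauss_pair: pair_sigma_finite "std_gaussian :: 'a::euclidean_space measure" "std_gaussian :: 'b::euclidean_space measure"
  by standard

text \<open>The normal angle is unchanged and the active part is cut by the random halfspace
  \<open>inner u x < 0\<close>. By Fubini the projected point may be fixed first; if nonzero, it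
  lies in the halfspace for half of all \<open>u\<close>. It is almost surely nonzero since
  \<open>1 \<le> k\<close> makes the hull of the face nontrivial.\<close>

lemma nn_integral_curv_term_inactive:
  fixes w :: "'i \<Rightarrow> 'a::euclidean_space"
  assumes J: "finite J" "I \<subseteq> J" "i \<notin> J" and k: "1 \<le> k" and A[measurable]: "A \<in> sets borel"
  shows "(\<integral>\<^sup>+u. ennreal (curv_term k (insert i J) (w(i := u)) A I) \<partial>std_gaussian) = ennreal (curv_term k J w A I / 2)"
proof (cases "dim (w ` I) + k = DIM('a)")
  case dim: True
  let ?G = "std_gaussian :: 'a measure"
  let ?V = "w ` I" and ?R = "active_part J w I \<inter> A"
  let ?P = "perp ?V"
  note L = subspace_orthogonal_comp[of ?V]
  note [measurable] = borel_measurable_proj[OF L]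
  define c where "c = gauss_on (span ?V) (convex_cone hull ?V)"
  have im: "(w(i := u)) ` I = ?V" for u using J by (auto simp: image_iff)
  have [measurable]: "?R \<in> sets borel" using borel_active_part[OF J(1)] by measurable
  have part: "active_part (insert i J) (w(i := u)) I \<inter> A = ?R \<inter> {x. inner u x < 0}" for u
    using J by (auto simp: active_part_def)
  have LD: "orthogonal_comp ?V \<noteq> {0}"
  proof
    assume "orthogonal_comp ?V = {0}"
    then have "dim (orthogonal_comp ?V) = 0" by simp
    with dim_orthogonal_comp[of ?V] dim k show False by linarith
  qed
  have ae: "AE x in ?G. ?P x \<noteq> 0" by (rule AE_std_gaussian_proj_nonzero[OF L LD])
  have half: "emeasure ?G {u. inner u y < 0} = 1 / 2" if "y \<noteq> 0" for y
    using emeasure_std_gaussian_halfspace(1)[OF that] by (simp add: inner_commute)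
  have "(\<integral>\<^sup>+u. ennreal (curv_term k (insert i J) (w(i := u)) A I) \<partial>?G)
     = (\<integral>\<^sup>+u. ennreal c * emeasure ?G {x. ?P x \<in> ?R \<inter> {x. inner u x < 0}} \<partial>?G)"
  proof (rule nn_integral_cong)
    fix u
    have "curv_term k (insert i J) (w(i := u)) A I =
        c * gauss_on (orthogonal_comp ?V) (?R \<inter> {x. inner u x < 0})"
      unfolding curv_term_def im part c_def if_P[OF dim] by (rule mult.commute)
    then show "ennreal (curv_term k (insert i J) (w(i := u)) A I) =
        ennreal c * emeasure ?G {x. ?P x \<in> ?R \<inter> {x. inner u x < 0}}"
      by (simp only: ennreal_mult gauss_on_nonneg c_def emeasure_gauss_on[OF L])
  qed
  also have "\<dots> = (\<integral>\<^sup>+u. ennreal c * (\<integral>\<^sup>+x. indicator ?R (?P x) * indicator {x. inner u x < 0} (?P x) \<partial>?G) \<partial>?G)"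
  proof (intro nn_integral_cong arg_cong[where f="(*) (ennreal c)"])
    fix u
    have "emeasure ?G {x. ?P x \<in> ?R \<inter> {x. inner u x < 0}} = (\<integral>\<^sup>+x. indicator {x. ?P x \<in> ?R \<inter> {x. inner u x < 0}} x \<partial>?G)"
      by (rule nn_integral_indicator[symmetric]) measurable
    then show "emeasure ?G {x. ?P x \<in> ?R \<inter> {x. inner u x < 0}} =
       (\<integral>\<^sup>+x. indicator ?R (?P x) * indicator {x. inner u x < 0} (?P x) \<partial>?G)"
      by (simp add: indicator_def if_distrib cong: if_cong) (auto intro!: nn_integral_cong)
  qed
  also have "\<dots> = ennreal c * (\<integral>\<^sup>+u. \<integral>\<^sup>+x. indicator ?R (?P x) * indicator {x. inner u x < 0} (?P x) \<partial>?G \<partial>?G)"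
    by (rule nn_integral_cmult) measurable
  also have "(\<integral>\<^sup>+u. \<integral>\<^sup>+x. indicator ?R (?P x) * indicator {x. inner u x < 0} (?P x) \<partial>?G \<partial>?G)
    = (\<integral>\<^sup>+x. \<integral>\<^sup>+u. indicator ?R (?P x) * indicator {x. inner u x < 0} (?P x) \<partial>?G \<partial>?G)"
    by (rule gauss_pair.Fubini'[symmetric]) measurable
  also have "\<dots> = (\<integral>\<^sup>+x. (1 / 2) * indicator {x. ?P x \<in> ?R} x \<partial>?G)"
  proof (intro nn_integral_cong_AE, use ae in eventually_elim)
    case (elim x)
    have "(\<integral>\<^sup>+u. indicator ?R (?P x) * indicator {x. inner u x < 0} (?P x) \<partial>?G) =
        indicator ?R (?P x) * (\<integral>\<^sup>+u. indicator {u. inner u (?P x) < 0} u \<partial>?G)"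
      by (subst nn_integral_cmult[symmetric]) (auto simp: indicator_def)
    also have "\<dots> = indicator ?R (?P x) * (1 / 2)"
      using half[OF elim] by (subst nn_integral_indicator) auto
    finally show ?case by (simp add: indicator_def)
  qed
  also have "\<dots> = (1 / 2) * emeasure ?G {x. ?P x \<in> ?R}"
    by (rule nn_integral_cmult_indicator) measurable
  also have "\<dots> = ennreal (gauss_on (orthogonal_comp ?V) ?R / 2)"
    by (simp add: emeasure_gauss_on[OF L] divide_ennreal[symmetric] gauss_on_nonneg del: Int_iff)
      (subst mult.commute, simp add: ennreal_times_divide)
  also have "ennreal c * \<dots> = ennreal (curv_term k J w A I / 2)"
    unfolding curv_term_def if_P[OF dim] c_def
    by (simp add: ennreal_mult[symmetric] gauss_on_nonneg mult.commute)
  finally show ?thesis .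
next
  case False
  moreover have "(w(i := u)) ` I = w ` I" for u using J by (auto simp: image_iff)
  ultimately show ?thesis by (simp add: curv_term_def)
qed

section \<open>Angles of the new faces on which the random constraint is active\<close>

lemma convex_cone_hull_insert:
  fixes u :: "'a::euclidean_space"
  shows "convex_cone hull (insert u V) = {n + t *\<^sub>R u | n t. n \<in> convex_cone hull V \<and> 0 \<le> t}"
proof -
  have "convex_cone hull {u} = {t *\<^sub>R u | t. 0 \<le> t}"
    using convex_cone_hull_finite_image[of "{u}" "\<lambda>x. x"] by auto
  then show ?thesis
    using convex_cone_hull_Un[of V "{u}"] by auto
qed

lemma convex_cone_hull_subset_span: "convex_cone hull V \<subseteq> span V"
  by (intro hull_minimal span_superset convex_cone_span)

text \<open>The projection of \<open>x\<close> to the enlarged span is its part in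
  \<open>span V\<close> plus a multiple of \<open>perp V u\<close>. This multiple must be the
  coefficient of \<open>u\<close> in the cone, which leaves a sign condition and membership of the
  remainder in the old cone.\<close>

lemma mem_convex_cone_hull_insert_perp:
  fixes u :: "'a::euclidean_space"
  assumes u: "u \<notin> span V"
  shows "x - perp (insert u V) x \<in> convex_cone hull (insert u V) \<longleftrightarrow>
    0 \<le> inner (perp V u) (perp V x) \<and>
    (x - perp V x) - (inner (perp V x) (perp V u) / inner (perp V u) (perp V u)) *\<^sub>R (u - perp V u) \<in> convex_cone hull V"
proof -
  let ?P = "perp V" and ?a = "perp V u"
  let ?c = "inner (?P x) ?a / inner ?a ?a"
  note L = subspace_orthogonal_comp[of V]
  note lin = linear_proj[OF L]
  have a: "?a \<noteq> 0" using u by (simp add: perp_eq_0_iff)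
  have c: "0 \<le> ?c \<longleftrightarrow> 0 \<le> inner ?a (?P x)"
  proof -
    have "0 < inner ?a ?a" using a by simp
    from pos_le_divide_eq[OF this, of 0 "inner (?P x) ?a"] show ?thesis
      by (simp only: mult_zero_left inner_commute[of "?P x" ?a])
  qed
  have eq: "x - perp (insert u V) x = (x - ?P x) + ?c *\<^sub>R ?a"
    by (simp add: perp_insert)
  have PP: "?P (?P y) = ?P y" for y by (intro proj_id L proj_mem)
  show ?thesis
  proof
    assume "x - perp (insert u V) x \<in> convex_cone hull (insert u V)"
    then obtain n t where nt: "x - ?P x + ?c *\<^sub>R ?a = n + t *\<^sub>R u" "n \<in> convex_cone hull V" "0 \<le> t"
      unfolding eq convex_cone_hull_insert by blast
    \<comment> \<open>Elements of the old cone have no component orthogonal to \<open>V\<close>, so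
      projecting the decomposition forces \<open>t = ?c\<close>.\<close>
    have "?P n = 0" using nt(2) convex_cone_hull_subset_span[of V] by (auto simp: perp_eq_0_iff)
    then have "?c *\<^sub>R ?a = t *\<^sub>R ?a"
      using arg_cong[OF nt(1), of ?P]
      by (simp add: linear_add[OF lin] linear_diff[OF lin] linear_scale[OF lin] PP)
    then have ct: "?c = t" using a by simp
    then have "0 \<le> ?c" using nt(3) by simp
    moreover have "(x - ?P x) - ?c *\<^sub>R (u - ?a) = n"
      using nt(1) unfolding ct by (simp add: algebra_simps)
    ultimately show "0 \<le> inner ?a (?P x) \<and> (x - ?P x) - ?c *\<^sub>R (u - ?a) \<in> convex_cone hull V"
      using nt(2) c by simp
  next
    assume h: "0 \<le> inner ?a (?P x) \<and> (x - ?P x) - ?c *\<^sub>R (u - ?a) \<in> convex_cone hull V"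
    have "x - perp (insert u V) x = ((x - ?P x) - ?c *\<^sub>R (u - ?a)) + ?c *\<^sub>R u"
      unfolding eq by (simp add: algebra_simps)
    with h c show "x - perp (insert u V) x \<in> convex_cone hull (insert u V)"
      unfolding convex_cone_hull_insert by blast
  qed
qed

text \<open>The component of \<open>q\<close> orthogonal to \<open>a\<close>. For independent
  Gaussian vectors projected to \<open>L\<close> it produces a random vector in the section of
  \<open>L\<close> by the random hyperplane.\<close>

definition reject :: "'a::euclidean_space \<Rightarrow> 'a \<Rightarrow> 'a" where
  "reject a q = q - (inner q a / inner a a) *\<^sub>R a"

lemma perp_insert_reject: "perp (insert u V) x = reject (perp V u) (perp V x)"
  by (simp add: perp_insert reject_def)

lemma borel_measurable_reject [measurable (raw)]:
  assumes "f \<in> borel_measurable M" "g \<in> borel_measurable M"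
  shows "(\<lambda>x. reject (f x) (g x)) \<in> borel_measurable M"
  using assms unfolding reject_def by measurable

text \<open>Isometries preserving \<open>L\<close> commute with \<open>proj L\<close> and
  \<open>reject\<close>, and acting on both vectors they preserve the law of the pair. The result is
  nonzero unless the second projection lies on the line of the first, a null event when
  \<open>L\<close> has dimension at least 2.\<close>

lemma rotation_invariant_reject:
  fixes L :: "'a::euclidean_space set"
  assumes L: "subspace L" and dim: "dim L \<ge> 2"
  shows "rotation_invariant_on L (distr (std_gaussian \<Otimes>\<^sub>M std_gaussian) borel (\<lambda>z. reject (proj L (fst z)) (proj L (snd z))))"
    (is "rotation_invariant_on L (distr ?GG borel ?Z)")
proof -
  note [measurable] = borel_measurable_proj[OF L]
  have Zm[measurable]: "?Z \<in> borel_measurable ?GG" by measurable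
  interpret GG: prob_space ?GG by (intro prob_space_pair) unfold_locales
  have "prob_space (distr ?GG borel ?Z)" by (intro GG.prob_space_distr Zm)
  moreover have "AE x in distr ?GG borel ?Z. x \<in> L \<and> x \<noteq> 0"
  proof (subst AE_distr_iff)
    show "{x \<in> space borel. x \<in> L \<and> x \<noteq> 0} \<in> sets borel"
    proof -
      have "{x \<in> space borel. x \<in> L \<and> x \<noteq> 0} = L - {0}" by auto
      then show ?thesis using borel_closed[OF closed_subspace[OF L]] by simp
    qed
    have ZL: "reject (proj L u) (proj L x) \<in> L" for u x
      unfolding reject_def by (intro subspace_diff subspace_scale L proj_mem)
    have "AE x in std_gaussian. AE y in std_gaussian. reject (proj L x) (proj L y) \<noteq> (0::'a)"
    proof (rule AE_I2)
      fix u :: 'a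
      let ?S = "proj L -` span {proj L u}"
      have "subspace ?S" by (intro linear_subspace_vimage linear_proj L subspace_span)
      moreover have "?S \<noteq> UNIV"
      proof
        assume "?S = UNIV"
        then have "L \<subseteq> span {proj L u}" using proj_id[OF L] by (metis UNIV_I subsetI vimageE)
        then have "dim L \<le> dim {proj L u}" by (metis dim_span dim_subset)
        also have "dim {proj L u} \<le> card {proj L u}" by (rule dim_le_card') simp
        finally show False using dim by simp
      qed
      ultimately have "AE y in std_gaussian. y \<notin> ?S" by (rule AE_std_gaussian_subspace)
      then show "AE y in std_gaussian. reject (proj L u) (proj L y) \<noteq> 0"
      proof eventually_elim
        case (elim y)
        show ?case
        proof
          assume "reject (proj L u) (proj L y) = 0"
          then have "proj L y = (inner (proj L y) (proj L u) / inner (proj L u) (proj L u)) *\<^sub>R proj L u"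
            by (simp add: reject_def)
          then have "proj L y \<in> span {proj L u}" by (metis span_base span_scale singletonI)
          with elim show False by simp
        qed
      qed
    qed
    then have "AE z in ?GG. reject (proj L (fst z)) (proj L (snd z)) \<noteq> (0::'a)"
      by (intro gauss_pair.AE_pair_measure[rotated]) (simp, measurable)
    then show "AE z in ?GG. ?Z z \<in> L \<and> ?Z z \<noteq> 0" using ZL by auto
  qed measurable
  moreover have "distr (distr ?GG borel ?Z) borel T = distr ?GG borel ?Z"
    if T: "orthogonal_transformation T" and TL: "\<forall>x\<in>L. T x \<in> L" for T :: "'a \<Rightarrow> 'a"
  proof -
    note [measurable] = measurable_orthogonal_transformation[OF T]
    have lin: "linear T" using T by (rule orthogonal_transformation_linear)
    let ?TT = "\<lambda>z::'a \<times> 'a. (T (fst z), T (snd z))"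
    have TT: "orthogonal_transformation ?TT"
      unfolding orthogonal_transformation
    proof (intro conjI allI)
      show "linear ?TT" by (rule linearI) (auto simp: linear_add[OF lin] linear_scale[OF lin])
      show "norm (?TT v) = norm v" for v
        by (simp add: norm_prod_def orthogonal_transformation_norm[OF T])
    qed
    have "T (?Z z) = ?Z (?TT z)" for z
      using T TL by (simp add: reject_def proj_orthogonal_transformation[OF L T] linear_diff[OF lin]
          linear_scale[OF lin] orthogonal_transformation_def)
    then have "T \<circ> ?Z = ?Z \<circ> ?TT" by (simp add: fun_eq_iff)
    have "distr (distr ?GG borel ?Z) borel T = distr ?GG borel (?Z \<circ> ?TT)"
      by (subst distr_distr) (auto simp: \<open>T \<circ> ?Z = ?Z \<circ> ?TT\<close>)
    also have "\<dots> = distr (distr ?GG borel ?TT) borel ?Z"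
      by (subst distr_distr) (auto simp: borel_prod[symmetric])
    also have "distr ?GG borel ?TT = ?GG"
      unfolding std_gaussian_pair by (rule distr_std_gaussian_orthogonal[OF TT])
    finally show ?thesis .
  qed
  ultimately show ?thesis by (simp add: rotation_invariant_on_def)
qed

text \<open>The rejected vector and the projected Gaussian vector both have rotation invariant laws
  on \<open>L\<close>, so they give conic sets the same mass: the mean angle of a random hyperplane
  section is the angle itself.\<close>

lemma nn_integral_reject_conic:
  fixes L :: "'a::euclidean_space set"
  assumes L: "subspace L" and dim: "dim L \<ge> 2" and B[measurable]: "B \<in> sets borel" and con: "conic_set B"
  shows "(\<integral>\<^sup>+u. \<integral>\<^sup>+x. indicator B (reject (proj L u) (proj L x)) \<partial>std_gaussian \<partial>std_gaussian) = ennreal (gauss_on L B)"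
proof -
  note [measurable] = borel_measurable_proj[OF L]
  let ?GG = "(std_gaussian :: 'a measure) \<Otimes>\<^sub>M (std_gaussian :: 'a measure)"
  let ?Z = "\<lambda>z::'a \<times> 'a. reject (proj L (fst z)) (proj L (snd z))"
  have [measurable]: "?Z \<in> borel_measurable ?GG" by measurable
  have "(\<integral>\<^sup>+u. \<integral>\<^sup>+x. indicator B (reject (proj L u) (proj L x)) \<partial>std_gaussian \<partial>std_gaussian) = (\<integral>\<^sup>+z. indicator B (?Z z) \<partial>?GG)"
    by (subst gauss.nn_integral_fst[symmetric]) auto
  also have "\<dots> = emeasure (distr ?GG borel ?Z) B"
    by (subst nn_integral_indicator[symmetric], simp, subst nn_integral_distr) auto
  also have "\<dots> = emeasure (distr std_gaussian borel (proj L)) B"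
  proof (rule rotation_invariant_conic_eq(2)[OF L rotation_invariant_reject[OF L dim] rotation_invariant_proj_gaussian[OF L] _ B con])
    show "L \<noteq> {0}" using dim by auto
  qed (use emeasure_proj_gaussian_cap_pos[OF L] in auto)
  also have "\<dots> = emeasure std_gaussian (proj L -` B)"
    by (subst emeasure_distr) auto
  also have "\<dots> = ennreal (gauss_on L B)"
    by (simp add: emeasure_gauss_on[OF L, symmetric] vimage_def)
  finally show ?thesis .
qed

text \<open>Here \<open>a\<close> is the fixed component of the new normal orthogonal to
  \<open>V\<close>. The sign condition concerns the component of \<open>y\<close> orthogonal to
  \<open>V\<close> and has probability 1/2; the independent remainder minus a multiple of
  \<open>v\<close> meets the cone with the probability given by its angle, whatever the
  multiple.\<close>

lemma nn_integral_normal_factor: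
  fixes V :: "'a::euclidean_space set"
  assumes V: "finite V" and a: "a \<noteq> 0" "a \<in> orthogonal_comp V"
  shows "(\<integral>\<^sup>+v. \<integral>\<^sup>+y. indicator {y. 0 \<le> inner a (perp V y) \<and>
        (y - perp V y) - (inner (perp V y) a / inner a a) *\<^sub>R (v - perp V v) \<in> convex_cone hull V} y
        \<partial>std_gaussian \<partial>std_gaussian) = ennreal (gauss_on (span V) (convex_cone hull V) / 2)"
proof -
  let ?G = "std_gaussian :: 'a measure" and ?P = "perp V"
  note L = subspace_orthogonal_comp[of V]
  note [measurable] = borel_measurable_proj[OF L]
  have [measurable]: "convex_cone hull V \<in> sets borel"
    using borel_closed[OF closed_convex_cone_hull[OF V]] .
  \<comment> \<open>The cylinder over the normal cone, so that Gaussian vectors of the whole space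
    can replace those of \<open>span V\<close>.\<close>
  define D where "D = {z. z - ?P z \<in> convex_cone hull V}"
  have D[measurable]: "D \<in> sets borel" unfolding D_def by measurable
  have conD: "conic_set D"
    unfolding conic_set_def D_def
  proof (intro ballI allI impI CollectI)
    fix x :: 'a and t :: real assume x: "x \<in> {z. z - ?P z \<in> convex_cone hull V}" and t: "t > 0"
    have "t *\<^sub>R x - ?P (t *\<^sub>R x) = t *\<^sub>R (x - ?P x)"
      by (simp add: linear_scale[OF linear_proj[OF L]] scaleR_diff_right)
    then show "t *\<^sub>R x - ?P (t *\<^sub>R x) \<in> convex_cone hull V"
      using x t by (auto intro: convex_cone_hull_mul)
  qed
  have GD: "emeasure ?G D = ennreal (gauss_on (span V) (convex_cone hull V))"
    unfolding D_def emeasure_gauss_on[OF subspace_span, symmetric] proj_span ..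
  let ?c = "\<lambda>y. inner (?P y) a / inner a a"
  let ?h = "\<lambda>v y z. indicator {y. 0 \<le> inner a y} (?P y) * indicator D (z - ?c y *\<^sub>R v) :: ennreal"
  have eq: "indicator {y. 0 \<le> inner a (?P y) \<and> (y - ?P y) - ?c y *\<^sub>R (v - ?P v) \<in> convex_cone hull V} y =
     indicator {y. 0 \<le> inner a y} (?P y) * (indicator (convex_cone hull V) ((y - ?P y) - ?c (?P y) *\<^sub>R (v - ?P v)) :: ennreal)" for y v
    by (simp add: indicator_def proj_id[OF L proj_mem[OF L]])
  have "(\<integral>\<^sup>+y. indicator {y. 0 \<le> inner a (?P y) \<and> (y - ?P y) - ?c y *\<^sub>R (v - ?P v) \<in> convex_cone hull V} y \<partial>?G)
     = (\<integral>\<^sup>+y. \<integral>\<^sup>+z. ?h v y z \<partial>?G \<partial>?G)" for v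
  proof -
    have "(\<integral>\<^sup>+y. indicator {y. 0 \<le> inner a (?P y) \<and> (y - ?P y) - ?c y *\<^sub>R (v - ?P v) \<in> convex_cone hull V} y \<partial>?G)
       = (\<integral>\<^sup>+y. \<integral>\<^sup>+z. indicator {y. 0 \<le> inner a y} (?P y) *
          (indicator (convex_cone hull V) ((z - ?P z) - ?c (?P y) *\<^sub>R (v - ?P v))) \<partial>?G \<partial>?G)"
      unfolding eq
      using nn_integral_gaussian_proj_indep[OF L, of "\<lambda>(y, z). indicator {y. 0 \<le> inner a y} y *
          (indicator (convex_cone hull V) (z - ?c y *\<^sub>R (v - ?P v)))"]
      by simp
    also have "\<dots> = (\<integral>\<^sup>+y. \<integral>\<^sup>+z. ?h v y z \<partial>?G \<partial>?G)"
      by (intro nn_integral_cong arg_cong2[where f="(*)"] refl)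
         (simp add: indicator_def D_def proj_id[OF L proj_mem[OF L]] linear_diff[OF linear_proj[OF L]]
           linear_scale[OF linear_proj[OF L]] algebra_simps)
    finally show ?thesis .
  qed
  then have "(\<integral>\<^sup>+v. \<integral>\<^sup>+y. indicator {y. 0 \<le> inner a (?P y) \<and>
        (y - ?P y) - ?c y *\<^sub>R (v - ?P v) \<in> convex_cone hull V} y \<partial>?G \<partial>?G)
      = (\<integral>\<^sup>+v. \<integral>\<^sup>+y. \<integral>\<^sup>+z. ?h v y z \<partial>?G \<partial>?G \<partial>?G)" by simp
  \<comment> \<open>With \<open>y\<close> outermost the coefficient \<open>?c y\<close> is constant
    in the inner double integral, as \<open>gaussian_difference_conic\<close> requires.\<close>
  also have "\<dots> = (\<integral>\<^sup>+y. \<integral>\<^sup>+v. \<integral>\<^sup>+z. ?h v y z \<partial>?G \<partial>?G \<partial>?G)"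
    by (rule gauss_pair.Fubini'[symmetric]) measurable
  also have "\<dots> = (\<integral>\<^sup>+y. indicator {y. 0 \<le> inner a y} (?P y) * (\<integral>\<^sup>+v. \<integral>\<^sup>+z. indicator D (z - ?c y *\<^sub>R v) \<partial>?G \<partial>?G) \<partial>?G)"
    by (simp add: nn_integral_cmult)
  also have "\<dots> = (\<integral>\<^sup>+y. emeasure ?G D * indicator {y. 0 \<le> inner a y} y \<partial>?G)"
  proof (rule nn_integral_cong)
    fix y
    have "indicator {y. 0 \<le> inner a y} (?P y) = (indicator {y. 0 \<le> inner a y} y :: ennreal)"
      using inner_proj_right[OF L a(2), of y] by (simp add: indicator_def)
    then show "indicator {y. 0 \<le> inner a y} (?P y) * (\<integral>\<^sup>+v. \<integral>\<^sup>+z. indicator D (z - ?c y *\<^sub>R v) \<partial>?G \<partial>?G)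
        = emeasure ?G D * indicator {y. 0 \<le> inner a y} y"
      by (simp only: gaussian_difference_conic[OF D conD] mult.commute)
  qed
  also have "\<dots> = emeasure ?G D * (1 / 2)"
    using emeasure_std_gaussian_halfspace(2)[OF a(1)] by (simp add: nn_integral_cmult_indicator)
  also have "\<dots> = ennreal (gauss_on (span V) (convex_cone hull V) / 2)"
    by (simp add: GD divide_ennreal[symmetric] gauss_on_nonneg ennreal_times_divide)
  finally show ?thesis .
qed

lemma conic_active_part: "conic_set (active_part J w I)"
  by (auto simp: conic_set_def active_part_def mult_pos_neg)

text \<open>The new face angle depends only on the component of \<open>u\<close> orthogonal to
  \<open>?V\<close>, the new normal angle on both components. Since these are independent,
  integrating first over the component in the span gives half the old normal angle, a constant; the
  remaining integral is the mean angle of a section.\<close>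

lemma nn_integral_curv_term_active:
  fixes w :: "'i \<Rightarrow> 'a::euclidean_space"
  assumes J: "finite J" "I \<subseteq> J" "i \<notin> J" and k: "1 \<le> k"
    and A[measurable]: "A \<in> sets borel" and conA: "conic_set A"
  shows "(\<integral>\<^sup>+u. ennreal (curv_term k (insert i J) (w(i := u)) A (insert i I)) \<partial>std_gaussian)
     = ennreal (curv_term (k + 1) J w A I / 2)"
proof -
  let ?G = "std_gaussian :: 'a measure"
  let ?V = "w ` I"
  let ?P = "perp ?V"
  have fin: "finite ?V" using J finite_subset by auto
  have im: "(w(i := u)) ` insert i I = insert u ?V" for u using J by (auto simp: image_iff)
  show ?thesis
  proof (cases "dim ?V < DIM('a)")
    case False
    \<comment> \<open>The normals already span the space, so with \<open>k \<ge> 1\<close> neither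
      dimension condition can hold and both sides are 0.\<close>
    have "dim (insert u ?V) + k \<noteq> DIM('a)" for u
    proof -
      have "dim ?V \<le> dim (insert u ?V)" by (rule dim_subset) auto
      then show ?thesis using False k by linarith
    qed
    moreover have "dim ?V + (k + 1) \<noteq> DIM('a)" using False k by auto
    ultimately show ?thesis by (simp add: curv_term_def im del: fun_upd_apply image_insert)
  next
    case True
    then have "span ?V \<noteq> UNIV" by (metis dim_UNIV dim_span less_irrefl)
    then have ae: "AE u in ?G. u \<notin> span ?V" by (intro AE_std_gaussian_subspace subspace_span)
    show ?thesis
    proof (cases "dim ?V + (k + 1) = DIM('a)")
      case False
      \<comment> \<open>Almost surely \<open>u\<close> raises the dimension by one, so the dimension
        condition fails on the left as it does on the right.\<close>
      have "(\<integral>\<^sup>+u. ennreal (curv_term k (insert i J) (w(i := u)) A (insert i I)) \<partial>?G) = (\<integral>\<^sup>+u. 0 \<partial>?G)"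
        by (intro nn_integral_cong_AE, use ae in eventually_elim)
           (use False in \<open>simp add: curv_term_def im dim_insert del: fun_upd_apply image_insert\<close>)
      with False show ?thesis by (simp add: curv_term_def)
    next
      case dim: True
      note L = subspace_orthogonal_comp[of ?V]
      note [measurable] = borel_measurable_proj[OF L]
      have [measurable]: "convex_cone hull ?V \<in> sets borel"
        using borel_closed[OF closed_convex_cone_hull[OF fin]] .
      have dL: "dim (orthogonal_comp ?V) \<ge> 2" using dim_orthogonal_comp[of ?V] dim k by linarith
      define B where "B = active_part J w I \<inter> A"
      have B[measurable]: "B \<in> sets borel" unfolding B_def using borel_active_part[OF J(1)] by measurable
      have conB: "conic_set B"
        unfolding B_def using conic_active_part[of J w I] conA by (auto simp: conic_set_def)
      have part: "active_part (insert i J) (w(i := u)) (insert i I) = active_part J w I \<inter> {x. inner u x = 0}" for u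
        using J by (auto simp: active_part_def)
      \<comment> \<open>For \<open>u\<close> outside the span, \<open>F\<close> is the angle of the
        new face and \<open>H\<close> that of its normal cone, in terms of the components
        \<open>a\<close> orthogonal to \<open>?V\<close> and \<open>b\<close> in its span.\<close>
      define F where "F a = (\<integral>\<^sup>+x. indicator B (reject a (?P x)) \<partial>?G)" for a
      define H where "H a b = (\<integral>\<^sup>+y. indicator {y. 0 \<le> inner a (?P y) \<and>
         (y - ?P y) - (inner (?P y) a / inner a a) *\<^sub>R b \<in> convex_cone hull ?V} y \<partial>?G)" for a b
      have [measurable]: "F \<in> borel_measurable borel" unfolding F_def by measurable
      have [measurable]: "(\<lambda>(a, b). H a b) \<in> borel_measurable (borel \<Otimes>\<^sub>M borel)" unfolding H_def by measurable
      have term_eq: "ennreal (curv_term k (insert i J) (w(i := u)) A (insert i I)) = F (?P u) * H (?P u) (u - ?P u)"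
        if u: "u \<notin> span ?V" for u
      proof -
        let ?Q = "perp (insert u ?V)"
        note LQ = subspace_orthogonal_comp[of "insert u ?V"]
        have du: "dim (insert u ?V) + k = DIM('a)" using u dim by (simp add: dim_insert)
        have Qu: "inner u (?Q x) = 0" for x
          using proj_mem[OF LQ, of x] by (simp add: mem_orthogonal_comp)
        have "ennreal (gauss_on (orthogonal_comp (insert u ?V)) (active_part (insert i J) (w(i := u)) (insert i I) \<inter> A))
            = emeasure ?G {x. ?Q x \<in> B}"
          unfolding emeasure_gauss_on[OF LQ, symmetric] part B_def using Qu by simp
        also have "\<dots> = F (?P u)"
        proof -
          have "emeasure ?G {x. reject (?P u) (?P x) \<in> B} = (\<integral>\<^sup>+x. indicator {x. reject (?P u) (?P x) \<in> B} x \<partial>?G)"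
            by (rule nn_integral_indicator[symmetric]) measurable
          then show ?thesis unfolding F_def perp_insert_reject by (simp add: indicator_def)
        qed
        finally have 1: "ennreal (gauss_on (orthogonal_comp (insert u ?V)) (active_part (insert i J) (w(i := u)) (insert i I) \<inter> A)) = F (?P u)" .
        have "ennreal (gauss_on (span (insert u ?V)) (convex_cone hull (insert u ?V)))
            = emeasure ?G {y. y - ?Q y \<in> convex_cone hull (insert u ?V)}"
          unfolding emeasure_gauss_on[OF subspace_span, symmetric] proj_span ..
        also have "\<dots> = H (?P u) (u - ?P u)"
          unfolding mem_convex_cone_hull_insert_perp[OF u] H_def
          by (rule nn_integral_indicator[symmetric]) measurable
        finally show ?thesis
          unfolding curv_term_def im if_P[OF du] by (simp only: 1 ennreal_mult gauss_on_nonneg)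
      qed
      have "(\<integral>\<^sup>+u. ennreal (curv_term k (insert i J) (w(i := u)) A (insert i I)) \<partial>?G)
          = (\<integral>\<^sup>+u. F (?P u) * H (?P u) (u - ?P u) \<partial>?G)"
        by (intro nn_integral_cong_AE, use ae in eventually_elim) (rule term_eq)
      also have "\<dots> = (\<integral>\<^sup>+u. \<integral>\<^sup>+v. F (?P u) * H (?P u) (v - ?P v) \<partial>?G \<partial>?G)"
        using nn_integral_gaussian_proj_indep[OF L, of "\<lambda>(a, b). F a * H a b"] by simp
      also have "\<dots> = (\<integral>\<^sup>+u. F (?P u) * (\<integral>\<^sup>+v. H (?P u) (v - ?P v) \<partial>?G) \<partial>?G)"
        by (intro nn_integral_cong nn_integral_cmult) measurable
      also have "\<dots> = (\<integral>\<^sup>+u. F (?P u) * ennreal (gauss_on (span ?V) (convex_cone hull ?V) / 2) \<partial>?G)"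
      proof (intro nn_integral_cong_AE, use ae in eventually_elim)
        case (elim u)
        then have "?P u \<noteq> 0" by (simp add: perp_eq_0_iff)
        from nn_integral_normal_factor[OF fin this proj_mem[OF L]]
        show ?case by (simp only: H_def)
      qed
      also have "\<dots> = (\<integral>\<^sup>+u. F (?P u) \<partial>?G) * ennreal (gauss_on (span ?V) (convex_cone hull ?V) / 2)"
        by (rule nn_integral_multc) measurable
      also have "(\<integral>\<^sup>+u. F (?P u) \<partial>?G) = ennreal (gauss_on (orthogonal_comp ?V) B)"
        unfolding F_def by (rule nn_integral_reject_conic[OF L dL B conB])
      also have "\<dots> * ennreal (gauss_on (span ?V) (convex_cone hull ?V) / 2) = ennreal (curv_term (k + 1) J w A I / 2)"
        unfolding curv_term_def if_P[OF dim] B_def by (simp add: ennreal_mult[symmetric] gauss_on_nonneg)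
      finally show ?thesis .
    qed
  qed
qed

lemma cone_of_insert: "i \<notin> J \<Longrightarrow> cone_of (insert i J) (w(i := u)) = cone_of J w \<inter> {x. inner u x \<le> 0}"
  by (auto simp: cone_of_def)

text \<open>Active sets of the enlarged system either omit the new index or contain it; the two
  kinds give the two halves of the result.\<close>

lemma nn_integral_curv_measure_halfspace:
  fixes C :: "'a::euclidean_space set"
  assumes C: "polyhedral_cone C" and k: "1 \<le> k" and A: "A \<in> sets borel" "conic_set A"
  shows "(\<integral>\<^sup>+u. ennreal (curv_measure k (C \<inter> {x. inner u x \<le> 0}) A) \<partial>std_gaussian)
     = ennreal ((curv_measure k C A + curv_measure (k + 1) C A) / 2)"
proof -
  let ?G = "std_gaussian :: 'a measure"
  obtain U where U: "finite U" "C = {x. \<forall>u\<in>U. inner u x \<le> 0}"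
    using C by (auto simp: polyhedral_cone_def)
  \<comment> \<open>The index \<open>None\<close> stays free for the random constraint; the value of
    \<open>w\<close> there is a placeholder that gets overwritten.\<close>
  define J where "J = Some ` U"
  define w where "w = (case_option 0 (\<lambda>u. u) :: 'a option \<Rightarrow> 'a)"
  have J: "finite J" "None \<notin> J" using U by (auto simp: J_def)
  have CJ: "C = cone_of J w" by (auto simp: U(2) cone_of_def J_def w_def)
  let ?t = "\<lambda>u I. curv_term k (insert None J) (w(None := u)) A I"
  have m: "(\<lambda>u. ennreal (?t u I)) \<in> borel_measurable ?G" if "I \<subseteq> insert None J" for I
    using borel_measurable_curv_term[OF _ that A(1), of "\<lambda>u. w(None := u)" ?G k] J by simp
  have Pow: "Pow (insert None J) = Pow J \<union> insert None ` Pow J" by (rule Pow_insert)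
  have inj: "inj_on (insert None) (Pow J)" using J(2) by (intro inj_onI) (metis PowD insert_ident subsetD)
  have "(\<integral>\<^sup>+u. ennreal (curv_measure k (C \<inter> {x. inner u x \<le> 0}) A) \<partial>?G) = (\<integral>\<^sup>+u. (\<Sum>I\<in>Pow (insert None J). ennreal (?t u I)) \<partial>?G)"
    by (intro nn_integral_cong)
       (simp only: CJ cone_of_insert[OF J(2), symmetric] curv_measure_cone_of[OF finite.insertI[OF J(1)] A(1)] sum_ennreal curv_term_nonneg)
  also have "\<dots> = (\<Sum>I\<in>Pow (insert None J). \<integral>\<^sup>+u. ennreal (?t u I) \<partial>?G)"
    by (intro nn_integral_sum m) auto
  also have "\<dots> = (\<Sum>I\<in>Pow J. \<integral>\<^sup>+u. ennreal (?t u I) \<partial>?G) + (\<Sum>I\<in>Pow J. \<integral>\<^sup>+u. ennreal (?t u (insert None I)) \<partial>?G)"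
    unfolding Pow by (subst sum.union_disjoint) (use J in \<open>auto simp: sum.reindex[OF inj]\<close>)
  also have "\<dots> = (\<Sum>I\<in>Pow J. ennreal (curv_term k J w A I / 2)) + (\<Sum>I\<in>Pow J. ennreal (curv_term (k + 1) J w A I / 2))"
    using J k A by (intro arg_cong2[where f="(+)"] sum.cong refl nn_integral_curv_term_inactive nn_integral_curv_term_active) auto
  also have "\<dots> = ennreal ((curv_measure k C A + curv_measure (k + 1) C A) / 2)"
    by (simp add: CJ curv_measure_cone_of[OF J(1) A(1)] curv_term_nonneg sum_nonneg add_divide_distrib sum_divide_distrib)
  finally show ?thesis .
qed

subsection \<open>Schlaefli cones as sign cells\<close>

lemma borel_measurable_uniform_sphere_id: "(\<lambda>x. x) \<in> borel_measurable (uniform_sphere :: 'a::euclidean_space measure)"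
  unfolding measurable_cong_sets[OF sets_uniform_sphere refl] by (intro measurable_restrict_space1) simp

text \<open>A function invariant under positive scaling has the same integral over a Gaussian vector
  and its normalization, and the Gaussian law is symmetric, which absorbs the sign.\<close>

lemma nn_integral_uniform_sphere:
  fixes f :: "'a::euclidean_space \<Rightarrow> ennreal"
  assumes [measurable]: "f \<in> borel_measurable borel" and hom: "\<And>t x. t > 0 \<Longrightarrow> f (t *\<^sub>R x) = f x"
    and s: "s = 1 \<or> s = - 1"
  shows "(\<integral>\<^sup>+u. f (s *\<^sub>R u) \<partial>uniform_sphere) = (\<integral>\<^sup>+u. f u \<partial>std_gaussian)"
proof -
  have [measurable]: "unit_dir \<in> std_gaussian \<rightarrow>\<^sub>M restrict_space borel (sphere (0::'a) 1)"
    by (intro measurable_restrict_space2) auto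
  have "(\<lambda>u. f (s *\<^sub>R u)) \<in> borel_measurable (restrict_space borel (sphere 0 1))"
    by (intro measurable_restrict_space1) simp
  then have "(\<integral>\<^sup>+u. f (s *\<^sub>R u) \<partial>uniform_sphere) = (\<integral>\<^sup>+u. f (s *\<^sub>R unit_dir u) \<partial>std_gaussian)"
    unfolding uniform_sphere_eq by (subst nn_integral_distr) auto
  also have "\<dots> = (\<integral>\<^sup>+u. f (s *\<^sub>R u) \<partial>std_gaussian)"
  proof (rule nn_integral_cong_AE)
    obtain b :: 'a where "b \<in> Basis" using nonempty_Basis by blast
    then have "AE x in std_gaussian. inner b x \<noteq> 0"
      by (intro AE_std_gaussian_inner nonzero_Basis)
    then show "AE x in std_gaussian. f (s *\<^sub>R unit_dir x) = f (s *\<^sub>R x)"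
    proof eventually_elim
      case (elim x)
      then have "x \<noteq> 0" by auto
      then have "s *\<^sub>R unit_dir x = inverse (norm x) *\<^sub>R (s *\<^sub>R x)"
        by (auto simp: unit_dir_def sgn_div_norm)
      then show ?case using hom[of "inverse (norm x)" "s *\<^sub>R x"] \<open>x \<noteq> 0\<close> by simp
    qed
  qed
  also have "\<dots> = (\<integral>\<^sup>+u. f u \<partial>std_gaussian)"
    using s by (intro nn_integral_std_gaussian_orthogonal[where T="\<lambda>u. s *\<^sub>R u"])
      (auto simp: orthogonal_transformation_neg)
  finally show ?thesis .
qed

text \<open>The tags of the sum type keep the fixed normals of \<open>C\<close> apart from the
  random ones, so that measurability for indexed constraints applies.\<close>

lemma cone_of_Int_polyhedral:
  fixes C :: "'a::euclidean_space set"
  assumes "C = {x. \<forall>u\<in>U. inner u x \<le> 0}"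
  shows "C \<inter> cone_of J w = cone_of (Inl ` U \<union> Inr ` J) (case_sum (\<lambda>u. u) w)"
  by (simp add: assms cone_of_def ball_Un Collect_conj_eq)

lemma polyhedral_cone_Int_cone_of:
  assumes "polyhedral_cone C" "finite J"
  shows "polyhedral_cone (C \<inter> cone_of J w)"
proof -
  obtain U where U: "finite U" "C = {x. \<forall>u\<in>U. inner u x \<le> 0}"
    using assms by (auto simp: polyhedral_cone_def)
  have "C \<inter> cone_of J w = {x. \<forall>u\<in>U \<union> w ` J. inner u x \<le> 0}"
    using U by (auto simp: cone_of_def)
  with U assms show ?thesis unfolding polyhedral_cone_def by (intro exI[of _ "U \<union> w ` J"]) auto
qed

lemma borel_measurable_curv_measure_Int:
  fixes w :: "'m \<Rightarrow> 'i \<Rightarrow> 'a::euclidean_space"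
  assumes C: "polyhedral_cone C" and J: "finite J" and A: "A \<in> sets borel"
    and w: "\<And>i. i \<in> J \<Longrightarrow> (\<lambda>\<omega>. w \<omega> i) \<in> borel_measurable M"
  shows "(\<lambda>\<omega>. curv_measure k (C \<inter> cone_of J (w \<omega>)) A) \<in> borel_measurable M"
proof -
  obtain U where U: "finite U" "C = {x. \<forall>u\<in>U. inner u x \<le> 0}"
    using C by (auto simp: polyhedral_cone_def)
  show ?thesis
    unfolding cone_of_Int_polyhedral[OF U(2)]
    by (rule borel_measurable_curv_measure_cone_of) (use U J A w in auto)
qed

lemma nn_integral_curv_measure_uniform_halfspace:
  fixes C :: "'a::euclidean_space set"
  assumes C: "polyhedral_cone C" and k: "1 \<le> k" and A: "A \<in> sets borel" "conic_set A" and s: "s = 1 \<or> s = - 1"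
  shows "(\<integral>\<^sup>+u. ennreal (curv_measure k (C \<inter> {x. inner (s *\<^sub>R u) x \<le> 0}) A) \<partial>uniform_sphere)
     = ennreal ((curv_measure k C A + curv_measure (k + 1) C A) / 2)"
proof -
  let ?f = "\<lambda>u. ennreal (curv_measure k (C \<inter> {x. inner u x \<le> 0}) A)"
  have "(\<integral>\<^sup>+u. ?f (s *\<^sub>R u) \<partial>uniform_sphere) = (\<integral>\<^sup>+u. ?f u \<partial>std_gaussian)"
  proof (rule nn_integral_uniform_sphere[OF _ _ s])
    have "{x. inner u x \<le> 0} = cone_of {()} (\<lambda>_. u)" for u :: 'a by (simp add: cone_of_def)
    then show "?f \<in> borel_measurable borel"
      using borel_measurable_curv_measure_Int[OF C, of "{()}" A "\<lambda>u _. u" borel k] A by simp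
    fix t :: real and x :: 'a assume "t > 0"
    then show "?f (t *\<^sub>R x) = ?f x" by (simp add: mult_le_0_iff)
  qed
  then show ?thesis using nn_integral_curv_measure_halfspace[OF C k A] by simp
qed

section \<open>Mean curvature measures of a cell with fixed signs\<close>

abbreviation (input) iid_sphere :: "nat \<Rightarrow> (nat \<Rightarrow> 'a::euclidean_space) measure" where
  "iid_sphere n \<equiv> PiM {..<n} (\<lambda>_. uniform_sphere)"

interpretation sphere: prob_space "uniform_sphere :: 'a::euclidean_space measure"
  by (rule prob_space_uniform_sphere)

interpretation sphere_product: product_sigma_finite "\<lambda>_::nat. uniform_sphere :: 'a::euclidean_space measure"
  by standard

lemma borel_measurable_signed_component:
  assumes "i < n"
  shows "(\<lambda>u. s i *\<^sub>R u i) \<in> borel_measurable (iid_sphere n :: (nat \<Rightarrow> 'a::euclidean_space) measure)"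
proof -
  have "(\<lambda>u. u i) \<in> (iid_sphere n :: (nat \<Rightarrow> 'a) measure) \<rightarrow>\<^sub>M uniform_sphere"
    using assms by (intro measurable_component_singleton) simp
  from measurable_compose[OF this borel_measurable_uniform_sphere_id] show ?thesis
    by (intro borel_measurable_scaleR borel_measurable_const)
qed

abbreviation cell :: "nat \<Rightarrow> (nat \<Rightarrow> real) \<Rightarrow> (nat \<Rightarrow> 'a::euclidean_space) \<Rightarrow> 'a set" where
  "cell n s u \<equiv> cone_of {..<n} (\<lambda>i. s i *\<^sub>R u i)"

abbreviation open_cell :: "nat \<Rightarrow> (nat \<Rightarrow> real) \<Rightarrow> (nat \<Rightarrow> 'a::euclidean_space) \<Rightarrow> 'a set" where
  "open_cell n s u \<equiv> active_part {..<n} (\<lambda>i. s i *\<^sub>R u i) {}"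

lemma cell_Suc: "cell (Suc n) s (u(n := y)) = cell n s u \<inter> {x. inner (s n *\<^sub>R y) x \<le> 0}"
  by (auto simp: cone_of_def less_Suc_eq)

lemma sum_pascal:
  fixes a :: "nat \<Rightarrow> real"
  shows "(\<Sum>r\<le>n. real (n choose r) * a r) + (\<Sum>r\<le>n. real (n choose r) * a (Suc r)) =
     (\<Sum>r\<le>Suc n. real (Suc n choose r) * a r)"
proof -
  \<comment> \<open>The added summand at \<open>Suc n\<close> vanishes because its binomial
    coefficient is 0.\<close>
  have "(\<Sum>r\<le>n. real (n choose r) * a r) = (\<Sum>r\<le>Suc n. real (n choose r) * a r)" by simp
  also have "\<dots> = a 0 + (\<Sum>r\<le>n. real (n choose Suc r) * a (Suc r))"
    by (subst sum.atMost_Suc_shift) simp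
  finally have "(\<Sum>r\<le>n. real (n choose r) * a r) = a 0 + (\<Sum>r\<le>n. real (n choose Suc r) * a (Suc r))" .
  moreover have "(\<Sum>r\<le>Suc n. real (Suc n choose r) * a r) =
      a 0 + (\<Sum>r\<le>n. (real (n choose r) + real (n choose Suc r)) * a (Suc r))"
    by (subst sum.atMost_Suc_shift) simp
  ultimately show ?thesis by (simp only: sum.distrib distrib_right add.assoc add.commute add.left_commute)
qed

text \<open>Induction over the hyperplanes with \<open>k\<close> arbitrary, since each halfspace
  averages the values at \<open>k\<close> and \<open>k + 1\<close>; Pascal's rule collects the
  coefficients.\<close>

lemma nn_integral_curv_measure_cell:
  fixes C :: "'a::euclidean_space set"
  assumes C: "polyhedral_cone C" and k: "1 \<le> k" and A: "A \<in> sets borel" "conic_set A"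
    and s: "\<And>i. i < n \<Longrightarrow> s i = 1 \<or> s i = - 1"
  shows "(\<integral>\<^sup>+u. ennreal (curv_measure k (C \<inter> cell n s u) A) \<partial>iid_sphere n)
     = ennreal ((\<Sum>r\<le>n. real (n choose r) * curv_measure (k + r) C A) / 2 ^ n)"
  using k s
proof (induction n arbitrary: k)
  case 0
  then show ?case by (simp add: cone_of_def PiM_empty nn_integral_count_space_finite)
next
  case (Suc n)
  let ?f = "\<lambda>u. ennreal (curv_measure k (C \<inter> cell (Suc n) s u) A)"
  have m: "(\<lambda>u. ennreal (curv_measure k (C \<inter> cell n s u) A)) \<in> borel_measurable (iid_sphere n)" for n k
    by (intro measurable_compose[OF borel_measurable_curv_measure_Int[OF C _ A(1)] measurable_ennreal]
        borel_measurable_signed_component) auto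
  \<comment> \<open>The last direction is integrated first, with \<open>C\<close> intersected with
    the cell of the earlier ones as the fixed polyhedral cone.\<close>
  have "(\<integral>\<^sup>+u. ?f u \<partial>iid_sphere (Suc n)) = (\<integral>\<^sup>+x. \<integral>\<^sup>+y. ?f (x(n := y)) \<partial>uniform_sphere \<partial>iid_sphere n)"
    using m[of k "Suc n"] sphere_product.product_nn_integral_insert[of "{..<n}" n ?f, folded lessThan_Suc]
    by simp
  also have "\<dots> = (\<integral>\<^sup>+x. ennreal (curv_measure k (C \<inter> cell n s x) A) / 2 + ennreal (curv_measure (k + 1) (C \<inter> cell n s x) A) / 2 \<partial>iid_sphere n)"
  proof (rule nn_integral_cong)
    fix x
    have "(\<integral>\<^sup>+y. ?f (x(n := y)) \<partial>uniform_sphere) =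
        ennreal ((curv_measure k (C \<inter> cell n s x) A + curv_measure (k + 1) (C \<inter> cell n s x) A) / 2)"
      unfolding cell_Suc Int_assoc[symmetric]
      by (intro nn_integral_curv_measure_uniform_halfspace polyhedral_cone_Int_cone_of C A) (use Suc.prems in auto)
    then show "(\<integral>\<^sup>+y. ?f (x(n := y)) \<partial>uniform_sphere) =
        ennreal (curv_measure k (C \<inter> cell n s x) A) / 2 + ennreal (curv_measure (k + 1) (C \<inter> cell n s x) A) / 2"
      by (simp add: add_divide_distrib curv_measure_nonneg divide_ennreal[symmetric])
  qed
  also have "\<dots> = ennreal ((\<Sum>r\<le>n. real (n choose r) * curv_measure (k + r) C A) / 2 ^ n) / 2 +
      ennreal ((\<Sum>r\<le>n. real (n choose r) * curv_measure (k + 1 + r) C A) / 2 ^ n) / 2"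
    using m Suc.prems by (simp add: nn_integral_add nn_integral_divide Suc.IH[of k] Suc.IH[of "k + 1", simplified])
  also have "\<dots> = ennreal (((\<Sum>r\<le>n. real (n choose r) * curv_measure (k + r) C A) +
      (\<Sum>r\<le>n. real (n choose r) * curv_measure (k + Suc r) C A)) / 2 ^ Suc n)"
  proof -
    have half: "ennreal x / 2 + ennreal y / 2 = ennreal ((x + y) / 2)" if "0 \<le> x" "0 \<le> y" for x y
      using that by (simp add: add_divide_distrib divide_ennreal[symmetric])
    show ?thesis
      by (subst half) (simp_all add: curv_measure_nonneg sum_nonneg add_divide_distrib mult.commute)
  qed
  also have "\<dots> = ennreal ((\<Sum>r\<le>Suc n. real (Suc n choose r) * curv_measure (k + r) C A) / 2 ^ Suc n)"
    by (subst sum_pascal[of n "\<lambda>r. curv_measure (k + r) C A"]) simp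
  finally show ?case .
qed

section \<open>Nonempty open cells as components of the hyperplane complement\<close>

lemma open_active_part_empty: "finite J \<Longrightarrow> open (active_part J w {})"
proof -
  assume "finite J"
  moreover have "active_part J w {} = (\<Inter>j\<in>J. {x. inner (w j) x < 0})" by (auto simp: active_part_def)
  ultimately show ?thesis by (auto intro!: open_INT open_halfspace_lt)
qed

text \<open>Adding small positive multiples of a strictly feasible point \<open>p\<close> to a point
  of the cone makes all its constraints strict.\<close>

lemma closure_active_part_empty:
  assumes ne: "active_part J w {} \<noteq> {}"
  shows "closure (active_part J w {}) = cone_of J w"
proof
  show "closure (active_part J w {}) \<subseteq> cone_of J w"
    by (intro closure_minimal closed_cone_of) (auto simp: active_part_def cone_of_def less_imp_le)
  obtain p where p: "p \<in> active_part J w {}" using ne by blast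
  show "cone_of J w \<subseteq> closure (active_part J w {})"
  proof
    fix y assume y: "y \<in> cone_of J w"
    let ?z = "\<lambda>m. y + (1 / real (Suc m)) *\<^sub>R p"
    have "?z m \<in> active_part J w {}" for m
      using p y by (auto simp: active_part_def cone_of_def inner_add_right intro!: add_nonpos_neg divide_neg_pos)
    moreover have "?z \<longlonglongrightarrow> y + 0 *\<^sub>R p"
      by (intro tendsto_intros lim_1_over_n[THEN LIMSEQ_Suc])
    ultimately show "y \<in> closure (active_part J w {})"
      unfolding closure_sequential by (intro exI[of _ ?z]) auto
  qed
qed

text \<open>Extensionality makes a sign vector determined by its first \<open>n\<close> entries, so
  the set is finite and distinct vectors give distinct nondegenerate cells.\<close>

definition sign_vectors :: "nat \<Rightarrow> (nat \<Rightarrow> real) set" where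
  "sign_vectors n = {..<n} \<rightarrow>\<^sub>E {1, - 1}"

lemma finite_sign_vectors: "finite (sign_vectors n)"
  unfolding sign_vectors_def by (intro finite_PiE) auto

lemma card_sign_vectors: "card (sign_vectors n) = 2 ^ n"
  unfolding sign_vectors_def by (subst card_PiE) (auto simp: numeral_2_eq_2)

lemma sign_vectors_nth: "s \<in> sign_vectors n \<Longrightarrow> i < n \<Longrightarrow> s i = 1 \<or> s i = - 1"
  unfolding sign_vectors_def by auto

text \<open>Open cells are convex, hence connected, and by the intermediate value theorem the sign
  pattern is constant on connected subsets of the complement.\<close>

lemma components_hyperplane_complement:
  fixes u :: "nat \<Rightarrow> 'a::euclidean_space"
  shows "components (UNIV - (\<Union>i<n. {x. inner (u i) x = 0})) =
     (\<lambda>s. open_cell n s u) ` {s\<in>sign_vectors n. open_cell n s u \<noteq> {}}"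
proof -
  define W where "W = UNIV - (\<Union>i<n. {x. inner (u i) x = 0})"
  \<comment> \<open>The signs are opposite to those of the inner products because cells are cut out
    by negative values.\<close>
  define sg where "sg x = restrict (\<lambda>i. if inner (u i) x < 0 then 1 else (- 1 :: real)) {..<n}" for x
  have sg: "sg x \<in> sign_vectors n" for x by (auto simp: sg_def sign_vectors_def)
  have sg_cell: "x \<in> open_cell n (sg x) u" if "x \<in> W" for x
    using that by (auto simp: W_def sg_def active_part_def not_less le_less)
  have cellW: "open_cell n s u \<subseteq> W" if "s \<in> sign_vectors n" for s
    using sign_vectors_nth[OF that] by (force simp: W_def active_part_def)
  have sg_eq: "sg x = s" if s: "s \<in> sign_vectors n" and x: "x \<in> open_cell n s u" for s x
  proof
    fix i
    show "sg x i = s i"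
    proof (cases "i < n")
      case True
      then have "s i * inner (u i) x < 0" using x by (simp add: active_part_def)
      then show ?thesis using sign_vectors_nth[OF s True] True by (auto simp: sg_def)
    next
      case False
      then show ?thesis using s by (auto simp: sg_def sign_vectors_def PiE_def extensional_def)
    qed
  qed
  have comp: "connected_component_set W x = open_cell n (sg x) u" if x: "x \<in> W" for x
  proof
    have "convex (open_cell n (sg x) u)"
    proof -
      have "open_cell n (sg x) u = (\<Inter>i\<in>{..<n}. {y. inner (sg x i *\<^sub>R u i) y < 0})"
        by (auto simp: active_part_def)
      then show ?thesis by (auto intro!: convex_INT convex_halfspace_lt simp del: inner_scaleR_left)
    qed
    then show "open_cell n (sg x) u \<subseteq> connected_component_set W x"
      by (intro connected_component_maximal sg_cell x convex_connected cellW sg)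
    show "connected_component_set W x \<subseteq> open_cell n (sg x) u"
    proof
      fix y assume "y \<in> connected_component_set W x"
      then obtain T where T: "connected T" "T \<subseteq> W" "x \<in> T" "y \<in> T"
        by (auto simp: connected_component_def)
      have "sg y = sg x"
      proof
        fix i
        show "sg y i = sg x i"
        proof (rule ccontr)
          assume "sg y i \<noteq> sg x i"
          then have i: "i < n" and "(inner (u i) x \<le> 0 \<and> 0 \<le> inner (u i) y) \<or> (inner (u i) y \<le> 0 \<and> 0 \<le> inner (u i) x)"
            by (auto simp: sg_def restrict_def split: if_splits)
          then obtain z where "z \<in> T" "inner (u i) z = 0"
            using connected_ivt_hyperplane[OF T(1) T(3,4)] connected_ivt_hyperplane[OF T(1) T(4,3)] by blast
          with T i show False by (auto simp: W_def)
        qed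
      qed
      then show "y \<in> open_cell n (sg x) u" using sg_cell[of y] T by auto
    qed
  qed
  have "components W = (\<lambda>x. open_cell n (sg x) u) ` W"
    unfolding components_def using comp by auto
  also have "\<dots> = (\<lambda>s. open_cell n s u) ` {s\<in>sign_vectors n. open_cell n s u \<noteq> {}}"
  proof (intro equalityI subsetI)
    fix S assume "S \<in> (\<lambda>x. open_cell n (sg x) u) ` W"
    then show "S \<in> (\<lambda>s. open_cell n s u) ` {s\<in>sign_vectors n. open_cell n s u \<noteq> {}}"
      using sg sg_cell by blast
  next
    fix S assume "S \<in> (\<lambda>s. open_cell n s u) ` {s\<in>sign_vectors n. open_cell n s u \<noteq> {}}"
    then obtain s x where s: "s \<in> sign_vectors n" "S = open_cell n s u" "x \<in> open_cell n s u" by blast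
    then show "S \<in> (\<lambda>x. open_cell n (sg x) u) ` W"
      using sg_eq[OF s(1,3)] cellW[OF s(1)] by blast
  qed
  finally show ?thesis by (simp add: W_def)
qed

lemma inj_on_cell:
  "inj_on (\<lambda>s. cell n s u) {s\<in>sign_vectors n. open_cell n s u \<noteq> {}}"
proof (rule inj_onI)
  fix s t assume "s \<in> {s\<in>sign_vectors n. open_cell n s u \<noteq> {}}" "t \<in> {s\<in>sign_vectors n. open_cell n s u \<noteq> {}}"
    and eq: "cell n s u = cell n t u"
  then have s: "s \<in> sign_vectors n" and t: "t \<in> sign_vectors n" and ne: "open_cell n s u \<noteq> {}" by auto
  obtain x where x: "x \<in> open_cell n s u" using ne by blast
  have "x \<in> cell n t u" using x active_part_subset[of "{..<n}" "\<lambda>i. s i *\<^sub>R u i" "{}"] eq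
    by (auto simp: active_face_def)
  show "s = t"
  proof
    fix i
    show "s i = t i"
    proof (cases "i < n")
      case True
      then have "s i * inner (u i) x < 0" "t i * inner (u i) x \<le> 0"
        using x \<open>x \<in> cell n t u\<close> by (auto simp: active_part_def cone_of_def)
      then show ?thesis using sign_vectors_nth[OF s True] sign_vectors_nth[OF t True] by auto
    next
      case False
      then show ?thesis using s t by (auto simp: sign_vectors_def PiE_def extensional_def)
    qed
  qed
qed

text \<open>This trades the random index set for a fixed one, so that the expectation can be taken
  term by term.\<close>

lemma sum_schlafli_cones:
  fixes u :: "nat \<Rightarrow> 'a::euclidean_space"
  shows "(\<Sum>S\<in>schlafli_cones n u. f S) = (\<Sum>s\<in>sign_vectors n. if open_cell n s u \<noteq> {} then f (cell n s u) else (0::real))"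
proof -
  let ?K = "{s\<in>sign_vectors n. open_cell n s u \<noteq> {}}"
  have "schlafli_cones n u = (\<lambda>s. closure (open_cell n s u)) ` ?K"
    by (simp add: schlafli_cones_def components_hyperplane_complement image_image)
  also have "\<dots> = (\<lambda>s. cell n s u) ` ?K"
    by (intro image_cong refl closure_active_part_empty) auto
  finally have "(\<Sum>S\<in>schlafli_cones n u. f S) = (\<Sum>s\<in>?K. f (cell n s u))"
    by (simp add: sum.reindex[OF inj_on_cell])
  also have "\<dots> = (\<Sum>s\<in>sign_vectors n. if open_cell n s u \<noteq> {} then f (cell n s u) else 0)"
    using finite_sign_vectors by (simp add: sum.inter_filter)
  finally show ?thesis .
qed

section \<open>Almost surely a closed cell is full-dimensional or trivial\<close>

lemma pred_active_part_empty_nonempty: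
  fixes w :: "'m \<Rightarrow> 'i \<Rightarrow> 'a::euclidean_space"
  assumes J: "finite J" and w: "\<And>i. i \<in> J \<Longrightarrow> (\<lambda>\<omega>. w \<omega> i) \<in> borel_measurable M"
  shows "Measurable.pred M (\<lambda>\<omega>. active_part J (w \<omega>) {} \<noteq> {})"
proof -
  obtain D :: "'a set" where D: "countable D" "\<And>X. open X \<Longrightarrow> X \<noteq> {} \<Longrightarrow> \<exists>d\<in>D. d \<in> X"
    using countable_dense_setE by blast
  have "active_part J (w \<omega>) {} \<noteq> {} \<longleftrightarrow> (\<exists>d\<in>D. d \<in> active_part J (w \<omega>) {})" for \<omega>
    using D(2)[OF open_active_part_empty[OF J]] by blast
  moreover have "Measurable.pred M (\<lambda>\<omega>. \<exists>d\<in>D. d \<in> active_part J (w \<omega>) {})"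
    unfolding pred_def using D(1)
    by (intro sets.sets_Collect_countable_Ex' pred_active_part[OF J _ w, unfolded pred_def]) auto
  ultimately show ?thesis by simp
qed

text \<open>By Farkas' lemma triviality of the cone means that its normals generate the whole space,
  which is tested on finitely many vectors and is therefore measurable.\<close>

lemma cone_of_subset_0_iff:
  fixes w :: "'i \<Rightarrow> 'a::euclidean_space"
  assumes J: "finite J"
  shows "cone_of J w \<subseteq> {0} \<longleftrightarrow> (\<forall>b\<in>Basis \<union> uminus ` Basis. b \<in> convex_cone hull (w ` J))"
proof
  assume "cone_of J w \<subseteq> {0}"
  then show "\<forall>b\<in>Basis \<union> uminus ` Basis. b \<in> convex_cone hull (w ` J)"
    using J by (subst convex_cone_hull_polar) (auto simp: cone_of_def)
next
  assume R: "\<forall>b\<in>Basis \<union> uminus ` Basis. b \<in> convex_cone hull (w ` J)"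
  show "cone_of J w \<subseteq> {0}"
  proof
    fix x assume "x \<in> cone_of J w"
    then have x: "\<forall>v\<in>w ` J. inner v x \<le> 0" by (auto simp: cone_of_def)
    have "inner b x = 0" if b: "b \<in> Basis" for b
    proof -
      have "b \<in> convex_cone hull (w ` J)" "- b \<in> convex_cone hull (w ` J)" using R b by auto
      then have "inner b x \<le> 0" "inner (- b) x \<le> 0"
        using x J unfolding convex_cone_hull_polar[OF finite_imageI[OF J]] by blast+
      then show ?thesis by simp
    qed
    then show "x \<in> {0}" by (auto intro: euclidean_eqI simp: inner_commute)
  qed
qed

definition nondegenerate :: "'i set \<Rightarrow> ('i \<Rightarrow> 'a::euclidean_space) \<Rightarrow> bool" where
  "nondegenerate J w \<longleftrightarrow> active_part J w {} \<noteq> {} \<or> cone_of J w \<subseteq> {0}"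

lemma pred_nondegenerate:
  fixes w :: "'m \<Rightarrow> 'i \<Rightarrow> 'a::euclidean_space"
  assumes J: "finite J" and w: "\<And>i. i \<in> J \<Longrightarrow> (\<lambda>\<omega>. w \<omega> i) \<in> borel_measurable M"
  shows "Measurable.pred M (\<lambda>\<omega>. nondegenerate J (w \<omega>))"
  unfolding nondegenerate_def cone_of_subset_0_iff[OF J]
  by (intro pred_intros_logic pred_intros_finite pred_active_part_empty_nonempty pred_convex_cone_hull J w borel_measurable_const)
     auto

text \<open>Let \<open>Q\<close> be the dual cone of \<open>?K\<close>; its frontier is a null set
  by convexity. If \<open>u\<close> lies outside \<open>Q\<close>, the open halfspace meets
  \<open>?K\<close> and hence its dense open part. If \<open>u\<close> is interior to
  \<open>Q\<close>, it is positive on \<open>?K\<close> away from 0, so only the origin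
  remains.\<close>

lemma AE_nondegenerate_insert:
  fixes w :: "'i \<Rightarrow> 'a::euclidean_space"
  assumes J: "finite J" "i \<notin> J" and nd: "nondegenerate J w"
  shows "AE u in std_gaussian. nondegenerate (insert i J) (w(i := u))"
proof (cases "active_part J w {} = {}")
  case True
  then have "cone_of J w \<subseteq> {0}" using nd by (simp add: nondegenerate_def)
  then show ?thesis unfolding nondegenerate_def cone_of_insert[OF J(2)] by auto
next
  case ne: False
  let ?K = "cone_of J w"
  define Q where "Q = {u. \<forall>x\<in>?K. 0 \<le> inner u x}"
  have Q_eq: "Q = (\<Inter>x\<in>?K. {u. inner x u \<ge> 0})" by (auto simp: Q_def inner_commute)
  have "convex Q" unfolding Q_eq by (intro convex_INT convex_halfspace_ge)
  then have "frontier Q \<in> null_sets std_gaussian"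
    by (intro null_std_gaussian_negligible negligible_convex_frontier) auto
  moreover have "closed Q" unfolding Q_eq by (intro closed_INT ballI closed_halfspace_ge)
  ultimately have "AE u in std_gaussian. u \<notin> Q - interior Q"
    using AE_not_in[of "frontier Q"] by (simp add: frontier_def)
  then show ?thesis
  proof eventually_elim
    case (elim u)
    have part: "active_part (insert i J) (w(i := u)) {} = active_part J w {} \<inter> {x. inner u x < 0}"
      using J by (auto simp: active_part_def)
    show ?case
    proof (cases "u \<in> Q")
      case False
      then obtain x where "x \<in> ?K" "inner u x < 0" by (auto simp: Q_def not_le)
      then have "{x. inner u x < 0} \<inter> closure (active_part J w {}) \<noteq> {}"
        using closure_active_part_empty[OF ne] by auto
      then have "{x. inner u x < 0} \<inter> active_part J w {} \<noteq> {}"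
        using open_Int_closure_eq_empty[OF open_halfspace_lt[of u 0]] by auto
      then show ?thesis unfolding nondegenerate_def part by (simp add: Int_commute)
    next
      case True
      with elim have "u \<in> interior Q" by simp
      then obtain e where e: "e > 0" "ball u e \<subseteq> Q" by (auto simp: mem_interior)
      have "x = 0" if x: "x \<in> ?K" "inner u x \<le> 0" for x
      proof (rule ccontr)
        assume "x \<noteq> 0"
        \<comment> \<open>Moving \<open>u\<close> slightly against \<open>x\<close> stays in
          \<open>Q\<close>, so \<open>inner u x\<close> exceeds 0 by a definite amount.\<close>
        let ?v = "u - (e / 2 / norm x) *\<^sub>R x"
        have "?v \<in> ball u e" using e \<open>x \<noteq> 0\<close> by (simp add: dist_norm)
        then have "?v \<in> Q" using e by blast
        then have "0 \<le> inner ?v x" using x by (auto simp: Q_def)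
        then have "(e / 2 / norm x) * inner x x \<le> inner u x" by (simp add: inner_diff_left)
        moreover have "(e / 2 / norm x) * inner x x > 0" using e \<open>x \<noteq> 0\<close> by simp
        ultimately show False using x by simp
      qed
      then show ?thesis unfolding nondegenerate_def cone_of_insert[OF J(2)] by blast
    qed
  qed
qed

lemma AE_nondegenerate_cell:
  assumes "\<And>i. i < n \<Longrightarrow> s i = 1 \<or> s i = - 1"
  shows "AE u in (iid_sphere n :: (nat \<Rightarrow> 'a::euclidean_space) measure). nondegenerate {..<n} (\<lambda>i. s i *\<^sub>R u i)"
  using assms
proof (induction n)
  case 0
  then show ?case by (simp add: nondegenerate_def active_part_def)
next
  case (Suc n)
  let ?nd = "\<lambda>n (u :: nat \<Rightarrow> 'a). nondegenerate {..<n} (\<lambda>i. s i *\<^sub>R u i)"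
  \<comment> \<open>With the indicator of failure the almost sure statement becomes a vanishing
    integral, which can be split into one over the last direction and one over the rest.\<close>
  let ?f = "\<lambda>n u. if ?nd n u then 0 else 1 :: ennreal"
  have m: "?f n \<in> borel_measurable (iid_sphere n)" for n
    by (intro measurable_If measurable_const pred_nondegenerate[unfolded pred_def] borel_measurable_signed_component) auto
  have iff: "(\<integral>\<^sup>+u. ?f n u \<partial>iid_sphere n) = 0 \<longleftrightarrow> (AE u in iid_sphere n. ?nd n u)" for n
    by (subst nn_integral_0_iff_AE[OF m]) (auto intro!: arg_cong[where f="\<lambda>P. almost_everywhere (iid_sphere n) P"])
  have inner0: "(\<integral>\<^sup>+y. ?f (Suc n) (x(n := y)) \<partial>uniform_sphere) = 0" if x: "?nd n x" for x
  proof -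
    define w where "w = (\<lambda>i. s i *\<^sub>R x i)"
    define g where "g u = (if nondegenerate (insert n {..<n}) (w(n := u)) then 0 else 1 :: ennreal)" for u
    have [measurable]: "g \<in> borel_measurable borel"
      unfolding g_def
      by (intro measurable_If measurable_const pred_nondegenerate[unfolded pred_def]) auto
    have hom: "g (t *\<^sub>R u) = g u" if "t > 0" for t u
    proof -
      have "active_part (insert n {..<n}) (w(n := t *\<^sub>R u)) {} = active_part (insert n {..<n}) (w(n := u)) {}"
        "cone_of (insert n {..<n}) (w(n := t *\<^sub>R u)) = cone_of (insert n {..<n}) (w(n := u))"
        using that by (auto simp: active_part_def cone_of_def mult_less_0_iff mult_le_0_iff)
      then show ?thesis by (simp add: g_def nondegenerate_def)
    qed
    have "(\<lambda>i. s i *\<^sub>R (x(n := y)) i) = w(n := s n *\<^sub>R y)" for y by (auto simp: w_def)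
    then have "(\<integral>\<^sup>+y. ?f (Suc n) (x(n := y)) \<partial>uniform_sphere) = (\<integral>\<^sup>+y. g (s n *\<^sub>R y) \<partial>uniform_sphere)"
      by (simp only: g_def lessThan_Suc)
    also have "\<dots> = (\<integral>\<^sup>+u. g u \<partial>std_gaussian)"
      using Suc.prems by (intro nn_integral_uniform_sphere hom) auto
    also have "\<dots> = 0"
    proof (subst nn_integral_0_iff_AE)
      have "AE u in std_gaussian. nondegenerate (insert n {..<n}) (w(n := u))"
        using x by (intro AE_nondegenerate_insert) (auto simp: w_def)
      then show "AE u in std_gaussian. g u = 0" by eventually_elim (simp add: g_def)
    qed simp
    finally show ?thesis .
  qed
  have "(\<integral>\<^sup>+u. ?f (Suc n) u \<partial>iid_sphere (Suc n)) = (\<integral>\<^sup>+x. \<integral>\<^sup>+y. ?f (Suc n) (x(n := y)) \<partial>uniform_sphere \<partial>iid_sphere n)"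
    using m[of "Suc n"] sphere_product.product_nn_integral_insert[of "{..<n}" n "?f (Suc n)", folded lessThan_Suc]
    by (simp del: fun_upd_apply)
  also have "\<dots> = (\<integral>\<^sup>+x. 0 \<partial>(iid_sphere n :: (nat \<Rightarrow> 'a) measure))"
  proof (rule nn_integral_cong_AE)
    have "AE x in iid_sphere n. ?nd n x" using Suc by simp
    then show "AE x in iid_sphere n. (\<integral>\<^sup>+y. ?f (Suc n) (x(n := y)) \<partial>uniform_sphere) = 0"
      by eventually_elim (rule inner0)
  qed
  finally show ?case unfolding iff[symmetric] by simp
qed

section \<open>Vanishing curvature measures and the sum over all sign vectors\<close>

lemma curv_measure_eq_0:
  assumes "\<And>F. F face_of C \<Longrightarrow> aff_dim F \<noteq> int k"
  shows "curv_measure k C A = 0"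
proof -
  have "kfaces k C = {}" using assms by (auto simp: kfaces_def)
  then show ?thesis by (simp add: curv_measure_def)
qed

lemma curv_measure_subset_0:
  fixes C :: "'a::euclidean_space set"
  assumes "C \<subseteq> {0}" "1 \<le> k"
  shows "curv_measure k C A = 0"
proof (rule curv_measure_eq_0)
  fix F assume "F face_of C"
  then have "F \<subseteq> {0}" using assms face_of_imp_subset by blast
  then have "aff_dim F \<le> 0" using aff_dim_subset[of F "{0}"] by simp
  then show "aff_dim F \<noteq> int k" using assms by simp
qed

lemma curv_measure_gt_DIM:
  fixes C :: "'a::euclidean_space set"
  assumes "k > DIM('a)"
  shows "curv_measure k C A = 0"
proof (rule curv_measure_eq_0)
  fix F assume "F face_of C"
  show "aff_dim F \<noteq> int k" using aff_dim_le_DIM[of F] assms by linarith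
qed

theorem theorem1p2:
  fixes C A :: "'a::euclidean_space set" and n k :: nat
  assumes "DIM('a) \<ge> 2"
    and "polyhedral_cone C"
    and "A \<in> sets borel" and "conic_set A"
    and "n \<ge> 1"
    and "1 \<le> k" and "k \<le> DIM('a)"
  shows "has_bochner_integral (PiM {..<n} (\<lambda>_. uniform_sphere))
           (random_schlafli_avg n (\<lambda>S. curv_measure k (C \<inter> S) A))
           ((\<Sum>s=0..min n (DIM('a) - k). real (n choose s) * curv_measure (k + s) C A)
              / real (schlafli_count n DIM('a)))"
proof -
  let ?M = "iid_sphere n :: (nat \<Rightarrow> 'a) measure"
  let ?N = "real (schlafli_count n DIM('a))"
  let ?S = "\<Sum>r\<le>n. real (n choose r) * curv_measure (k + r) C A"
  \<comment> \<open>Sign vectors with empty open cell do not give a Schlaefli cone and count as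
    0.\<close>
  let ?h = "\<lambda>s u. if open_cell n s u \<noteq> {} then curv_measure k (C \<inter> cell n s u) A else 0"
  have avg: "random_schlafli_avg n (\<lambda>S. curv_measure k (C \<inter> S) A) = (\<lambda>u. (\<Sum>s\<in>sign_vectors n. ?h s u) / ?N)"
    unfolding random_schlafli_avg_def sum_schlafli_cones ..
  \<comment> \<open>Summands with \<open>k + s\<close> above the dimension vanish, so the truncated
    sum equals the full binomial sum.\<close>
  have S: "(\<Sum>s=0..min n (DIM('a) - k). real (n choose s) * curv_measure (k + s) C A) = ?S"
    by (rule sum.mono_neutral_left) (auto simp: curv_measure_gt_DIM not_le)
  have m: "?h s \<in> borel_measurable ?M" for s
    by (intro measurable_If borel_measurable_curv_measure_Int assms measurable_const
        pred_active_part_empty_nonempty[unfolded pred_def] borel_measurable_signed_component) auto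
  have h: "(\<integral>\<^sup>+u. ennreal (?h s u) \<partial>?M) = ennreal (?S / 2 ^ n)" if s: "s \<in> sign_vectors n" for s
  proof -
    have "(\<integral>\<^sup>+u. ennreal (?h s u) \<partial>?M) = (\<integral>\<^sup>+u. ennreal (curv_measure k (C \<inter> cell n s u) A) \<partial>?M)"
    proof (rule nn_integral_cong_AE)
      have "AE u in ?M. nondegenerate {..<n} (\<lambda>i. s i *\<^sub>R u i)"
        using sign_vectors_nth[OF s] by (rule AE_nondegenerate_cell)
      then show "AE u in ?M. ennreal (?h s u) = ennreal (curv_measure k (C \<inter> cell n s u) A)"
      proof eventually_elim
        case (elim u)
        have "curv_measure k (C \<inter> cell n s u) A = 0" if "cell n s u \<subseteq> {0}"
          using that \<open>1 \<le> k\<close> by (intro curv_measure_subset_0) auto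
        then show ?case using elim unfolding nondegenerate_def by auto
      qed
    qed
    also have "\<dots> = ennreal (?S / 2 ^ n)"
      using sign_vectors_nth[OF s] by (intro nn_integral_curv_measure_cell assms)
    finally show ?thesis .
  qed
  have "(\<integral>\<^sup>+u. ennreal ((\<Sum>s\<in>sign_vectors n. ?h s u) / ?N) \<partial>?M) = (\<integral>\<^sup>+u. (\<Sum>s\<in>sign_vectors n. ennreal (?h s u / ?N)) \<partial>?M)"
    by (simp add: sum_divide_distrib curv_measure_nonneg)
  also have "\<dots> = (\<Sum>s\<in>sign_vectors n. \<integral>\<^sup>+u. ennreal (?h s u / ?N) \<partial>?M)"
    using m by (intro nn_integral_sum) simp
  also have "\<dots> = (\<Sum>s\<in>sign_vectors n. ennreal (?S / 2 ^ n * (1 / ?N)))"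
  proof (rule sum.cong)
    fix s assume s: "s \<in> sign_vectors n"
    have "(\<integral>\<^sup>+u. ennreal (?h s u / ?N) \<partial>?M) = (\<integral>\<^sup>+u. ennreal (?h s u) * ennreal (1 / ?N) \<partial>?M)"
      by (intro nn_integral_cong, subst ennreal_mult[symmetric]) (auto simp: curv_measure_nonneg)
    also have "\<dots> = ennreal (?S / 2 ^ n) * ennreal (1 / ?N)"
      using m[of s] h[OF s] by (simp add: nn_integral_multc)
    also have "\<dots> = ennreal (?S / 2 ^ n * (1 / ?N))"
      by (rule ennreal_mult[symmetric]) (simp_all add: curv_measure_nonneg sum_nonneg)
    finally show "(\<integral>\<^sup>+u. ennreal (?h s u / ?N) \<partial>?M) = ennreal (?S / 2 ^ n * (1 / ?N))" .
  qed simp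
  \<comment> \<open>There are \<open>2 ^ n\<close> sign vectors with equal contributions, which
    cancels the factor \<open>2 ^ n\<close> in the denominator.\<close>
  also have "\<dots> = ennreal (?S / ?N)"
    by (simp add: card_sign_vectors curv_measure_nonneg sum_nonneg ennreal_of_nat_eq_real_of_nat flip: ennreal_mult)
  finally have int: "(\<integral>\<^sup>+u. ennreal ((\<Sum>s\<in>sign_vectors n. ?h s u) / ?N) \<partial>?M) = ennreal (?S / ?N)" .
  show ?thesis
    unfolding avg S
  proof (rule has_bochner_integral_nn_integral)
    show "(\<lambda>u. (\<Sum>s\<in>sign_vectors n. ?h s u) / ?N) \<in> borel_measurable ?M"
      using m by (intro borel_measurable_divide borel_measurable_sum) auto
    show "AE u in ?M. 0 \<le> (\<Sum>s\<in>sign_vectors n. ?h s u) / ?N"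
      by (intro AE_I2 divide_nonneg_nonneg sum_nonneg) (auto simp: curv_measure_nonneg)
    show "0 \<le> ?S / ?N" by (intro divide_nonneg_nonneg sum_nonneg) (auto simp: curv_measure_nonneg)
  qed (rule int)
qed

end
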